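(* Let $n\ge1$ and let $\lambda$ be a partition with at most $n$ parts such that $|\lambda|$ is even. Write $\lambda=\sum_{i=1}^n a_i\,\omega_{n+1-i}$ (so $a_i$ is the number of columns of $\lambda$ of height $n+1-i$), put $s_k=\sum_{i=1}^k a_i$, and let $b_i=a_i+1$ if $a_i$ is odd and $s_i$ is odd, $b_i=a_i-1$ if $a_i$ is odd and $s_i$ is even, and $b_i=a_i$ if $a_i$ is even. Then the smallest power of $t$ in $K^{C_n}_{\lambda,0}(t)$ (i.e. the smallest exponent occurring with nonzero coefficient) is $$\frac12\sum_{i=1}^n(n+1-i)\,b_i=\frac{|\lambda|}2+\frac12\sum_{i:\ a_i\text{ odd}}(-1)^{s_i-1}(n+1-i).$$
   Context: For $\mathfrak{sp}_{2n}$ (type $C_n$) with positive roots $R_+$, Weyl group $W$, length function $\ell$, half-sum $\rho$ of positive roots, let $\prod_{\alpha\in R_+}\frac1{1-te^\alpha}=\sum_\beta P_t(\beta)e^\beta$. For a partition $\lambda$ with at most $n$ parts, viewed as the dominant weight $\sum_i\lambda_i\varepsilon_i$, the generalized exponent is $K^{C_n}_{\lambda,0}(t)=\sum_{w\in W}(-1)^{\ell(w)}P_t(w(\lambda+\rho)-\rho)$. Here $\omega_j=\varepsilon_1+\cdots+\varepsilon_j$, and $|\lambda|$ is the sum of the parts of $\lambda$. *)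

theory Defs
  imports
    "HOL-Library.Function_Algebras"
    "HOL-Library.Poly_Mapping"
    "HOL-Computational_Algebra.Formal_Power_Series"
    "HOL-Combinatorics.Permutations"
begin

text \<open>
  A weight of \<open>sp\<^sub>2\<^sub>n\<close> is given by its integer coordinates with respect to
  \<open>\<epsilon>\<^sub>1, \<dots>, \<epsilon>\<^sub>n\<close>; the coordinates outside \<open>{1..n}\<close> are irrelevant and are
  \<open>0\<close> for all weights used below.  Addition is pointwise (\<open>Function_Algebras\<close>).
\<close>

type_synonym weight = "nat \<Rightarrow> int"

definition eps :: "nat \<Rightarrow> weight" where
  "eps i = (\<lambda>k. if k = i then 1 else 0)"

definition fund_weight :: "nat \<Rightarrow> weight" where
  "fund_weight j = (\<Sum>i = 1..j. eps i)"

definition pos_roots :: "nat \<Rightarrow> weight set" where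
  "pos_roots n =
     {eps i - eps j | i j. 1 \<le> i \<and> i < j \<and> j \<le> n} \<union>
     {eps i + eps j | i j. 1 \<le> i \<and> i < j \<and> j \<le> n} \<union>
     {eps i + eps i | i. 1 \<le> i \<and> i \<le> n}"

text \<open>The sum of the positive roots has even coordinates, so \<open>div\<close> is exact here
 .\<close>

definition half_sum :: "nat \<Rightarrow> weight" where
  "half_sum n = (\<lambda>k. (\<Sum>\<alpha>\<in>pos_roots n. \<alpha> k) div 2)"

definition simple_root :: "nat \<Rightarrow> nat \<Rightarrow> weight" where
  "simple_root n i = (if i < n then eps i - eps (Suc i) else eps n + eps n)"

definition inner_weight :: "nat \<Rightarrow> weight \<Rightarrow> weight \<Rightarrow> int" where
  "inner_weight n v u = (\<Sum>k = 1..n. v k * u k)"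

text \<open>The orthogonal reflection in the hyperplane perpendicular to \<open>\<alpha>\<close>.  For a root
  \<open>\<alpha>\<close> of type \<open>C\<^sub>n\<close> and an integral \<open>v\<close> the quotient is an integer, so \<open>div\<close> is exact.\<close>

definition reflection :: "nat \<Rightarrow> weight \<Rightarrow> weight \<Rightarrow> weight" where
  "reflection n \<alpha> v =
     (\<lambda>k. v k - (2 * inner_weight n v \<alpha> div inner_weight n \<alpha> \<alpha>) * \<alpha> k)"

definition weyl_word :: "nat \<Rightarrow> nat list \<Rightarrow> weight \<Rightarrow> weight" where
  "weyl_word n is = foldr (\<lambda>i f. reflection n (simple_root n i) \<circ> f) is id"

text \<open>The simple reflections are involutions, so the group they generate consists of the
  products of simple reflections.\<close>

definition weyl_group :: "nat \<Rightarrow> (weight \<Rightarrow> weight) set" where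
  "weyl_group n = weyl_word n ` lists {1..n}"

definition weyl_length :: "nat \<Rightarrow> (weight \<Rightarrow> weight) \<Rightarrow> nat" where
  "weyl_length n w = (LEAST l. \<exists>is \<in> lists {1..n}. length is = l \<and> weyl_word n is = w)"

text \<open>
  \<open>weight \<Rightarrow>\<^sub>0 int\<close> is the group ring of the weights, \<open>Poly_Mapping.single \<alpha> 1\<close> being
  \<open>e\<^sup>\<alpha>\<close>; power series in \<open>t\<close> are taken over it.  The type carries no \<open>inverse\<close>, so
  \<open>1 / (1 - t e\<^sup>\<alpha>)\<close> is written as a geometric series (see \<open>geometric_root_inverse\<close>).
\<close>

definition geometric_root :: "weight \<Rightarrow> (weight \<Rightarrow>\<^sub>0 int) fps" where
  "geometric_root \<alpha> = Abs_fps (\<lambda>k. Poly_Mapping.single \<alpha> 1 ^ k)"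

definition kostant_series :: "nat \<Rightarrow> (weight \<Rightarrow>\<^sub>0 int) fps" where
  "kostant_series n = (\<Prod>\<alpha>\<in>pos_roots n. geometric_root \<alpha>)"

text \<open>The coefficient of \<open>e\<^sup>\<beta>\<close>, as a series in \<open>t\<close>.\<close>

definition kostant_partition :: "nat \<Rightarrow> weight \<Rightarrow> int fps" where
  "kostant_partition n \<beta> = Abs_fps (\<lambda>k. Poly_Mapping.lookup (fps_nth (kostant_series n) k) \<beta>)"

definition gen_exponent :: "nat \<Rightarrow> weight \<Rightarrow> int fps" where
  "gen_exponent n \<mu> =
     (\<Sum>w\<in>weyl_group n. (-1) ^ weyl_length n w *
        kostant_partition n (w (\<mu> + half_sum n) - half_sum n))"

text \<open>\<open>p i\<close> is the \<open>i\<close>-th part, \<open>i \<ge> 1\<close>; the unused index \<open>0\<close> carries the value \<open>0\<close>.\<close>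

definition is_partition :: "nat \<Rightarrow> (nat \<Rightarrow> nat) \<Rightarrow> bool" where
  "is_partition n p \<longleftrightarrow> p 0 = 0 \<and> (\<forall>i\<ge>1. p (Suc i) \<le> p i) \<and> (\<forall>i>n. p i = 0)"

definition partition_weight :: "(nat \<Rightarrow> nat) \<Rightarrow> weight" where
  "partition_weight p = (\<lambda>i. int (p i))"

definition partial_sum :: "(nat \<Rightarrow> nat) \<Rightarrow> nat \<Rightarrow> nat" where
  "partial_sum a k = (\<Sum>i = 1..k. a i)"

definition even_adjust :: "(nat \<Rightarrow> nat) \<Rightarrow> nat \<Rightarrow> int" where
  "even_adjust a i =
     (if odd (a i) then if odd (partial_sum a i) then int (a i) + 1 else int (a i) - 1
      else int (a i))"

lemma geometric_root_inverse:
  "geometric_root \<alpha> * (1 - fps_const (Poly_Mapping.single \<alpha> 1) * fps_X) = 1"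
proof (rule fps_ext)
  fix k
  let ?e = "Poly_Mapping.single \<alpha> (1 :: int)"
  have "geometric_root \<alpha> * (1 - fps_const ?e * fps_X)
      = geometric_root \<alpha> - fps_const ?e * geometric_root \<alpha> * fps_X"
    by (simp add: right_diff_distrib mult_ac)
  then show "fps_nth (geometric_root \<alpha> * (1 - fps_const ?e * fps_X)) k = fps_nth 1 k"
    by (cases k) (simp_all add: geometric_root_def)
qed

lemma finite_pos_roots: "finite (pos_roots n)"
proof -
  let ?D = "(\<lambda>(i, j). eps i - eps j) ` ({1..n} \<times> {1..n})"
  let ?S = "(\<lambda>(i, j). eps i + eps j) ` ({1..n} \<times> {1..n})"
  have D: "eps i - eps j \<in> ?D" and S: "eps i + eps j \<in> ?S"
    if "1 \<le> i" "i \<le> n" "1 \<le> j" "j \<le> n" for i j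
    using that by (intro image_eqI[of _ _ "(i, j)"]; simp)+
  have "pos_roots n \<subseteq> ?D \<union> ?S"
    unfolding pos_roots_def
  proof (intro Un_least subsetI)
    fix x assume "x \<in> {eps i - eps j | i j. 1 \<le> i \<and> i < j \<and> j \<le> n}"
    then obtain i j where "x = eps i - eps j" "1 \<le> i" "i < j" "j \<le> n" by blast
    moreover from this have "i \<le> n" "1 \<le> j" by linarith+
    ultimately show "x \<in> ?D \<union> ?S" using D[of i j] by (simp only: Un_iff simp_thms)
  next
    fix x assume "x \<in> {eps i + eps j | i j. 1 \<le> i \<and> i < j \<and> j \<le> n}"
    then obtain i j where "x = eps i + eps j" "1 \<le> i" "i < j" "j \<le> n" by blast
    moreover from this have "i \<le> n" "1 \<le> j" by linarith+
    ultimately show "x \<in> ?D \<union> ?S" using S[of i j] by (simp only: Un_iff simp_thms)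
  next
    fix x assume "x \<in> {eps i + eps i | i. 1 \<le> i \<and> i \<le> n}"
    then obtain i where "x = eps i + eps i" "1 \<le> i" "i \<le> n" by blast
    then show "x \<in> ?D \<union> ?S" using S[of i i] by (simp only: Un_iff simp_thms)
  qed
  then show ?thesis
    by (rule finite_subset) (intro finite_UnI finite_imageI finite_cartesian_product finite_atLeastAtMost)
qed

lemma inner_eps_left:
  assumes "i \<in> {1..n}"
  shows "inner_weight n v (\<lambda>k. c * eps i k) = c * v i"
proof -
  have "(\<Sum>k = 1..n. v k * (c * eps i k)) = (\<Sum>k = 1..n. if k = i then c * v i else 0)"
    by (rule sum.cong) (auto simp: eps_def)
  then show ?thesis
    using assms by (simp add: inner_weight_def)
qed

lemma inner_weight_add: "inner_weight n v (u + u') = inner_weight n v u + inner_weight n v u'"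
  by (simp add: inner_weight_def distrib_left sum.distrib)

lemma inner_weight_diff: "inner_weight n v (u - u') = inner_weight n v u - inner_weight n v u'"
  by (simp add: inner_weight_def right_diff_distrib sum_subtractf)

lemma inner_weight_eps: "i \<in> {1..n} \<Longrightarrow> inner_weight n v (eps i) = v i"
  using inner_eps_left[of i n v 1] by simp

lemma simple_reflection_less:
  assumes "1 \<le> i" "i < n"
  shows "reflection n (simple_root n i) v = v \<circ> Transposition.transpose i (Suc i)"
proof
  fix k
  have "inner_weight n u (simple_root n i) = u i - u (Suc i)" for u
    using assms by (simp add: simple_root_def inner_weight_diff inner_weight_eps)
  then show "reflection n (simple_root n i) v k = (v \<circ> Transposition.transpose i (Suc i)) k"
    using assms by (auto simp: reflection_def simple_root_def eps_def Transposition.transpose_def)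
qed

lemma simple_reflection_last:
  assumes "1 \<le> n"
  shows "reflection n (simple_root n n) v = v(n := - v n)"
proof
  fix k
  have "simple_root n n = eps n + eps n"
    by (simp only: simple_root_def less_irrefl if_False)
  then have "inner_weight n u (simple_root n n) = 2 * u n" for u
    using assms by (simp only: inner_weight_add) (simp add: inner_weight_eps)
  then show "reflection n (simple_root n n) v k = (v(n := - v n)) k"
    using assms by (auto simp: reflection_def simple_root_def eps_def)
qed

lemma weyl_word_signed_permutation:
  assumes "is \<in> lists {1..n}"
  shows "\<exists>\<pi> s. \<pi> permutes {1..n} \<and> s \<in> {1..n} \<rightarrow>\<^sub>E {1, -1} \<and>
    weyl_word n is = (\<lambda>v k. (if k \<in> {1..n} then s k else 1) * v (\<pi> k))"
  using assms
proof (induction "is")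
  case Nil
  have "(id :: nat \<Rightarrow> nat) permutes {1..n}"
    by (rule permutes_id)
  moreover have "(\<lambda>k\<in>{1..n}. 1 :: int) \<in> {1..n} \<rightarrow>\<^sub>E {1, -1}"
    by (simp add: restrict_PiE_iff)
  moreover have "weyl_word n [] =
      (\<lambda>v k. (if k \<in> {1..n} then (\<lambda>k\<in>{1..n}. 1 :: int) k else 1) * v (id k))"
    by (intro ext) (simp add: weyl_word_def)
  ultimately show ?case
    by (intro exI conjI)
next
  case (Cons i "is")
  then obtain \<pi> s where \<pi>: "\<pi> permutes {1..n}" and s: "s \<in> {1..n} \<rightarrow>\<^sub>E {1, -1}"
    and w: "weyl_word n is = (\<lambda>v k. (if k \<in> {1..n} then s k else 1) * v (\<pi> k))"
    by auto
  have i: "1 \<le> i" "i \<le> n" using Cons.hyps by auto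
  have step: "weyl_word n (i # is) v = reflection n (simple_root n i) (weyl_word n is v)" for v
    by (simp add: weyl_word_def)
  show ?case
  proof (cases "i < n")
    case True
    let ?\<tau> = "Transposition.transpose i (Suc i)"
    have \<tau>: "?\<tau> permutes {1..n}" using i True by (intro permutes_swap_id) auto
    have mem: "?\<tau> k \<in> {1..n} \<longleftrightarrow> k \<in> {1..n}" for k
      using permutes_in_image[OF \<tau>] .
    have "s (?\<tau> k) \<in> {1, -1}" if "k \<in> {1..n}" for k
      using PiE_mem[OF s, of "?\<tau> k"] mem[of k] that by simp
    then have s': "(\<lambda>k\<in>{1..n}. s (?\<tau> k)) \<in> {1..n} \<rightarrow>\<^sub>E {1, -1}"
      by (simp only: restrict_PiE_iff) simp
    have "weyl_word n (i # is) v k =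
        (if k \<in> {1..n} then (\<lambda>k\<in>{1..n}. s (?\<tau> k)) k else 1) * v ((\<pi> \<circ> ?\<tau>) k)" for v k
      by (simp only: step simple_reflection_less[OF i(1) True] w comp_apply mem restrict_apply
          if_True cong: if_cong)
    then have "weyl_word n (i # is) =
        (\<lambda>v k. (if k \<in> {1..n} then (\<lambda>k\<in>{1..n}. s (?\<tau> k)) k else 1) * v ((\<pi> \<circ> ?\<tau>) k))"
      by (intro ext)
    with s' permutes_compose[OF \<tau> \<pi>] show ?thesis
      by (intro exI conjI)
  next
    case False
    with i have i_n: "i = n" and n: "1 \<le> n" by auto
    have s': "s(n := - s n) \<in> {1..n} \<rightarrow>\<^sub>E {1, -1}"
      using s n by (auto simp: PiE_iff extensional_def)
    have "weyl_word n (i # is) v k =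
        (if k \<in> {1..n} then (s(n := - s n)) k else 1) * v (\<pi> k)" for v k
      using n by (simp add: step[unfolded i_n] i_n simple_reflection_last w)
    then have "weyl_word n (i # is) =
        (\<lambda>v k. (if k \<in> {1..n} then (s(n := - s n)) k else 1) * v (\<pi> k))"
      by (intro ext)
    with s' \<pi> show ?thesis
      by (intro exI conjI)
  qed
qed

lemma finite_weyl_group: "finite (weyl_group n)"
proof (rule finite_subset)
  let ?act = "\<lambda>(\<pi>, s) (v :: weight) k. (if k \<in> {1..n} then s k else 1) * v (\<pi> k)"
  let ?S = "{\<pi>. \<pi> permutes {1..n}} \<times> ({1..n} \<rightarrow>\<^sub>E {1, -1})"
  show "weyl_group n \<subseteq> ?act ` ?S"
  proof
    fix w assume "w \<in> weyl_group n"
    then obtain "is" where "is \<in> lists {1..n}" "w = weyl_word n is"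
      by (auto simp only: weyl_group_def)
    then obtain \<pi> s where "\<pi> permutes {1..n}" "s \<in> {1..n} \<rightarrow>\<^sub>E {1, -1}" "w = ?act (\<pi>, s)"
      using weyl_word_signed_permutation[of "is" n] by (simp only: prod.case) blast
    then show "w \<in> ?act ` ?S"
      by (intro image_eqI[of _ _ "(\<pi>, s)"]) (simp_all only: mem_Sigma_iff mem_Collect_eq)
  qed
  have "finite {\<pi>. \<pi> permutes {1..n}}"
    by (rule finite_permutations) simp
  moreover have "finite ({1..n} \<rightarrow>\<^sub>E {1 :: int, -1})"
    by (rule finite_PiE) simp_all
  ultimately show "finite (?act ` ?S)"
    by blast
qed

end

theory Submission
  imports Defs "HOL-Library.Multiset"
begin

text \<open>
  Write \<open>x\<^sub>i = e\<^sup>\<epsilon>\<^sup>i\<close>.  Antisymmetrizing the Kostant series and pulling out the Weyl invariant factor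
  \<open>\<Prod> 1/(1 - t e\<^sup>\<alpha>)\<close> over all roots leaves an antisymmetric Laurent polynomial with so few exponents
  that it is a multiple \<open>c(t)\<close> of the Weyl denominator, with \<open>c(0) \<noteq> 0\<close>.  So the lowest exponent is the smallest
  degree \<open>d\<close> in which \<open>e\<^sup>\<lambda>\<^sup>+\<^sup>\<rho>\<close> has a nonzero coefficient in \<open>\<theta> = e\<^sup>\<rho> \<Prod>\<^bsub>\<alpha>>0\<^esub> (1 - e\<^sup>-\<^sup>\<alpha>) \<Prod> 1/(1 - t e\<^sup>\<alpha>)\<close>;
  it turns out to be \<open>\<Sum> \<lceil>\<lambda>\<^sub>i / 2\<rceil>\<close>.

  Let the excess be \<open>2d - |\<lambda>|\<close>.  At excess \<open>0\<close> only \<open>\<Prod>\<^bsub>i\<le>j\<^esub> 1/(1 - t x\<^sub>i x\<^sub>j)\<close> contributes, and Littlewood's identity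
  gives coefficient \<open>1\<close> if all parts of \<open>\<lambda>\<close> are even, and \<open>0\<close> otherwise.  The derivation \<open>2t d/dt - \<Sum> x\<^sub>i d/dx\<^sub>i\<close>
  multiplies a coefficient by its excess, and applied to the product \<open>\<theta>\<close> it expresses the result by coefficients of smaller
  excess, at weights where one or two entries are moved by \<open>\<plusminus>k\<close>.  Moving an entry by \<open>k\<close> destroys at most \<open>k\<close>
  odd parts, and destroys \<open>k\<close> only if it raises or lowers a vertical strip of \<open>k\<close> equal odd parts by one.  By induction on the excess the
  coefficient vanishes if there are more odd parts than the excess; if there are exactly as many, it
  depends only on the multiset of the odd parts, and the recursion, in which all signs cancel,
  shows it to be positive when their number is even.
\<close>

subsection \<open>Power series over the group ring\<close>

text \<open>In every term of the recursion the excess falls by at least the number of odd parts that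
  the moves can destroy. Two opposite moves by \<open>k\<close> in degree \<open>d - k\<close>, two
  upward moves by \<open>k\<close> in degree \<open>d\<close> and one by \<open>2k\<close> in degree
  \<open>d\<close> lower it by \<open>2k\<close>, and only these reach the extremal case. Upward
  moves in degree \<open>d - k\<close> lower it by \<open>4k\<close>, and the unmoved term by
  \<open>2k\<close> without destroying anything. Resorting after a move by \<open>k\<close> costs
  \<open>k - 1\<close> swaps, so pairs of moves by \<open>k\<close> count positively and a move by
  \<open>2k\<close> negatively, which its coefficient -1 repairs; the coefficient 2 of the opposite
  pairs outweighs the -1 of the upward ones.

  An even \<open>|\<lambda>|\<close> means an even number of odd parts; since block pairs remove
  \<open>2k\<close> parts, positivity passes from even sizes to even sizes.

  The closed formula is the sum of the \<open>\<lceil>\<lambda>_i / 2\<rceil>\<close>: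
  \<open>s_m\<close> is the part \<open>\<lambda>_(n+1-m)\<close>, and
  \<open>b_1 + ... + b_m\<close> is \<open>s_m\<close> rounded up to an even number.\<close>

type_synonym weight_series = "(weight \<Rightarrow>\<^sub>0 int) fps"

definition coef :: "weight_series \<Rightarrow> nat \<Rightarrow> weight \<Rightarrow> int" where
  "coef F d \<kappa> = Poly_Mapping.lookup (fps_nth F d) \<kappa>"

definition emon :: "weight \<Rightarrow> weight_series" where
  "emon \<alpha> = fps_const (Poly_Mapping.single \<alpha> 1)"

definition tmon :: "weight \<Rightarrow> weight_series" where
  "tmon \<alpha> = emon \<alpha> * fps_X"

lemma coef_eqI: "(\<And>d \<kappa>. coef F d \<kappa> = coef G d \<kappa>) \<Longrightarrow> F = G"
  unfolding coef_def by (intro fps_ext poly_mapping_eqI) simp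

lemma coef_0 [simp]: "coef 0 d \<kappa> = 0"
  by (simp add: coef_def)

lemma coef_add [simp]: "coef (F + G) d \<kappa> = coef F d \<kappa> + coef G d \<kappa>"
  by (simp add: coef_def lookup_add)

lemma coef_diff [simp]: "coef (F - G) d \<kappa> = coef F d \<kappa> - coef G d \<kappa>"
  by (simp add: coef_def lookup_minus)

lemma coef_uminus [simp]: "coef (- F) d \<kappa> = - coef F d \<kappa>"
  by (simp add: coef_def)

lemma coef_sum: "coef (\<Sum>i\<in>I. F i) d \<kappa> = (\<Sum>i\<in>I. coef (F i) d \<kappa>)"
  by (induction I rule: infinite_finite_induct) auto

lemma coef_1: "coef 1 d \<kappa> = (if d = 0 \<and> \<kappa> = 0 then 1 else 0)"
  by (auto simp: coef_def lookup_one)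

lemma coef_emon: "coef (emon \<alpha>) d \<kappa> = (if d = 0 \<and> \<kappa> = \<alpha> then 1 else 0)"
  by (auto simp: coef_def emon_def lookup_single when_def)

lemma emon_0 [simp]: "emon 0 = 1"
  by (simp add: emon_def)

lemma emon_add: "emon (\<alpha> + \<beta>) = emon \<alpha> * emon \<beta>"
  by (simp add: emon_def mult_single)

lemma emon_sum: "finite I \<Longrightarrow> emon (\<Sum>i\<in>I. v i) = (\<Prod>i\<in>I. emon (v i))"
  by (induction I rule: finite_induct)
     (simp_all only: sum.empty prod.empty emon_0 sum.insert prod.insert emon_add not_False_eq_True)

text \<open>Weights form a group, so the second exponent is determined by the first and the
  convolution is a finite sum over one support.\<close>

lemma lookup_mult_keys:
  fixes p q :: "weight \<Rightarrow>\<^sub>0 int"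
  shows "Poly_Mapping.lookup (p * q) \<kappa>
    = (\<Sum>a\<in>Poly_Mapping.keys p. Poly_Mapping.lookup p a * Poly_Mapping.lookup q (\<kappa> - a))"
proof -
  have eq: "(\<kappa> = l + r) = (r = \<kappa> - l)" for l r :: weight
    by (metis add_diff_cancel_left' diff_add_cancel add.commute)
  have "(\<Sum>r. Poly_Mapping.lookup q r when \<kappa> = l + r) = Poly_Mapping.lookup q (\<kappa> - l)" for l
    by (simp add: eq)
  then have "Poly_Mapping.lookup (p * q) \<kappa>
      = (\<Sum>l. Poly_Mapping.lookup p l * Poly_Mapping.lookup q (\<kappa> - l))"
    by (simp add: lookup_mult)
  also have "\<dots> = (\<Sum>a\<in>Poly_Mapping.keys p. Poly_Mapping.lookup p a * Poly_Mapping.lookup q (\<kappa> - a))"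
    by (rule Sum_any.expand_superset) (auto simp: in_keys_iff)
  finally show ?thesis .
qed

lemma coef_mult_const:
  "coef (fps_const (Poly_Mapping.single \<alpha> c) * F) d \<kappa> = c * coef F d (\<kappa> - \<alpha>)"
proof (cases "c = 0")
  case False
  then show ?thesis
    by (simp add: coef_def lookup_mult_keys)
qed (simp add: coef_def)

lemma coef_emon_mult [simp]: "coef (emon \<alpha> * F) d \<kappa> = coef F d (\<kappa> - \<alpha>)"
  by (simp add: emon_def coef_mult_const)

lemma coef_tmon_mult [simp]:
  "coef (tmon \<alpha> * F) d \<kappa> = (if d = 0 then 0 else coef F (d - 1) (\<kappa> - \<alpha>))"
proof -
  have "tmon \<alpha> * F = fps_X * (emon \<alpha> * F)"
    by (simp add: tmon_def mult_ac)
  moreover have "coef (fps_X * G) d \<kappa> = (if d = 0 then 0 else coef G (d - 1) \<kappa>)" for G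
    by (simp add: coef_def)
  ultimately show ?thesis
    by (simp only: coef_emon_mult)
qed

lemma finite_coef: "finite {\<kappa>. coef F d \<kappa> \<noteq> 0}"
  by (simp add: coef_def)

lemma coef_mult_neq_0D:
  assumes "coef (F * G) d \<kappa> \<noteq> 0"
  obtains i a where "i \<le> d" "coef F i a \<noteq> 0" "coef G (d - i) (\<kappa> - a) \<noteq> 0"
proof -
  have "coef (F * G) d \<kappa> = (\<Sum>i=0..d. Poly_Mapping.lookup (fps_nth F i * fps_nth G (d - i)) \<kappa>)"
    by (simp add: coef_def fps_mult_nth lookup_sum)
  with assms have "(\<Sum>i=0..d. Poly_Mapping.lookup (fps_nth F i * fps_nth G (d - i)) \<kappa>) \<noteq> 0"
    by simp
  then obtain i where i: "i \<in> {0..d}"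
      "Poly_Mapping.lookup (fps_nth F i * fps_nth G (d - i)) \<kappa> \<noteq> 0"
    by (rule sum.not_neutral_contains_not_neutral)
  from i(2) obtain a where "a \<in> Poly_Mapping.keys (fps_nth F i)"
      "Poly_Mapping.lookup (fps_nth F i) a * Poly_Mapping.lookup (fps_nth G (d - i)) (\<kappa> - a) \<noteq> 0"
    unfolding lookup_mult_keys by (rule sum.not_neutral_contains_not_neutral)
  with i show ?thesis
    by (intro that[of i a]) (auto simp: coef_def)
qed

subsection \<open>Linear changes of the exponents\<close>

definition additive_bij :: "(weight \<Rightarrow> weight) \<Rightarrow> bool" where
  "additive_bij w \<longleftrightarrow> bij w \<and> (\<forall>u v. w (u + v) = w u + w v)"

text \<open>The coefficient at \<open>\<kappa>\<close> is read at \<open>w \<kappa>\<close>, as in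
  \<open>gen_exponent\<close>. So \<open>e^(w \<alpha>)\<close> goes to \<open>e^\<alpha>\<close>,
  and composition reverses the order.\<close>

definition pullback :: "(weight \<Rightarrow> weight) \<Rightarrow> weight_series \<Rightarrow> weight_series" where
  "pullback w F = Abs_fps (\<lambda>d. Poly_Mapping.map_key w (fps_nth F d))"

lemma additive_bij_diff:
  assumes "additive_bij w" shows "w (u - v) = w u - w v"
proof -
  have "w u = w (u - v) + w v"
    using assms by (metis additive_bij_def diff_add_cancel)
  then show ?thesis by simp
qed

lemma additive_bij_comp: "additive_bij w \<Longrightarrow> additive_bij w' \<Longrightarrow> additive_bij (w \<circ> w')"
  by (auto simp: additive_bij_def bij_comp)

lemma coef_pullback: "additive_bij w \<Longrightarrow> coef (pullback w F) d \<kappa> = coef F d (w \<kappa>)"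
  by (simp add: coef_def pullback_def additive_bij_def bij_is_inj map_key.rep_eq)

lemma pullback_diff: "additive_bij w \<Longrightarrow> pullback w (F - G) = pullback w F - pullback w G"
  by (rule coef_eqI) (simp add: coef_pullback)

lemma pullback_uminus: "additive_bij w \<Longrightarrow> pullback w (- F) = - pullback w F"
  by (rule coef_eqI) (simp add: coef_pullback)

lemma pullback_comp:
  "additive_bij w \<Longrightarrow> additive_bij w' \<Longrightarrow> pullback w' (pullback w F) = pullback (w \<circ> w') F"
  by (rule coef_eqI) (simp add: coef_pullback additive_bij_comp)

lemma pullback_id: "pullback id F = F"
  by (rule coef_eqI) (simp add: coef_pullback additive_bij_def)

lemma pullback_mult:
  assumes w: "additive_bij w"
  shows "pullback w (F * G) = pullback w F * pullback w G"
proof (rule fps_ext)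
  have inj: "inj w" and surj: "surj w" using w by (auto simp: additive_bij_def bij_def)
  have mult: "Poly_Mapping.map_key w (p * q) = Poly_Mapping.map_key w p * Poly_Mapping.map_key w q"
    for p q :: "weight \<Rightarrow>\<^sub>0 int"
  proof (rule poly_mapping_eqI)
    fix \<kappa>
    have keys: "Poly_Mapping.keys p = w ` Poly_Mapping.keys (Poly_Mapping.map_key w p)"
      by (simp add: keys_map_key[OF inj] surj)
    have inj': "inj_on w A" for A using inj inj_on_subset by blast
    show "Poly_Mapping.lookup (Poly_Mapping.map_key w (p * q)) \<kappa>
        = Poly_Mapping.lookup (Poly_Mapping.map_key w p * Poly_Mapping.map_key w q) \<kappa>"
      by (simp add: map_key.rep_eq[OF inj] lookup_mult_keys keys sum.reindex[OF inj']
          additive_bij_diff[OF w])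
  qed
  have add: "Poly_Mapping.map_key w (\<Sum>i\<in>I. p i) = (\<Sum>i\<in>I. Poly_Mapping.map_key w (p i))"
    for I :: "nat set" and p
    by (induction I rule: infinite_finite_induct) (simp_all add: map_key_plus[OF inj] map_key_zero[OF inj])
  show "fps_nth (pullback w (F * G)) d = fps_nth (pullback w F * pullback w G) d" for d
    by (simp add: pullback_def fps_mult_nth add mult)
qed

lemma pullback_emon: "additive_bij w \<Longrightarrow> pullback w (emon (w \<alpha>)) = emon \<alpha>"
  by (rule coef_eqI) (auto simp: coef_pullback coef_emon additive_bij_def bij_def inj_eq)

lemma pullback_1: "additive_bij w \<Longrightarrow> pullback w 1 = 1"
  using pullback_emon[of w 0] additive_bij_diff[of w 0 0] by simp

lemma pullback_X: "additive_bij w \<Longrightarrow> pullback w fps_X = fps_X"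
proof (rule coef_eqI)
  fix d \<kappa> assume w: "additive_bij w"
  have *: "coef fps_X d \<kappa> = (if d = 1 \<and> \<kappa> = 0 then 1 else 0)" for \<kappa>
    by (simp add: coef_def fps_X_def lookup_one when_def)
  have "w \<kappa> = 0 \<longleftrightarrow> \<kappa> = 0"
    using w additive_bij_diff[of w 0 0] by (auto simp: additive_bij_def bij_def inj_def)
  then show "coef (pullback w fps_X) d \<kappa> = coef fps_X d \<kappa>"
    by (simp add: coef_pullback[OF w] *)
qed

lemma pullback_tmon: "additive_bij w \<Longrightarrow> pullback w (tmon (w \<alpha>)) = tmon \<alpha>"
  by (simp add: tmon_def pullback_mult pullback_emon pullback_X)

lemma pullback_prod:
  assumes "additive_bij w"
  shows "pullback w (\<Prod>i\<in>I. F i) = (\<Prod>i\<in>I. pullback w (F i))"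
  by (induction I rule: infinite_finite_induct) (simp_all add: assms pullback_mult pullback_1)

lemma geometric_root_tmon: "geometric_root \<alpha> * (1 - tmon \<alpha>) = 1"
  using geometric_root_inverse[of \<alpha>] by (simp add: tmon_def emon_def)

lemma geometric_root_unfold: "geometric_root \<alpha> = 1 + tmon \<alpha> * geometric_root \<alpha>"
  using geometric_root_tmon[of \<alpha>] by (simp add: algebra_simps)

text \<open>Stands in for division: it characterizes \<open>geometric_root\<close> as an
  inverse.\<close>

lemma right_inverse_unique:
  fixes F G H :: "'a::comm_ring_1"
  assumes "F * H = 1" "G * H = 1" shows "F = G"
proof -
  have "F = F * (G * H)" using assms by simp
  also have "\<dots> = G * (F * H)" by (simp add: mult_ac)
  finally show ?thesis using assms by simp
qed

lemma pullback_geometric_root: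
  assumes w: "additive_bij w"
  shows "pullback w (geometric_root (w \<alpha>)) = geometric_root \<alpha>"
proof (rule right_inverse_unique)
  have "pullback w (geometric_root (w \<alpha>) * (1 - tmon (w \<alpha>))) = pullback w 1"
    by (simp only: geometric_root_tmon)
  then show "pullback w (geometric_root (w \<alpha>)) * (1 - tmon \<alpha>) = 1"
    using w by (simp add: pullback_mult pullback_diff pullback_1 pullback_tmon)
qed (rule geometric_root_tmon)

subsection \<open>Gradings\<close>

text \<open>A valuation bound for the grading that gives \<open>t^d e^\<kappa>\<close> the weight
  \<open>c d + g \<kappa>\<close>. Various \<open>g\<close> and \<open>c\<close> single out the top
  term of the Weyl denominator, the excess, and single coordinates.\<close>

definition wt_ge :: "(weight \<Rightarrow> int) \<Rightarrow> int \<Rightarrow> int \<Rightarrow> weight_series \<Rightarrow> bool" where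
  "wt_ge g c a F \<longleftrightarrow> (\<forall>d \<kappa>. coef F d \<kappa> \<noteq> 0 \<longrightarrow> a \<le> c * int d + g \<kappa>)"

definition additive_form :: "(weight \<Rightarrow> int) \<Rightarrow> bool" where
  "additive_form g \<longleftrightarrow> (\<forall>u v. g (u + v) = g u + g v)"

lemma additive_form_diff: "additive_form g \<Longrightarrow> g (u - v) = g u - g v"
  by (metis add_diff_cancel_right' additive_form_def diff_add_cancel)

lemma additive_form_0: "additive_form g \<Longrightarrow> g 0 = 0"
  using additive_form_diff[of g 0 0] by simp

lemma additive_form_uminus: "additive_form g \<Longrightarrow> g (- v) = - g v"
  using additive_form_diff[of g 0 v] by (simp add: additive_form_0)

lemma wt_geD: "wt_ge g c a F \<Longrightarrow> coef F d \<kappa> \<noteq> 0 \<Longrightarrow> a \<le> c * int d + g \<kappa>"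
  by (simp add: wt_ge_def)

lemma wt_ge_mult:
  assumes g: "additive_form g" and F: "wt_ge g c a F" and G: "wt_ge g c b G"
  shows "wt_ge g c (a + b) (F * G)"
  unfolding wt_ge_def
proof (intro allI impI)
  fix d \<kappa> assume "coef (F * G) d \<kappa> \<noteq> 0"
  then obtain i v where "i \<le> d" and Fv: "coef F i v \<noteq> 0" and Gv: "coef G (d - i) (\<kappa> - v) \<noteq> 0"
    by (rule coef_mult_neq_0D)
  have "a \<le> c * int i + g v" by (rule wt_geD[OF F Fv])
  moreover have "b \<le> c * int (d - i) + g (\<kappa> - v)" by (rule wt_geD[OF G Gv])
  moreover have "g (\<kappa> - v) = g \<kappa> - g v" by (rule additive_form_diff[OF g])
  moreover have "c * int (d - i) = c * int d - c * int i"
    using \<open>i \<le> d\<close> by (simp add: of_nat_diff right_diff_distrib)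
  ultimately show "a + b \<le> c * int d + g \<kappa>" by linarith
qed

lemma wt_ge_add:
  assumes F: "wt_ge g c a F" and G: "wt_ge g c a G" shows "wt_ge g c a (F + G)"
  unfolding wt_ge_def
proof (intro allI impI)
  fix d \<kappa> assume "coef (F + G) d \<kappa> \<noteq> 0"
  then have "coef F d \<kappa> \<noteq> 0 \<or> coef G d \<kappa> \<noteq> 0" by (simp only: coef_add) auto
  then show "a \<le> c * int d + g \<kappa>" using wt_geD[OF F] wt_geD[OF G] by metis
qed

lemma wt_ge_uminus: "wt_ge g c a F \<Longrightarrow> wt_ge g c a (- F)"
  by (simp add: wt_ge_def)

lemma wt_ge_diff: "wt_ge g c a F \<Longrightarrow> wt_ge g c a G \<Longrightarrow> wt_ge g c a (F - G)"
  using wt_ge_add[of g c a F "- G"] wt_ge_uminus[of g c a G] by simp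

lemma wt_ge_mono: "wt_ge g c b F \<Longrightarrow> a \<le> b \<Longrightarrow> wt_ge g c a F"
  unfolding wt_ge_def by (meson order_trans)

lemma wt_ge_1: "additive_form g \<Longrightarrow> wt_ge g c 0 1"
  by (simp add: wt_ge_def coef_1 additive_form_0)

lemma wt_ge_emon: "g \<alpha> = a \<Longrightarrow> wt_ge g c a (emon \<alpha>)"
  by (simp add: wt_ge_def coef_emon)

lemma wt_ge_prod:
  assumes "additive_form g" "\<And>i. i \<in> I \<Longrightarrow> wt_ge g c 0 (F i)"
  shows "wt_ge g c 0 (\<Prod>i\<in>I. F i)"
  using assms(2)
proof (induction I rule: infinite_finite_induct)
  case (insert i I)
  then have "wt_ge g c (0 + 0) (F i * (\<Prod>i\<in>I. F i))"
    by (intro wt_ge_mult[OF assms(1)]) auto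
  with insert show ?case by simp
qed (simp_all add: wt_ge_1 assms)

text \<open>From \<open>F G - 1 = (F - 1) (G - 1) + (F - 1) + (G - 1)\<close>, where the product has
  weight at least \<open>2a \<ge> a\<close>.\<close>

lemma wt_ge_prod_minus_1:
  assumes g: "additive_form g" and "0 \<le> a" "\<And>i. i \<in> I \<Longrightarrow> wt_ge g c a (F i - 1)"
  shows "wt_ge g c a ((\<Prod>i\<in>I. F i) - 1)"
  using assms(3)
proof (induction I rule: infinite_finite_induct)
  case (insert i I)
  let ?P = "\<Prod>i\<in>I. F i"
  have "wt_ge g c (a + a) ((F i - 1) * (?P - 1))"
    using insert by (intro wt_ge_mult g) auto
  then have "wt_ge g c a ((F i - 1) * (?P - 1))"
    using \<open>0 \<le> a\<close> by (rule_tac wt_ge_mono) auto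
  moreover have "wt_ge g c a (F i - 1)" "wt_ge g c a (?P - 1)" using insert by auto
  moreover have "(\<Prod>i\<in>insert i I. F i) - 1 = (F i - 1) * (?P - 1) + (F i - 1) + (?P - 1)"
    using insert by (simp add: algebra_simps)
  ultimately show ?case
    by (simp only: wt_ge_add)
qed (simp_all add: wt_ge_def)

lemma coef_geometric_root:
  "coef (geometric_root \<alpha>) d \<kappa> = (if \<kappa> = (\<lambda>k. int d * \<alpha> k) then 1 else 0)"
proof (induction d arbitrary: \<kappa>)
  case 0
  then show ?case by (auto simp: coef_def geometric_root_def lookup_one when_def fun_eq_iff)
next
  case (Suc d)
  have "coef (geometric_root \<alpha>) (Suc d) \<kappa> = coef (tmon \<alpha> * geometric_root \<alpha>) (Suc d) \<kappa>"
    by (subst geometric_root_unfold) (simp add: coef_1)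
  also have "\<dots> = (if \<kappa> - \<alpha> = (\<lambda>k. int d * \<alpha> k) then 1 else 0)"
    by (simp only: Suc coef_tmon_mult diff_Suc_1 nat.distinct if_False)
  also have "\<kappa> - \<alpha> = (\<lambda>k. int d * \<alpha> k) \<longleftrightarrow> \<kappa> = (\<lambda>k. int (Suc d) * \<alpha> k)"
    by (simp add: fun_eq_iff algebra_simps)
  finally show ?case .
qed

lemma wt_ge_geometric_root_minus_1:
  assumes g: "additive_form g" and a: "c + g \<alpha> = a" "0 \<le> a"
  shows "wt_ge g c a (geometric_root \<alpha> - 1)"
  unfolding wt_ge_def
proof (intro allI impI)
  fix d \<kappa> assume *: "coef (geometric_root \<alpha> - 1) d \<kappa> \<noteq> 0"
  have sum: "g (\<lambda>k. int d * \<alpha> k) = int d * g \<alpha>" for d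
  proof (induction d)
    case 0
    then show ?case using additive_form_0[OF g] by (simp add: zero_fun_def)
  next
    case (Suc d)
    have "(\<lambda>k. int (Suc d) * \<alpha> k) = (\<lambda>k. int d * \<alpha> k) + \<alpha>"
      by (simp add: fun_eq_iff algebra_simps)
    then have "g (\<lambda>k. int (Suc d) * \<alpha> k) = g (\<lambda>k. int d * \<alpha> k) + g \<alpha>"
      using g by (simp only: additive_form_def)
    with Suc show ?case by (simp add: algebra_simps)
  qed
  from * have \<kappa>: "\<kappa> = (\<lambda>k. int d * \<alpha> k)" and "d \<noteq> 0"
    by (auto simp: coef_geometric_root coef_1 fun_eq_iff split: if_splits)
  then have "int d \<ge> 1" by simp
  then have "a \<le> int d * a" using a(2) by (simp add: mult_le_cancel_right1)
  also have "\<dots> = c * int d + g \<kappa>" unfolding \<kappa> sum a(1)[symmetric] by (simp add: algebra_simps)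
  finally show "a \<le> c * int d + g \<kappa>" .
qed

subsection \<open>Euler derivations\<close>

text \<open>Multiplies \<open>t^d e^\<kappa>\<close> by its weight in the grading of
  \<open>wt_ge\<close>; additivity of \<open>g\<close> makes this a derivation.\<close>

definition euler :: "(weight \<Rightarrow> int) \<Rightarrow> int \<Rightarrow> weight_series \<Rightarrow> weight_series" where
  "euler g c F = Abs_fps (\<lambda>d. Poly_Mapping.mapp (\<lambda>\<kappa> x. (c * int d + g \<kappa>) * x) (fps_nth F d))"

lemma coef_euler: "coef (euler g c F) d \<kappa> = (c * int d + g \<kappa>) * coef F d \<kappa>"
  by (simp add: coef_def euler_def lookup_mapp when_def in_keys_iff)

lemma euler_diff: "euler g c (F - G) = euler g c F - euler g c G"
  by (rule coef_eqI) (simp add: coef_euler algebra_simps)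

lemma coef_mult:
  "coef (F * G) d \<kappa> = (\<Sum>i=0..d. \<Sum>a\<in>{a. coef F i a \<noteq> 0}. coef F i a * coef G (d - i) (\<kappa> - a))"
  by (simp add: coef_def fps_mult_nth lookup_sum lookup_mult_keys keys.rep_eq)

lemma euler_mult:
  assumes g: "additive_form g"
  shows "euler g c (F * G) = euler g c F * G + F * euler g c G"
proof (rule coef_eqI)
  fix d \<kappa>
  \<comment> \<open>\<open>euler\<close> kills monomials of weight 0; summing over the support of
    \<open>F\<close> all the same lets both products be combined term by term.\<close>
  have superset: "coef (euler g c F * G) d \<kappa>
      = (\<Sum>i=0..d. \<Sum>a\<in>{a. coef F i a \<noteq> 0}. coef (euler g c F) i a * coef G (d - i) (\<kappa> - a))"
    unfolding coef_mult
    by (rule sum.cong[OF refl], rule sum.mono_neutral_left[OF finite_coef]) (auto simp: coef_euler)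
  have "coef (euler g c F * G) d \<kappa> + coef (F * euler g c G) d \<kappa>
      = (\<Sum>i=0..d. \<Sum>a\<in>{a. coef F i a \<noteq> 0}. (c * int d + g \<kappa>) * (coef F i a * coef G (d - i) (\<kappa> - a)))"
    unfolding superset coef_mult[of F] sum.distrib[symmetric]
    by (intro sum.cong refl) (simp add: coef_euler additive_form_diff[OF g] of_nat_diff algebra_simps)
  also have "\<dots> = coef (euler g c (F * G)) d \<kappa>"
    by (simp only: coef_euler coef_mult sum_distrib_left)
  finally show "coef (euler g c (F * G)) d \<kappa> = coef (euler g c F * G + F * euler g c G) d \<kappa>"
    by simp
qed

lemma euler_emon: "euler g c (emon \<alpha>) = of_int (g \<alpha>) * emon \<alpha>"
proof (rule coef_eqI)
  fix d \<kappa>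
  have "Poly_Mapping.single 0 k = (of_int k :: weight \<Rightarrow>\<^sub>0 int)" for k
    using single_of_int[of k, where 'a = weight and 'b = int] by simp
  then have "of_int k * F = fps_const (Poly_Mapping.single 0 k) * F" for k and F :: weight_series
    by (simp only: fps_of_int)
  then show "coef (euler g c (emon \<alpha>)) d \<kappa> = coef (of_int (g \<alpha>) * emon \<alpha>) d \<kappa>"
    by (simp add: coef_mult_const coef_euler coef_emon)
qed

subsection \<open>The root system\<close>

text \<open>The positive roots are split by \<open>coord_sum\<close>, which is 0 on difference roots
  and 2 on sum roots, long roots included; the excess sees only this.\<close>

definition diff_roots :: "nat \<Rightarrow> weight set" where
  "diff_roots n = {eps i - eps j | i j. 1 \<le> i \<and> i < j \<and> j \<le> n}"

definition sum_roots :: "nat \<Rightarrow> weight set" where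
  "sum_roots n = {eps i + eps j | i j. 1 \<le> i \<and> i \<le> j \<and> j \<le> n}"

definition simple_refl :: "nat \<Rightarrow> nat \<Rightarrow> weight \<Rightarrow> weight" where
  "simple_refl n i = reflection n (simple_root n i)"

lemma diff_rootsI: "1 \<le> i \<Longrightarrow> i < j \<Longrightarrow> j \<le> n \<Longrightarrow> eps i - eps j \<in> diff_roots n"
  unfolding diff_roots_def by blast

lemma sum_rootsI: "1 \<le> i \<Longrightarrow> i \<le> n \<Longrightarrow> 1 \<le> j \<Longrightarrow> j \<le> n \<Longrightarrow> eps i + eps j \<in> sum_roots n"
  unfolding sum_roots_def by (cases i j rule: le_cases) (auto, metis add.commute)

lemma pos_roots_Un: "pos_roots n = diff_roots n \<union> sum_roots n"
proof -
  have "sum_roots n = {eps i + eps j | i j. 1 \<le> i \<and> i < j \<and> j \<le> n} \<union>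
     {eps i + eps i | i. 1 \<le> i \<and> i \<le> n}" (is "_ = ?R")
  proof
    show "sum_roots n \<subseteq> ?R" unfolding sum_roots_def by (auto simp: le_less)
    show "?R \<subseteq> sum_roots n" unfolding sum_roots_def
      by (intro Un_least subsetI) (blast intro: less_imp_le)+
  qed
  then show ?thesis unfolding pos_roots_def diff_roots_def by (simp only: Un_assoc)
qed

lemma refl_less_apply: "1 \<le> i \<Longrightarrow> i < n \<Longrightarrow>
    simple_refl n i v k = (if k = i then v (Suc i) else if k = Suc i then v i else v k)"
  by (simp add: simple_refl_def simple_reflection_less Transposition.transpose_def)

lemma refl_last_apply: "1 \<le> n \<Longrightarrow> simple_refl n n v k = (if k = n then - v n else v k)"
  by (simp add: simple_refl_def simple_reflection_last)

lemma refl_add: "i \<in> {1..n} \<Longrightarrow> simple_refl n i (u + v) = simple_refl n i u + simple_refl n i v"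
  by (cases "i < n") (auto simp: fun_eq_iff refl_less_apply refl_last_apply)

lemma refl_refl: "i \<in> {1..n} \<Longrightarrow> simple_refl n i (simple_refl n i v) = v"
  by (cases "i < n") (auto simp: fun_eq_iff refl_less_apply refl_last_apply)

lemma additive_bij_refl: "i \<in> {1..n} \<Longrightarrow> additive_bij (simple_refl n i)"
  unfolding additive_bij_def by (auto intro!: o_bij[of "simple_refl n i"] simp: fun_eq_iff refl_refl refl_add)

lemma refl_diff: "i \<in> {1..n} \<Longrightarrow> simple_refl n i (u - v) = simple_refl n i u - simple_refl n i v"
  by (rule additive_bij_diff[OF additive_bij_refl])

lemma refl_uminus: "i \<in> {1..n} \<Longrightarrow> simple_refl n i (- v) = - simple_refl n i v"
  by (cases "i < n") (auto simp: fun_eq_iff refl_less_apply refl_last_apply)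

lemma refl_sum:
  assumes "i \<in> {1..n}"
  shows "simple_refl n i (\<Sum>x\<in>A. f x) = (\<Sum>x\<in>A. simple_refl n i (f x))"
proof -
  have "simple_refl n i 0 = 0" using refl_diff[OF assms, of 0 0] by simp
  then show ?thesis
    by (induction A rule: infinite_finite_induct)
       (simp_all only: sum.empty sum.infinite sum.insert refl_add[OF assms] not_False_eq_True)
qed

lemma refl_eps: "1 \<le> i \<Longrightarrow> i < n \<Longrightarrow> simple_refl n i (eps a) = eps (Transposition.transpose i (Suc i) a)"
  by (auto simp: fun_eq_iff refl_less_apply eps_def Transposition.transpose_def)

lemma refl_eps_last: "1 \<le> n \<Longrightarrow> simple_refl n n (eps a) = (if a = n then - eps n else eps a)"
  by (auto simp: fun_eq_iff refl_last_apply eps_def)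

lemma simple_root_last: "simple_root n n = eps n + eps n"
  by (simp only: simple_root_def less_irrefl if_False)

lemma refl_simple_root: "i \<in> {1..n} \<Longrightarrow> simple_refl n i (simple_root n i) = - simple_root n i"
proof (cases "i < n")
  case True
  assume "i \<in> {1..n}"
  with True show ?thesis
    by (simp add: fun_eq_iff refl_less_apply simple_root_def eps_def)
next
  case False
  assume "i \<in> {1..n}"
  with False have [simp]: "i = n" and "1 \<le> n" by auto
  then show ?thesis
    unfolding fun_eq_iff by (simp add: refl_last_apply simple_root_last eps_def)
qed

lemma simple_root_pos: "i \<in> {1..n} \<Longrightarrow> simple_root n i \<in> pos_roots n"
proof (cases "i < n")
  case True
  assume "i \<in> {1..n}"
  with True show ?thesis unfolding pos_roots_Un simple_root_def
    using diff_rootsI[of i "Suc i" n] by auto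
next
  case False
  assume "i \<in> {1..n}"
  with False have [simp]: "i = n" and "1 \<le> n" by auto
  then show ?thesis unfolding pos_roots_Un \<open>i = n\<close> simple_root_last
    using sum_rootsI[of n n n] by simp
qed

lemma refl_sum_roots_less:
  assumes i: "1 \<le> i" "i < n" and \<alpha>: "\<alpha> \<in> sum_roots n"
  shows "simple_refl n i \<alpha> \<in> sum_roots n"
proof -
  obtain a b where ab: "\<alpha> = eps a + eps b" "1 \<le> a" "a \<le> b" "b \<le> n"
    using \<alpha> unfolding sum_roots_def by blast
  let ?t = "Transposition.transpose i (Suc i)"
  have t: "1 \<le> ?t c \<and> ?t c \<le> n" if "1 \<le> c" "c \<le> n" for c
    using that i by (auto simp: Transposition.transpose_def)
  have "simple_refl n i \<alpha> = eps (?t a) + eps (?t b)"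
    using i unfolding ab(1) by (simp only: refl_add refl_eps atLeastAtMost_iff less_imp_le simp_thms)
  then show ?thesis
    using t[of a] t[of b] ab by (simp only:) (auto intro!: sum_rootsI)
qed

lemma refl_diff_roots_less:
  assumes i: "1 \<le> i" "i < n" and \<alpha>: "\<alpha> \<in> diff_roots n" "\<alpha> \<noteq> simple_root n i"
  shows "simple_refl n i \<alpha> \<in> diff_roots n"
proof -
  obtain a b where ab: "\<alpha> = eps a - eps b" "1 \<le> a" "a < b" "b \<le> n"
    using \<alpha> unfolding diff_roots_def by blast
  let ?t = "Transposition.transpose i (Suc i)"
  have "\<not> (a = i \<and> b = Suc i)"
    using \<alpha>(2) i unfolding ab(1) simple_root_def by auto
  then have t: "?t a < ?t b" "1 \<le> ?t a" "?t b \<le> n"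
    using ab(2-4) i by (auto simp: Transposition.transpose_def)
  have "simple_refl n i \<alpha> = eps (?t a) - eps (?t b)"
    using i unfolding ab(1) by (simp only: refl_diff refl_eps atLeastAtMost_iff less_imp_le simp_thms)
  then show ?thesis
    using t by (simp only:) (auto intro!: diff_rootsI)
qed

lemma refl_pos_roots:
  assumes i: "i \<in> {1..n}" and \<alpha>: "\<alpha> \<in> pos_roots n" "\<alpha> \<noteq> simple_root n i"
  shows "simple_refl n i \<alpha> \<in> pos_roots n"
proof (cases "i < n")
  case True
  then show ?thesis
    using assms refl_sum_roots_less[of i n \<alpha>] refl_diff_roots_less[of i n \<alpha>]
    by (auto simp: pos_roots_Un)
next
  case False
  with i have [simp]: "i = n" and n: "1 \<le> n" by auto
  have nn: "n \<in> {1..n}" using n by simp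
  show ?thesis
  proof (cases "\<alpha> \<in> diff_roots n")
    case True
    then obtain a b where ab: "\<alpha> = eps a - eps b" "1 \<le> a" "a < b" "b \<le> n"
      unfolding diff_roots_def by blast
    have "simple_refl n i \<alpha> = (if b = n then eps a + eps b else eps a - eps b)"
      unfolding ab(1) \<open>i = n\<close> refl_diff[OF nn] refl_eps_last[OF n] using ab by auto
    then show ?thesis
      using ab sum_rootsI[of a n b] diff_rootsI[of a b n] by (auto simp: pos_roots_Un)
  next
    case False
    with \<alpha> obtain a b where ab: "\<alpha> = eps a + eps b" "1 \<le> a" "a \<le> b" "b \<le> n"
      unfolding pos_roots_Un sum_roots_def by blast
    have "\<not> (a = n \<and> b = n)"
      using \<alpha>(2) unfolding ab(1) \<open>i = n\<close> simple_root_last by auto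
    with ab have "a \<noteq> n" by auto
    then have "simple_refl n i \<alpha> = (if b = n then eps a - eps b else eps a + eps b)"
      unfolding ab(1) \<open>i = n\<close> refl_add[OF nn] refl_eps_last[OF n] by auto
    then show ?thesis
      using ab \<open>a \<noteq> n\<close> sum_rootsI[of a n b] diff_rootsI[of a b n] by (auto simp: pos_roots_Un)
  qed
qed

text \<open>Largest at the dominant weight of each Weyl group orbit.\<close>

definition height :: "nat \<Rightarrow> weight \<Rightarrow> int" where
  "height n v = (\<Sum>k = 1..n. int (n + 1 - k) * v k)"

definition coord_sum :: "nat \<Rightarrow> weight \<Rightarrow> int" where
  "coord_sum n v = (\<Sum>k = 1..n. v k)"

lemma additive_form_height: "additive_form (height n)"
  by (simp add: additive_form_def height_def distrib_left sum.distrib)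

lemma additive_form_coord_sum: "additive_form (coord_sum n)"
  by (simp add: additive_form_def coord_sum_def sum.distrib)

lemma height_eps: "height n (eps i) = (if i \<in> {1..n} then int (n + 1 - i) else 0)"
proof -
  have "height n (eps i) = (\<Sum>k = 1..n. if k = i then int (n + 1 - i) else 0)"
    unfolding height_def by (rule sum.cong) (auto simp: eps_def)
  then show ?thesis by simp
qed

lemma coord_sum_eps: "coord_sum n (eps i) = (if i \<in> {1..n} then 1 else 0)"
proof -
  have "coord_sum n (eps i) = (\<Sum>k = 1..n. if k = i then 1 else 0)"
    unfolding coord_sum_def by (rule sum.cong) (auto simp: eps_def)
  then show ?thesis by simp
qed

lemma coord_sum_diff_roots: "\<alpha> \<in> diff_roots n \<Longrightarrow> coord_sum n \<alpha> = 0"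
  unfolding diff_roots_def
  by (auto simp: additive_form_diff[OF additive_form_coord_sum] coord_sum_eps)

lemma coord_sum_sum_roots: "\<alpha> \<in> sum_roots n \<Longrightarrow> coord_sum n \<alpha> = 2"
  unfolding sum_roots_def
  by (auto simp: additive_form_coord_sum[unfolded additive_form_def] coord_sum_eps)

lemma diff_roots_Int_sum_roots: "diff_roots n \<inter> sum_roots n = {}"
  using coord_sum_diff_roots coord_sum_sum_roots by fastforce

lemma finite_diff_roots: "finite (diff_roots n)" and finite_sum_roots: "finite (sum_roots n)"
  using finite_pos_roots[of n] by (simp_all add: pos_roots_Un)

lemma height_pos_root: "\<alpha> \<in> pos_roots n \<Longrightarrow> height n \<alpha> > 0"
proof -
  have add: "height n (u + v) = height n u + height n v" for u v
    using additive_form_height by (simp add: additive_form_def)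
  have "height n (eps i - eps j) > 0" if "1 \<le> i" "i < j" "j \<le> n" for i j
    using that by (simp add: additive_form_diff[OF additive_form_height] height_eps)
  moreover have "height n (eps i + eps j) > 0" if "1 \<le> i" "i \<le> j" "j \<le> n" for i j
    using that by (simp only: add height_eps) simp
  moreover assume "\<alpha> \<in> pos_roots n"
  ultimately show ?thesis unfolding pos_roots_Un diff_roots_def sum_roots_def by blast
qed

text \<open>A positive root cannot be sent to \<open>\<alpha>_i\<close>: it would equal
  \<open>- \<alpha>_i\<close>, whose height is negative.\<close>

lemma refl_permutes_pos_roots:
  assumes i: "i \<in> {1..n}"
  shows "bij_betw (simple_refl n i) (pos_roots n - {simple_root n i}) (pos_roots n - {simple_root n i})"
proof -
  have "simple_refl n i \<alpha> \<in> pos_roots n - {simple_root n i}" if \<alpha>: "\<alpha> \<in> pos_roots n - {simple_root n i}" for \<alpha>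
  proof -
    have "simple_refl n i \<alpha> \<noteq> simple_root n i"
    proof
      assume "simple_refl n i \<alpha> = simple_root n i"
      then have "\<alpha> = - simple_root n i" using refl_refl[OF i, of \<alpha>] refl_simple_root[OF i] by simp
      then have "height n \<alpha> = - height n (simple_root n i)"
        by (simp only: additive_form_uminus[OF additive_form_height])
      then show False
        using height_pos_root[of \<alpha> n] height_pos_root[OF simple_root_pos[OF i]] \<alpha> by auto
    qed
    then show ?thesis using refl_pos_roots[OF i] \<alpha> by auto
  qed
  then show ?thesis
    by (intro bij_betw_byWitness[where f' = "simple_refl n i"]) (auto simp: refl_refl[OF i])
qed

section \<open>The half-sum in coordinates\<close>

lemma weight_sum_apply: "(\<Sum>x\<in>A. (f x :: weight)) k = (\<Sum>x\<in>A. f x k)"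
  by (induction A rule: infinite_finite_induct) auto

lemma pos_root_outside: "\<alpha> \<in> pos_roots n \<Longrightarrow> k \<notin> {1..n} \<Longrightarrow> \<alpha> k = 0"
  unfolding pos_roots_Un diff_roots_def sum_roots_def by (auto simp: eps_def)

text \<open>No counting of roots: \<open>s_i\<close> permutes the positive roots other than
  \<open>\<alpha>_i\<close>, so their total sum \<open>\<sigma>\<close> satisfies
  \<open>s_i \<sigma> = \<sigma> - 2 \<alpha>_i\<close>. Coordinate \<open>i\<close> of this
  equation gives steps of 2 between neighbours and the value 2 at the end.\<close>

lemma half_sum_apply: "half_sum n k = (if k \<in> {1..n} then int (n + 1 - k) else 0)"
proof (cases "k \<in> {1..n}")
  case False
  then have "(\<Sum>\<alpha>\<in>pos_roots n. \<alpha> k) = 0"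
    by (intro sum.neutral) (simp add: pos_root_outside)
  with False show ?thesis unfolding half_sum_def by simp
next
  case True
  define \<sigma> where "\<sigma> = (\<Sum>\<alpha>\<in>pos_roots n. \<alpha>)"
  have refl\<sigma>: "simple_refl n i \<sigma> = \<sigma> - simple_root n i - simple_root n i" if i: "i \<in> {1..n}" for i
  proof -
    let ?P = "pos_roots n - {simple_root n i}"
    have \<sigma>: "\<sigma> = simple_root n i + (\<Sum>\<alpha>\<in>?P. \<alpha>)"
      unfolding \<sigma>_def by (rule sum.remove[OF finite_pos_roots simple_root_pos[OF i]])
    have "(\<Sum>\<alpha>\<in>?P. simple_refl n i \<alpha>) = (\<Sum>\<alpha>\<in>?P. \<alpha>)"
      by (rule sum.reindex_bij_betw[OF refl_permutes_pos_roots[OF i], of "\<lambda>\<alpha>. \<alpha>"])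
    then have "simple_refl n i \<sigma> = - simple_root n i + (\<Sum>\<alpha>\<in>?P. \<alpha>)"
      by (subst \<sigma>) (simp only: refl_add[OF i] refl_sum[OF i] refl_simple_root[OF i])
    moreover have "- u + v = (u + v) - u - u" for u v :: weight
      by (simp add: algebra_simps)
    ultimately show ?thesis using \<sigma> by (simp only:)
  qed
  have step: "\<sigma> i = \<sigma> (Suc i) + 2" if "1 \<le> i" "i < n" for i
    using fun_cong[OF refl\<sigma>[of i], of i] that
    by (simp add: refl_less_apply simple_root_def eps_def)
  have last: "\<sigma> n = 2"
  proof -
    have n: "1 \<le> n" using True by auto
    have "- \<sigma> n = \<sigma> n - simple_root n n n - simple_root n n n"
      using fun_cong[OF refl\<sigma>[of n], of n] n by (simp only: refl_last_apply) simp
    then show ?thesis unfolding simple_root_last by (simp add: eps_def)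
  qed
  have "\<sigma> (n - m) = 2 * int (m + 1)" if "m < n" for m
    using that
  proof (induction m)
    case (Suc m)
    then show ?case using step[of "n - Suc m"] by (simp add: Suc_diff_Suc)
  qed (simp add: last)
  from this[of "n - k"] True have "\<sigma> k = 2 * int (n + 1 - k)" by simp
  then show ?thesis using True unfolding half_sum_def \<sigma>_def weight_sum_apply by simp
qed

lemma refl_half_sum:
  assumes "i \<in> {1..n}"
  shows "simple_refl n i (half_sum n) = half_sum n - simple_root n i"
proof (cases "i < n")
  case True
  with assms show ?thesis
    by (auto simp: fun_eq_iff refl_less_apply simple_root_def eps_def half_sum_apply)
next
  case False
  with assms have [simp]: "i = n" and n: "1 \<le> n" by auto
  show ?thesis unfolding \<open>i = n\<close> simple_root_last fun_eq_iff
    using n by (auto simp: refl_last_apply eps_def half_sum_apply)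
qed

subsection \<open>Antisymmetry under the Weyl group\<close>

definition weyl_antisym :: "nat \<Rightarrow> weight_series \<Rightarrow> bool" where
  "weyl_antisym n F \<longleftrightarrow> (\<forall>i\<in>{1..n}. pullback (simple_refl n i) F = - F)"

definition denominator :: "nat \<Rightarrow> weight_series" where
  "denominator n = emon (half_sum n) * (\<Prod>\<alpha>\<in>pos_roots n. 1 - emon (- \<alpha>))"

definition sym_series :: "nat \<Rightarrow> weight_series" where
  "sym_series n = (\<Prod>\<alpha>\<in>pos_roots n. geometric_root \<alpha> * geometric_root (- \<alpha>))"

definition theta :: "nat \<Rightarrow> weight_series" where
  "theta n = denominator n * sym_series n"

lemma pullback_refl:
  assumes i: "i \<in> {1..n}"
  shows "pullback (simple_refl n i) (emon \<alpha>) = emon (simple_refl n i \<alpha>)"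
    and "pullback (simple_refl n i) (geometric_root \<alpha>) = geometric_root (simple_refl n i \<alpha>)"
  using pullback_emon[OF additive_bij_refl[OF i], of "simple_refl n i \<alpha>"]
    pullback_geometric_root[OF additive_bij_refl[OF i], of "simple_refl n i \<alpha>"]
  by (simp_all only: refl_refl[OF i])

text \<open>The factors of the other positive roots are permuted; what remains is \<open>e^(\<rho> -
  \<alpha>_i) (1 - e^(\<alpha>_i)) = - e^\<rho> (1 - e^(- \<alpha>_i))\<close>.\<close>

lemma antisym_denominator: "weyl_antisym n (denominator n)"
  unfolding weyl_antisym_def
proof
  fix i assume i: "i \<in> {1..n}"
  let ?s = "simple_refl n i" and ?a = "simple_root n i" and ?P = "pos_roots n - {simple_root n i}"
  note ab = additive_bij_refl[OF i]
  have split: "(\<Prod>\<alpha>\<in>pos_roots n. f \<alpha>) = f ?a * (\<Prod>\<alpha>\<in>?P. f \<alpha>)" for f :: "weight \<Rightarrow> weight_series"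
    by (rule prod.remove[OF finite_pos_roots simple_root_pos[OF i]])
  have "pullback ?s (\<Prod>\<alpha>\<in>?P. 1 - emon (- \<alpha>)) = (\<Prod>\<alpha>\<in>?P. 1 - emon (- ?s \<alpha>))"
    by (simp add: pullback_prod[OF ab] pullback_diff[OF ab] pullback_1[OF ab] pullback_refl[OF i] refl_uminus[OF i])
  also have "\<dots> = (\<Prod>\<alpha>\<in>?P. 1 - emon (- \<alpha>))"
    by (rule prod.reindex_bij_betw[OF refl_permutes_pos_roots[OF i], of "\<lambda>\<alpha>. 1 - emon (- \<alpha>)"])
  finally have P: "pullback ?s (\<Prod>\<alpha>\<in>?P. 1 - emon (- \<alpha>)) = (\<Prod>\<alpha>\<in>?P. 1 - emon (- \<alpha>))" .
  have h: "pullback ?s (emon (half_sum n)) = emon (half_sum n) * emon (- ?a)"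
    by (simp add: pullback_refl[OF i] refl_half_sum[OF i] flip: emon_add)
  have a: "pullback ?s (1 - emon (- ?a)) = 1 - emon ?a"
    by (simp add: pullback_diff[OF ab] pullback_1[OF ab] pullback_refl[OF i] refl_uminus[OF i]
        refl_simple_root[OF i])
  have e: "emon (- ?a) * emon ?a = 1"
    using emon_add[of "- ?a" ?a] by simp
  have "pullback ?s (denominator n)
      = emon (half_sum n) * (emon (- ?a) * (1 - emon ?a)) * (\<Prod>\<alpha>\<in>?P. 1 - emon (- \<alpha>))"
    unfolding denominator_def split pullback_mult[OF ab] P h a by (simp only: mult.assoc)
  also have "emon (- ?a) * (1 - emon ?a) = - (1 - emon (- ?a))"
    using e by (simp add: algebra_simps)
  finally show "pullback ?s (denominator n) = - denominator n"
    unfolding denominator_def split by (simp only: mult_minus_left mult_minus_right mult.assoc)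
qed

lemma pullback_sym_series:
  assumes i: "i \<in> {1..n}"
  shows "pullback (simple_refl n i) (sym_series n) = sym_series n"
proof -
  let ?s = "simple_refl n i" and ?a = "simple_root n i" and ?P = "pos_roots n - {simple_root n i}"
  let ?g = "\<lambda>\<alpha>. geometric_root \<alpha> * geometric_root (- \<alpha>)"
  note ab = additive_bij_refl[OF i]
  have split: "(\<Prod>\<alpha>\<in>pos_roots n. f \<alpha>) = f ?a * (\<Prod>\<alpha>\<in>?P. f \<alpha>)" for f :: "weight \<Rightarrow> weight_series"
    by (rule prod.remove[OF finite_pos_roots simple_root_pos[OF i]])
  have g: "pullback ?s (?g \<alpha>) = ?g (?s \<alpha>)" for \<alpha>
    by (simp add: pullback_mult[OF ab] pullback_refl[OF i] refl_uminus[OF i])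
  have "pullback ?s (sym_series n) = (\<Prod>\<alpha>\<in>pos_roots n. ?g (?s \<alpha>))"
    by (simp only: sym_series_def pullback_prod[OF ab] g)
  also have "\<dots> = ?g (?s ?a) * (\<Prod>\<alpha>\<in>?P. ?g (?s \<alpha>))"
    by (rule split)
  also have "(\<Prod>\<alpha>\<in>?P. ?g (?s \<alpha>)) = (\<Prod>\<alpha>\<in>?P. ?g \<alpha>)"
    by (rule prod.reindex_bij_betw[OF refl_permutes_pos_roots[OF i], of ?g])
  also have "?g (?s ?a) = ?g ?a"
    by (simp add: refl_simple_root[OF i] mult.commute)
  finally show ?thesis unfolding sym_series_def split .
qed

lemma antisym_mult:
  assumes "weyl_antisym n F" "\<And>i. i \<in> {1..n} \<Longrightarrow> pullback (simple_refl n i) G = G"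
  shows "weyl_antisym n (F * G)"
  using assms by (simp add: weyl_antisym_def pullback_mult additive_bij_refl)

lemma antisym_diff: "weyl_antisym n F \<Longrightarrow> weyl_antisym n G \<Longrightarrow> weyl_antisym n (F - G)"
  by (simp add: weyl_antisym_def pullback_diff additive_bij_refl)

lemma antisym_theta: "weyl_antisym n (theta n)"
  unfolding theta_def by (intro antisym_mult antisym_denominator pullback_sym_series)

lemma antisym_coef: "weyl_antisym n F \<Longrightarrow> i \<in> {1..n} \<Longrightarrow> coef F d (simple_refl n i \<kappa>) = - coef F d \<kappa>"
  unfolding weyl_antisym_def by (metis additive_bij_refl coef_pullback coef_uminus)

section \<open>Weyl group elements as words, and their signs\<close>

lemma weyl_word_Cons: "weyl_word n (i # is) = simple_refl n i \<circ> weyl_word n is"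
  by (simp add: weyl_word_def simple_refl_def)

lemma weyl_word_append: "weyl_word n (is @ [i]) = weyl_word n is \<circ> simple_refl n i"
  by (induction "is") (simp_all add: weyl_word_def simple_refl_def comp_assoc)

lemma weyl_word_Nil: "weyl_word n [] = id"
  by (simp add: weyl_word_def)

lemma additive_bij_weyl_word: "is \<in> lists {1..n} \<Longrightarrow> additive_bij (weyl_word n is)"
proof (induction "is")
  case Nil
  show ?case unfolding weyl_word_Nil additive_bij_def
    by (intro conjI allI bij_id) (simp only: id_apply)
next
  case (Cons i "is")
  then have "i \<in> {1..n}" "additive_bij (weyl_word n is)" by auto
  then show ?case unfolding weyl_word_Cons by (intro additive_bij_comp additive_bij_refl)
qed

lemma additive_bij_weyl: "w \<in> weyl_group n \<Longrightarrow> additive_bij w"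
  unfolding weyl_group_def using additive_bij_weyl_word by blast

lemma pullback_weyl_word:
  assumes F: "weyl_antisym n F" and "is \<in> lists {1..n}"
  shows "pullback (weyl_word n is) F = (-1) ^ length is * F"
  using assms(2)
proof (induction "is")
  case Nil
  then show ?case by (simp only: weyl_word_Nil pullback_id list.size power_0 mult_1)
next
  case (Cons i "is")
  then have i: "i \<in> {1..n}" and w: "additive_bij (weyl_word n is)"
    using additive_bij_weyl_word by auto
  have "pullback (weyl_word n (i # is)) F = pullback (weyl_word n is) (pullback (simple_refl n i) F)"
    by (simp add: weyl_word_Cons pullback_comp[OF additive_bij_refl[OF i] w])
  also have "\<dots> = - pullback (weyl_word n is) F"
    using F i by (simp add: weyl_antisym_def pullback_uminus[OF w])
  finally show ?case using Cons by simp
qed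

lemma weyl_length_word:
  assumes "w \<in> weyl_group n"
  obtains "is" where "is \<in> lists {1..n}" "length is = weyl_length n w" "weyl_word n is = w"
proof -
  obtain js where "js \<in> lists {1..n}" "weyl_word n js = w"
    using assms by (auto simp only: weyl_group_def)
  then have "\<exists>is\<in>lists {1..n}. length is = length js \<and> weyl_word n is = w" by blast
  then have "\<exists>is\<in>lists {1..n}. length is = weyl_length n w \<and> weyl_word n is = w"
    unfolding weyl_length_def by (rule LeastI)
  with that show ?thesis by blast
qed

text \<open>A shortest word for \<open>w\<close> has \<open>weyl_length n w\<close> letters, and
  each letter contributes one sign.\<close>

lemma pullback_weyl:
  assumes "weyl_antisym n F" "w \<in> weyl_group n"
  shows "pullback w F = (-1) ^ weyl_length n w * F"
  using weyl_length_word[OF assms(2)] pullback_weyl_word[OF assms(1)] by metis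

lemma coef_sign_mult: "coef ((-1) ^ l * F) d \<kappa> = (-1) ^ l * coef F d \<kappa>"
  by (cases "even l") simp_all

lemma coef_weyl:
  assumes "weyl_antisym n F" "w \<in> weyl_group n"
  shows "coef F d (w \<kappa>) = (-1) ^ weyl_length n w * coef F d \<kappa>"
  using pullback_weyl[OF assms] coef_pullback[OF additive_bij_weyl[OF assms(2)], of F d \<kappa>]
  by (simp add: coef_sign_mult)

text \<open>Every other term of the product lowers the height, so \<open>e^\<rho>\<close> arises
  only from the term 1.\<close>

lemma coef_denominator_half_sum: "coef (denominator n) d (half_sum n) = (if d = 0 then 1 else 0)"
proof -
  let ?g = "\<lambda>v. - height n v"
  have g: "additive_form ?g" using additive_form_height by (auto simp: additive_form_def)
  let ?P = "\<Prod>\<alpha>\<in>pos_roots n. 1 - emon (- \<alpha>)"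
  have "wt_ge ?g 0 1 (?P - 1)"
  proof (rule wt_ge_prod_minus_1[OF g])
    fix \<alpha> assume \<alpha>: "\<alpha> \<in> pos_roots n"
    have "wt_ge ?g 0 1 (emon (- \<alpha>))"
      using height_pos_root[OF \<alpha>]
      by (intro wt_ge_mono[OF wt_ge_emon[of ?g "- \<alpha>" "height n \<alpha>"]])
         (simp_all add: additive_form_uminus[OF additive_form_height])
    then have "wt_ge ?g 0 1 (- emon (- \<alpha>))" by (rule wt_ge_uminus)
    then show "wt_ge ?g 0 1 (1 - emon (- \<alpha>) - 1)" by simp
  qed simp
  then have "coef (?P - 1) d 0 = 0"
    using wt_geD[of ?g 0 1 "?P - 1" d 0] by (auto simp: additive_form_0[OF additive_form_height])
  then show ?thesis unfolding denominator_def by (simp add: coef_1)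
qed

lemma weyl_group_comp: "w \<in> weyl_group n \<Longrightarrow> i \<in> {1..n} \<Longrightarrow> w \<circ> simple_refl n i \<in> weyl_group n"
proof -
  assume "w \<in> weyl_group n" and i: "i \<in> {1..n}"
  then obtain "is" where "is \<in> lists {1..n}" "w = weyl_word n is"
    by (auto simp only: weyl_group_def)
  then have "w \<circ> simple_refl n i = weyl_word n (is @ [i])" "is @ [i] \<in> lists {1..n}"
    using i by (simp_all only: weyl_word_append append_in_lists_conv) auto
  then show ?thesis unfolding weyl_group_def by blast
qed

lemma id_weyl_group: "id \<in> weyl_group n"
proof -
  have "weyl_word n [] = id" by (simp add: weyl_word_def)
  then show ?thesis unfolding weyl_group_def by (metis image_eqI lists.Nil)
qed

text \<open>The sign of \<open>w\<close> is the coefficient of the Weyl denominator at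
  \<open>w \<rho>\<close>. This replaces a parity theory of lengths: antisymmetry alone determines
  the coefficient at \<open>w s_i \<rho>\<close>.\<close>

lemma weyl_sign_comp:
  assumes w: "w \<in> weyl_group n" and i: "i \<in> {1..n}"
  shows "(-1 :: int) ^ weyl_length n (w \<circ> simple_refl n i) = - ((-1) ^ weyl_length n w)"
proof -
  let ?D = "denominator n" and ?\<rho> = "half_sum n"
  have "(-1) ^ weyl_length n (w \<circ> simple_refl n i) * coef ?D 0 ?\<rho> = coef ?D 0 (w (simple_refl n i ?\<rho>))"
    using coef_weyl[OF antisym_denominator weyl_group_comp[OF w i]] by simp
  also have "\<dots> = (-1) ^ weyl_length n w * - coef ?D 0 ?\<rho>"
    by (simp only: coef_weyl[OF antisym_denominator w] antisym_coef[OF antisym_denominator i])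
  finally show ?thesis by (simp add: coef_denominator_half_sum)
qed

lemma weyl_sign_stabilizer:
  assumes w: "w \<in> weyl_group n" and "w (half_sum n) = half_sum n"
  shows "(-1 :: int) ^ weyl_length n w = 1"
  using coef_weyl[OF antisym_denominator w, of 0 "half_sum n"] assms(2)
  by (simp add: coef_denominator_half_sum)

section \<open>Alternating sums over the Weyl group\<close>

definition alternating_sum :: "nat \<Rightarrow> weight_series \<Rightarrow> weight_series" where
  "alternating_sum n F = (\<Sum>w\<in>weyl_group n. (-1) ^ weyl_length n w * pullback w F)"

lemma coef_alternating_sum:
  "coef (alternating_sum n F) d \<kappa> = (\<Sum>w\<in>weyl_group n. (-1) ^ weyl_length n w * coef F d (w \<kappa>))"
  unfolding alternating_sum_def coef_sum
  by (rule sum.cong) (simp_all add: coef_sign_mult coef_pullback additive_bij_weyl)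

lemma antisym_alternating_sum: "weyl_antisym n (alternating_sum n F)"
  unfolding weyl_antisym_def
proof (intro ballI coef_eqI)
  fix i d \<kappa> assume i: "i \<in> {1..n}"
  let ?c = "\<lambda>w. (-1 :: int) ^ weyl_length n w * coef F d (w \<kappa>)"
  have bij: "bij_betw (\<lambda>w. w \<circ> simple_refl n i) (weyl_group n) (weyl_group n)"
  proof (rule bij_betw_byWitness[where f' = "\<lambda>w. w \<circ> simple_refl n i"])
    have "w \<circ> simple_refl n i \<circ> simple_refl n i = w" for w :: "weight \<Rightarrow> weight"
      by (rule ext) (simp only: comp_apply refl_refl[OF i])
    then show "\<forall>w\<in>weyl_group n. w \<circ> simple_refl n i \<circ> simple_refl n i = w"
      "\<forall>w\<in>weyl_group n. w \<circ> simple_refl n i \<circ> simple_refl n i = w" by blast+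
  qed (use weyl_group_comp[OF _ i] in auto)
  have "coef (pullback (simple_refl n i) (alternating_sum n F)) d \<kappa>
      = (\<Sum>w\<in>weyl_group n. (-1) ^ weyl_length n w * coef F d ((w \<circ> simple_refl n i) \<kappa>))"
    by (simp add: coef_pullback[OF additive_bij_refl[OF i]] coef_alternating_sum)
  also have "\<dots> = (\<Sum>w\<in>weyl_group n. - ?c (w \<circ> simple_refl n i))"
    by (intro sum.cong refl) (simp only: weyl_sign_comp[OF _ i] mult_minus_left minus_minus)
  also have "\<dots> = (\<Sum>w\<in>weyl_group n. - ?c w)"
    by (rule sum.reindex_bij_betw[OF bij, of "\<lambda>w. - ?c w"])
  finally show "coef (pullback (simple_refl n i) (alternating_sum n F)) d \<kappa> = coef (- alternating_sum n F) d \<kappa>"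
    by (simp add: coef_alternating_sum sum_negf)
qed

lemma alternating_sum_mult:
  assumes "\<And>i. i \<in> {1..n} \<Longrightarrow> pullback (simple_refl n i) S = S"
  shows "alternating_sum n (S * F) = S * alternating_sum n F"
proof -
  have word: "pullback (weyl_word n is) S = S" if "is \<in> lists {1..n}" for "is"
    using that
  proof (induction "is")
    case Nil
    then show ?case by (simp only: weyl_word_Nil pullback_id)
  next
    case (Cons i "is")
    then have i: "i \<in> {1..n}" and w: "additive_bij (weyl_word n is)"
      using additive_bij_weyl_word by auto
    have "pullback (weyl_word n (i # is)) S = pullback (weyl_word n is) (pullback (simple_refl n i) S)"
      by (simp add: weyl_word_Cons pullback_comp[OF additive_bij_refl[OF i] w])
    with Cons assms[OF i] show ?case by simp
  qed
  have "pullback w (S * F) = S * pullback w F" if w: "w \<in> weyl_group n" for w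
  proof -
    obtain "is" where "is \<in> lists {1..n}" "weyl_word n is = w" using weyl_length_word[OF w] by metis
    then have "pullback w S = S" using word by metis
    then show ?thesis by (simp only: pullback_mult[OF additive_bij_weyl[OF w]])
  qed
  then show ?thesis
    unfolding alternating_sum_def sum_distrib_left by (intro sum.cong refl) (simp add: mult_ac)
qed

subsection \<open>Antisymmetric series with small exponents\<close>

text \<open>The exponents in the expansion of \<open>e^\<rho> \<Prod> (1 - e^-\<alpha>)\<close>,
  with or without \<open>t\<close> in the factors.\<close>

definition small_weights :: "nat \<Rightarrow> weight set" where
  "small_weights n = {half_sum n - (\<Sum>\<alpha>\<in>A. \<alpha>) | A. A \<subseteq> pos_roots n}"

text \<open>Since \<open>s_i \<rho> = \<rho> - \<alpha>_i\<close>, the set \<open>A\<close> is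
  reflected apart from \<open>\<alpha>_i\<close>, whose membership is toggled.\<close>

lemma refl_small_weights:
  assumes i: "i \<in> {1..n}" and \<kappa>: "\<kappa> \<in> small_weights n"
  shows "simple_refl n i \<kappa> \<in> small_weights n"
proof -
  let ?s = "simple_refl n i" and ?a = "simple_root n i" and ?P = "pos_roots n - {simple_root n i}"
  obtain A where A: "A \<subseteq> pos_roots n" and \<kappa>: "\<kappa> = half_sum n - (\<Sum>\<alpha>\<in>A. \<alpha>)"
    using \<kappa> unfolding small_weights_def by blast
  have fin: "finite A" using A finite_pos_roots finite_subset by blast
  let ?B = "?s ` (A - {?a})"
  have B: "?B \<subseteq> ?P"
    using A bij_betw_imp_surj_on[OF refl_permutes_pos_roots[OF i]] by blast
  have inj: "inj_on ?s C" for C by (rule inj_on_inverseI[of _ ?s]) (rule refl_refl[OF i])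
  have sumB: "(\<Sum>\<alpha>\<in>?B. \<alpha>) = (\<Sum>\<alpha>\<in>A - {?a}. ?s \<alpha>)"
    by (simp only: sum.reindex[OF inj] o_def)
  have s\<kappa>: "?s \<kappa> = half_sum n - ?a - (\<Sum>\<alpha>\<in>A. ?s \<alpha>)"
    unfolding \<kappa> by (simp only: refl_diff[OF i] refl_sum[OF i] refl_half_sum[OF i])
  show ?thesis
  proof (cases "?a \<in> A")
    case True
    have "(\<Sum>\<alpha>\<in>A. ?s \<alpha>) = - ?a + (\<Sum>\<alpha>\<in>?B. \<alpha>)"
      unfolding sum.remove[OF fin True] sumB refl_simple_root[OF i] ..
    then have "?s \<kappa> = half_sum n - (\<Sum>\<alpha>\<in>?B. \<alpha>)"
      unfolding s\<kappa> by (simp add: algebra_simps)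
    then show ?thesis unfolding small_weights_def using B by blast
  next
    case False
    have "?a \<notin> ?B" using B by blast
    then have "(\<Sum>\<alpha>\<in>insert ?a ?B. \<alpha>) = ?a + (\<Sum>\<alpha>\<in>A. ?s \<alpha>)"
      using fin False sumB by simp
    then have "?s \<kappa> = half_sum n - (\<Sum>\<alpha>\<in>insert ?a ?B. \<alpha>)"
      unfolding s\<kappa> by (simp add: algebra_simps)
    moreover have "insert ?a ?B \<subseteq> pos_roots n" using B simple_root_pos[OF i] by blast
    ultimately show ?thesis unfolding small_weights_def by blast
  qed
qed

lemma weyl_small_weights:
  assumes "w \<in> weyl_group n" and "w \<kappa> \<in> small_weights n"
  shows "\<kappa> \<in> small_weights n"
proof -
  have "is \<in> lists {1..n} \<Longrightarrow> weyl_word n is \<kappa> \<in> small_weights n \<Longrightarrow> \<kappa> \<in> small_weights n" for "is"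
  proof (induction "is")
    case Nil
    then show ?case by (simp add: weyl_word_def)
  next
    case (Cons i "is")
    then have i: "i \<in> {1..n}" by auto
    have "simple_refl n i (simple_refl n i (weyl_word n is \<kappa>)) \<in> small_weights n"
      using Cons.prems refl_small_weights[OF i] by (simp add: weyl_word_Cons)
    with Cons show ?case by (simp add: refl_refl[OF i])
  qed
  with assms show ?thesis unfolding weyl_group_def by auto
qed

lemma small_weights_outside: "\<kappa> \<in> small_weights n \<Longrightarrow> k \<notin> {1..n} \<Longrightarrow> \<kappa> k = 0"
proof -
  assume "\<kappa> \<in> small_weights n" and k: "k \<notin> {1..n}"
  then obtain A where A: "A \<subseteq> pos_roots n" and \<kappa>: "\<kappa> = half_sum n - (\<Sum>\<alpha>\<in>A. \<alpha>)"
    unfolding small_weights_def by blast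
  have "(\<Sum>\<alpha>\<in>A. \<alpha> k) = 0" using A k pos_root_outside by (intro sum.neutral) blast
  then show ?thesis unfolding \<kappa> using k by (auto simp: half_sum_apply weight_sum_apply)
qed

lemma small_weights_coord_sum: "\<kappa> \<in> small_weights n \<Longrightarrow> coord_sum n \<kappa> \<le> coord_sum n (half_sum n)"
proof -
  assume "\<kappa> \<in> small_weights n"
  then obtain A where A: "A \<subseteq> pos_roots n" and \<kappa>: "\<kappa> = half_sum n - (\<Sum>\<alpha>\<in>A. \<alpha>)"
    unfolding small_weights_def by blast
  have "coord_sum n (\<Sum>\<alpha>\<in>A. \<alpha>) = (\<Sum>\<alpha>\<in>A. coord_sum n \<alpha>)"
    unfolding coord_sum_def weight_sum_apply by (rule sum.swap)
  also have "\<dots> \<ge> 0"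
    using A coord_sum_diff_roots coord_sum_sum_roots
    by (intro sum_nonneg) (fastforce simp: pos_roots_Un)
  finally show ?thesis unfolding \<kappa> by (simp add: additive_form_diff[OF additive_form_coord_sum])
qed

text \<open>\<open>f\<close> abstracts from \<open>e^-\<alpha>\<close> and
  \<open>t e^-\<alpha>\<close>, so that the Weyl denominator and its deformation are treated
  alike.\<close>

lemma coef_prod_small:
  assumes "finite B" "\<forall>\<alpha> d \<kappa>. coef (f \<alpha>) d \<kappa> \<noteq> 0 \<longrightarrow> \<kappa> = - \<alpha>"
    and "coef (\<Prod>\<alpha>\<in>B. 1 - f \<alpha>) d \<kappa> \<noteq> 0"
  shows "\<exists>A\<subseteq>B. \<kappa> = - (\<Sum>\<alpha>\<in>A. \<alpha>)"
  using assms(1,3)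
proof (induction B arbitrary: d \<kappa> rule: finite_induct)
  case empty
  then show ?case by (auto simp: coef_1 split: if_splits)
next
  case (insert \<beta> B)
  let ?Q = "\<Prod>\<alpha>\<in>B. 1 - f \<alpha>"
  have "(\<Prod>\<alpha>\<in>insert \<beta> B. 1 - f \<alpha>) = ?Q - f \<beta> * ?Q"
    using insert.hyps by (simp add: algebra_simps)
  with insert.prems have "coef ?Q d \<kappa> \<noteq> 0 \<or> coef (f \<beta> * ?Q) d \<kappa> \<noteq> 0" by auto
  then show ?case
  proof
    assume "coef ?Q d \<kappa> \<noteq> 0"
    then show ?case using insert.IH by blast
  next
    assume "coef (f \<beta> * ?Q) d \<kappa> \<noteq> 0"
    then obtain i v where v: "coef (f \<beta>) i v \<noteq> 0" and Q: "coef ?Q (d - i) (\<kappa> - v) \<noteq> 0"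
      by (rule coef_mult_neq_0D)
    from insert.IH[OF Q] obtain A where A: "A \<subseteq> B" "\<kappa> - v = - (\<Sum>\<alpha>\<in>A. \<alpha>)" by blast
    have "finite A" "\<beta> \<notin> A" using A insert.hyps finite_subset by auto
    then have "(\<Sum>\<alpha>\<in>insert \<beta> A. \<alpha>) = \<beta> + (\<Sum>\<alpha>\<in>A. \<alpha>)" by simp
    moreover have "v = - \<beta>" using assms(2) v by blast
    moreover have "\<kappa> = - (\<Sum>\<alpha>\<in>A. \<alpha>) + v" using A(2) by (simp only: diff_eq_eq)
    ultimately have "\<kappa> = - (\<Sum>\<alpha>\<in>insert \<beta> A. \<alpha>)" by (simp only: minus_add_distrib add.commute)
    with A(1) show ?case by blast
  qed
qed

lemma small_weights_prod:
  assumes "\<forall>\<alpha> d \<kappa>. coef (f \<alpha>) d \<kappa> \<noteq> 0 \<longrightarrow> \<kappa> = - \<alpha>"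
    and "coef (emon (half_sum n) * (\<Prod>\<alpha>\<in>pos_roots n. 1 - f \<alpha>)) d \<kappa> \<noteq> 0"
  shows "\<kappa> \<in> small_weights n"
proof -
  have "coef (\<Prod>\<alpha>\<in>pos_roots n. 1 - f \<alpha>) d (\<kappa> - half_sum n) \<noteq> 0"
    using assms(2) by (simp only: coef_emon_mult not_False_eq_True)
  from coef_prod_small[of "pos_roots n" f, OF finite_pos_roots assms(1) this]
  obtain A where "A \<subseteq> pos_roots n" "\<kappa> - half_sum n = - (\<Sum>\<alpha>\<in>A. \<alpha>)"
    by (elim exE conjE)
  moreover from this(2) have "\<kappa> = half_sum n - (\<Sum>\<alpha>\<in>A. \<alpha>)" by (simp add: diff_eq_eq)
  ultimately show ?thesis unfolding small_weights_def by blast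
qed

text \<open>An exponent of maximal height in one degree is strictly dominant: a reflection cannot
  fix it, by antisymmetry, nor raise it. Strictly dominant integral weights dominate
  \<open>\<rho>\<close> coordinatewise, while small weights have at most the coordinate sum of
  \<open>\<rho>\<close>; so the exponent is \<open>\<rho>\<close> itself.\<close>

lemma antisym_small_eq_0:
  assumes F: "weyl_antisym n F" and small: "\<And>d \<kappa>. coef F d \<kappa> \<noteq> 0 \<Longrightarrow> \<kappa> \<in> small_weights n"
    and \<rho>: "\<And>d. coef F d (half_sum n) = 0"
  shows "F = 0"
proof (rule ccontr)
  assume "F \<noteq> 0"
  then obtain d \<kappa>0 where \<kappa>0: "coef F d \<kappa>0 \<noteq> 0" using coef_eqI[of F 0] by auto
  let ?S = "{\<kappa>. coef F d \<kappa> \<noteq> 0}"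
  have "finite (height n ` ?S)" "height n ` ?S \<noteq> {}" using finite_coef \<kappa>0 by auto
  then have "Max (height n ` ?S) \<in> height n ` ?S" by (rule Max_in)
  then obtain \<kappa> where \<kappa>: "coef F d \<kappa> \<noteq> 0" and "height n \<kappa> = Max (height n ` ?S)" by auto
  then have max: "height n \<kappa>' \<le> height n \<kappa>" if "coef F d \<kappa>' \<noteq> 0" for \<kappa>'
    using that finite_coef by simp
  have refl_le: "height n (simple_refl n i \<kappa>) \<le> height n \<kappa> \<and> simple_refl n i \<kappa> \<noteq> \<kappa>" if i: "i \<in> {1..n}" for i
    using antisym_coef[OF F i, of d \<kappa>] \<kappa> max[of "simple_refl n i \<kappa>"] by auto
  have step: "\<kappa> i > \<kappa> (Suc i)" if i: "1 \<le> i" "i < n" for i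
  proof -
    have "simple_refl n i \<kappa> = \<kappa> - (\<lambda>k. (\<kappa> i - \<kappa> (Suc i)) * (eps i k - eps (Suc i) k))"
      using i by (auto simp: fun_eq_iff refl_less_apply eps_def)
    moreover have "height n (\<lambda>k. c * (eps i k - eps (Suc i) k)) = c" for c
    proof -
      have "height n (\<lambda>k. c * (eps i k - eps (Suc i) k)) = c * height n (eps i - eps (Suc i))"
        by (simp add: height_def sum_distrib_left mult_ac)
      then show ?thesis
        using i by (simp add: additive_form_diff[OF additive_form_height] height_eps)
    qed
    ultimately have "height n (simple_refl n i \<kappa>) = height n \<kappa> - (\<kappa> i - \<kappa> (Suc i))"
      by (simp only: additive_form_diff[OF additive_form_height])
    moreover have "\<kappa> i \<noteq> \<kappa> (Suc i)"
    proof
      assume "\<kappa> i = \<kappa> (Suc i)"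
      then have "simple_refl n i \<kappa> = \<kappa>" using i by (auto simp: fun_eq_iff refl_less_apply)
      then show False using refl_le[of i] i by simp
    qed
    ultimately show ?thesis using refl_le[of i] i by simp
  qed
  have last: "\<kappa> n > 0" if n: "1 \<le> n"
  proof -
    have "simple_refl n n \<kappa> = \<kappa> - (\<lambda>k. 2 * \<kappa> n * eps n k)"
      using n by (auto simp: fun_eq_iff refl_last_apply eps_def)
    moreover have "height n (\<lambda>k. c * eps n k) = c" for c
    proof -
      have "height n (\<lambda>k. c * eps n k) = c * height n (eps n)"
        by (simp add: height_def sum_distrib_left mult_ac)
      then show ?thesis using n by (simp add: height_eps)
    qed
    ultimately have "height n (simple_refl n n \<kappa>) = height n \<kappa> - 2 * \<kappa> n"
      by (simp only: additive_form_diff[OF additive_form_height])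
    moreover have "\<kappa> n \<noteq> 0"
    proof
      assume "\<kappa> n = 0"
      then have "simple_refl n n \<kappa> = \<kappa>" using n by (auto simp: fun_eq_iff refl_last_apply)
      then show False using refl_le[of n] n by simp
    qed
    ultimately show ?thesis using refl_le[of n] n by simp
  qed
  \<comment> \<open>Positive at the end and strictly decreasing in the integers, hence at least 1,
    2, ... counted from the right.\<close>
  have dominant: "\<kappa> (n - m) \<ge> int (m + 1)" if "m < n" for m
    using that
  proof (induction m)
    case (Suc m)
    then have "\<kappa> (n - m) < \<kappa> (n - Suc m)" using step[of "n - Suc m"] by (simp add: Suc_diff_Suc)
    with Suc show ?case by simp
  qed (use last in simp)
  have ge: "\<kappa> k \<ge> half_sum n k" if "k \<in> {1..n}" for k
    using that dominant[of "n - k"] by (simp add: half_sum_apply of_nat_diff)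
  have "\<kappa> k = half_sum n k" for k
  proof (cases "k \<in> {1..n}")
    case True
    have "(\<Sum>k = 1..n. \<kappa> k - half_sum n k) \<le> 0"
      using small_weights_coord_sum[OF small[OF \<kappa>]] by (simp add: coord_sum_def sum_subtractf)
    moreover have nonneg: "\<kappa> k - half_sum n k \<ge> 0" if "k \<in> {1..n}" for k using ge[OF that] by simp
    ultimately have "(\<Sum>k = 1..n. \<kappa> k - half_sum n k) = 0" by (intro order_antisym sum_nonneg)
    then have "\<kappa> k - half_sum n k = 0"
      using True nonneg by (subst (asm) sum_nonneg_eq_0_iff) auto
    then show ?thesis by simp
  next
    case False
    then show ?thesis using small_weights_outside[OF small[OF \<kappa>]] by (simp add: half_sum_apply)
  qed
  then have "\<kappa> = half_sum n" by (rule ext)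
  with \<kappa> \<rho> show False by simp
qed

section \<open>Factoring out a constant series in \<open>t\<close>\<close>

definition scalar_series :: "int fps \<Rightarrow> weight_series" where
  "scalar_series c = Abs_fps (\<lambda>d. Poly_Mapping.single 0 (fps_nth c d))"

definition coef_series :: "weight_series \<Rightarrow> weight \<Rightarrow> int fps" where
  "coef_series F \<kappa> = Abs_fps (\<lambda>d. coef F d \<kappa>)"

lemma coef_scalar_mult:
  "coef (scalar_series c * F) d \<kappa> = (\<Sum>i=0..d. fps_nth c i * coef F (d - i) \<kappa>)"
proof -
  have "Poly_Mapping.lookup (Poly_Mapping.single 0 x * p) \<kappa> = x * Poly_Mapping.lookup p \<kappa>"
    for x and p :: "weight \<Rightarrow>\<^sub>0 int"
    using coef_mult_const[of 0 x "fps_const p" 0 \<kappa>] by (simp add: coef_def)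
  then show ?thesis by (simp add: coef_def scalar_series_def fps_mult_nth lookup_sum)
qed

lemma coef_series_scalar_mult: "coef_series (scalar_series c * F) \<kappa> = c * coef_series F \<kappa>"
  by (rule fps_ext) (simp add: coef_series_def coef_scalar_mult fps_mult_nth)

lemma pullback_scalar_series: "additive_bij w \<Longrightarrow> pullback w (scalar_series c) = scalar_series c"
proof (rule coef_eqI)
  fix d \<kappa> assume w: "additive_bij w"
  have "w \<kappa> = 0 \<longleftrightarrow> \<kappa> = 0"
    using w additive_bij_diff[OF w, of 0 0] by (auto simp: additive_bij_def bij_def inj_def)
  then show "coef (pullback w (scalar_series c)) d \<kappa> = coef (scalar_series c) d \<kappa>"
    unfolding coef_pullback[OF w] by (auto simp: coef_def scalar_series_def lookup_single when_def)
qed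

text \<open>Macdonald's identity, up to the value of the constant \<open>c\<close>.\<close>

lemma alternating_sum_deformed_denominator:
  obtains c where "fps_nth c 0 \<noteq> 0"
    "alternating_sum n (emon (half_sum n) * (\<Prod>\<alpha>\<in>pos_roots n. 1 - tmon (- \<alpha>)))
      = scalar_series c * denominator n"
proof
  let ?\<rho> = "half_sum n"
  let ?F = "emon ?\<rho> * (\<Prod>\<alpha>\<in>pos_roots n. 1 - tmon (- \<alpha>))"
  let ?Q = "alternating_sum n ?F"
  let ?c = "coef_series ?Q ?\<rho>"
  let ?G = "scalar_series ?c * denominator n"
  have tmon: "\<forall>\<alpha> d \<kappa>. coef (tmon (- \<alpha>)) d \<kappa> \<noteq> 0 \<longrightarrow> \<kappa> = - \<alpha>"
  proof (intro allI impI)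
    fix \<alpha> :: weight and d \<kappa> assume "coef (tmon (- \<alpha>)) d \<kappa> \<noteq> 0"
    then show "\<kappa> = - \<alpha>"
      using coef_tmon_mult[of "- \<alpha>" 1 d \<kappa>] by (auto simp: coef_1 eq_neg_iff_add_eq_0 split: if_splits)
  qed
  have Q_small: "\<kappa> \<in> small_weights n" if "coef ?Q d \<kappa> \<noteq> 0" for d \<kappa>
  proof -
    from that have "(\<Sum>w\<in>weyl_group n. (-1) ^ weyl_length n w * coef ?F d (w \<kappa>)) \<noteq> 0"
      by (simp only: coef_alternating_sum not_False_eq_True)
    then obtain w where w: "w \<in> weyl_group n" "(-1) ^ weyl_length n w * coef ?F d (w \<kappa>) \<noteq> 0"
      by (rule sum.not_neutral_contains_not_neutral)
    from w(2) have "coef ?F d (w \<kappa>) \<noteq> 0" by (simp only: mult_eq_0_iff de_Morgan_disj simp_thms)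
    then have "w \<kappa> \<in> small_weights n" by (rule small_weights_prod[where f = "\<lambda>\<alpha>. tmon (- \<alpha>)", OF tmon])
    with w(1) show ?thesis by (rule weyl_small_weights)
  qed
  have D_small: "\<kappa> \<in> small_weights n" if "coef ?G d \<kappa> \<noteq> 0" for d \<kappa>
  proof -
    from that have "(\<Sum>i=0..d. fps_nth ?c i * coef (denominator n) (d - i) \<kappa>) \<noteq> 0"
      by (simp only: coef_scalar_mult not_False_eq_True)
    then obtain i where "fps_nth ?c i * coef (denominator n) (d - i) \<kappa> \<noteq> 0"
      by (rule sum.not_neutral_contains_not_neutral)
    then have "coef (denominator n) (d - i) \<kappa> \<noteq> 0" by (simp only: mult_eq_0_iff de_Morgan_disj simp_thms)
    then show ?thesis unfolding denominator_def
      by (rule small_weights_prod[where f = "\<lambda>\<alpha>. emon (- \<alpha>)", rotated])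
         (auto simp: coef_emon split: if_splits)
  qed
  have "weyl_antisym n ?G"
    using antisym_mult[OF antisym_denominator, of n "scalar_series ?c"]
    by (simp add: pullback_scalar_series additive_bij_refl mult.commute)
  then have "weyl_antisym n (?Q - ?G)" by (intro antisym_diff antisym_alternating_sum)
  moreover have "coef ?G d ?\<rho> = coef ?Q d ?\<rho>" for d
  proof -
    have "coef ?G d ?\<rho> = (\<Sum>i=0..d. if i = d then fps_nth ?c i else 0)"
      unfolding coef_scalar_mult coef_denominator_half_sum by (rule sum.cong) auto
    then show ?thesis by (simp add: coef_series_def)
  qed
  moreover have "\<kappa> \<in> small_weights n" if "coef (?Q - ?G) d \<kappa> \<noteq> 0" for d \<kappa>
  proof -
    from that have "coef ?Q d \<kappa> \<noteq> 0 \<or> coef ?G d \<kappa> \<noteq> 0" by (simp only: coef_diff) auto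
    with Q_small D_small show ?thesis by blast
  qed
  ultimately have "?Q - ?G = 0" by (intro antisym_small_eq_0[of n]) (simp_all only: coef_diff diff_self)
  then show "?Q = ?G" by simp
  have F0: "coef ?F 0 \<kappa> = (if \<kappa> = ?\<rho> then 1 else 0)" for \<kappa>
  proof -
    have "fps_nth (\<Prod>\<alpha>\<in>A. 1 - tmon (- \<alpha>)) 0 = 1" for A
      by (induction A rule: infinite_finite_induct) (simp_all add: tmon_def fps_mult_nth_0)
    then have "coef (\<Prod>\<alpha>\<in>pos_roots n. 1 - tmon (- \<alpha>)) 0 \<mu> = (if \<mu> = 0 then 1 else 0)" for \<mu>
      by (simp only: coef_def lookup_one when_def)
    then show ?thesis by simp
  qed
  \<comment> \<open>At \<open>t = 0\<close> only \<open>e^\<rho>\<close> is left, so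
    \<open>c(0)\<close> counts the Weyl group elements that fix \<open>\<rho>\<close>; each has sign
    1, and the identity is among them.\<close>
  have "fps_nth ?c 0 = (\<Sum>w\<in>weyl_group n. (-1) ^ weyl_length n w * (if w ?\<rho> = ?\<rho> then 1 else 0))"
    by (simp only: coef_series_def coef_alternating_sum F0 fps_nth_Abs_fps)
  also have "\<dots> = (\<Sum>w\<in>weyl_group n. if w ?\<rho> = ?\<rho> then 1 else 0)"
    by (rule sum.cong) (auto simp: weyl_sign_stabilizer)
  also have "\<dots> > 0"
    by (rule sum_pos2[OF finite_weyl_group id_weyl_group]) auto
  finally show "fps_nth ?c 0 \<noteq> 0" by simp
qed

text \<open>The shift by \<open>- \<rho>\<close> outside \<open>w\<close> is absorbed as a factor
  \<open>e^\<rho>\<close>, after which \<open>w\<close> acts linearly on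
  \<open>\<mu> + \<rho>\<close>.\<close>

lemma gen_exponent_alternating_sum:
  "gen_exponent n \<mu>
    = coef_series (alternating_sum n (emon (half_sum n) * kostant_series n)) (\<mu> + half_sum n)"
proof (rule fps_ext)
  fix d
  have sign: "fps_nth ((-1) ^ l * f) d = (-1) ^ l * fps_nth f d" for l and f :: "int fps"
    by (cases "even l") simp_all
  show "fps_nth (gen_exponent n \<mu>) d = fps_nth (coef_series
      (alternating_sum n (emon (half_sum n) * kostant_series n)) (\<mu> + half_sum n)) d"
    unfolding gen_exponent_def fps_sum_nth sign coef_series_def fps_nth_Abs_fps
      coef_alternating_sum coef_emon_mult kostant_partition_def
    by (simp only: coef_def)
qed

lemma gen_exponent_theta:
  obtains c where "fps_nth c 0 \<noteq> 0"
    "gen_exponent n \<mu> = c * coef_series (theta n) (\<mu> + half_sum n)"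
proof -
  let ?\<rho> = "half_sum n"
  obtain c where c: "fps_nth c 0 \<noteq> 0"
    and eq: "alternating_sum n (emon ?\<rho> * (\<Prod>\<alpha>\<in>pos_roots n. 1 - tmon (- \<alpha>)))
      = scalar_series c * denominator n"
    by (rule alternating_sum_deformed_denominator)
  \<comment> \<open>Inserting a factor 1 for each negative root completes the Kostant series to the
    invariant product over all roots, which can leave the alternating sum.\<close>
  have "emon ?\<rho> * kostant_series n
      = emon ?\<rho> * (kostant_series n * (\<Prod>\<alpha>\<in>pos_roots n. geometric_root (- \<alpha>) * (1 - tmon (- \<alpha>))))"
    by (simp add: geometric_root_tmon)
  also have "\<dots> = sym_series n * (emon ?\<rho> * (\<Prod>\<alpha>\<in>pos_roots n. 1 - tmon (- \<alpha>)))"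
    by (simp add: sym_series_def kostant_series_def prod.distrib mult_ac)
  finally have "alternating_sum n (emon ?\<rho> * kostant_series n)
      = sym_series n * (scalar_series c * denominator n)"
    by (simp only: alternating_sum_mult[OF pullback_sym_series] eq)
  also have "\<dots> = scalar_series c * theta n"
    by (simp add: theta_def mult_ac)
  finally have "alternating_sum n (emon ?\<rho> * kostant_series n) = scalar_series c * theta n" .
  then have "gen_exponent n \<mu> = c * coef_series (theta n) (\<mu> + ?\<rho>)"
    by (simp only: gen_exponent_alternating_sum coef_series_scalar_mult)
  with c show ?thesis by (rule that)
qed

subsection \<open>The extremal part of the series\<close>

text \<open>The part of \<open>theta\<close> of excess 0: up to the factor
  \<open>x_1 ... x_n\<close>, the Vandermonde product times Littlewood's product.\<close>

definition psi :: "nat \<Rightarrow> weight_series" where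
  "psi n = emon (half_sum n) * (\<Prod>\<alpha>\<in>diff_roots n. 1 - emon (- \<alpha>)) * (\<Prod>\<alpha>\<in>sum_roots n. geometric_root \<alpha>)"

lemma prod_pos_roots: "(\<Prod>\<alpha>\<in>pos_roots n. f \<alpha>) = (\<Prod>\<alpha>\<in>diff_roots n. f \<alpha>) * (\<Prod>\<alpha>\<in>sum_roots n. f \<alpha>)"
  for f :: "weight \<Rightarrow> weight_series"
  unfolding pos_roots_Un
  by (rule prod.union_disjoint[OF finite_diff_roots finite_sum_roots diff_roots_Int_sum_roots])

lemma sum_pos_roots: "(\<Sum>\<alpha>\<in>pos_roots n. f \<alpha>) = (\<Sum>\<alpha>\<in>diff_roots n. f \<alpha>) + (\<Sum>\<alpha>\<in>sum_roots n. f \<alpha>)"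
  for f :: "weight \<Rightarrow> 'a::comm_monoid_add"
  unfolding pos_roots_Un
  by (rule sum.union_disjoint[OF finite_diff_roots finite_sum_roots diff_roots_Int_sum_roots])

lemma wt_ge_of_minus_1:
  assumes "additive_form g" "wt_ge g c a (F - 1)" "0 \<le> a"
  shows "wt_ge g c 0 F"
  using wt_ge_add[OF wt_ge_mono[OF assms(2,3)] wt_ge_1[OF assms(1)]] by simp

lemma wt_ge_mult_minus_1:
  assumes g: "additive_form g" and F: "wt_ge g c a (F - 1)" and G: "wt_ge g c a (G - 1)" and a: "0 \<le> a"
  shows "wt_ge g c a (F * G - 1)"
proof -
  have "wt_ge g c (a + 0) ((F - 1) * G)"
    by (rule wt_ge_mult[OF g F wt_ge_of_minus_1[OF g G a]])
  then have "wt_ge g c a ((F - 1) * G + (G - 1))" using G by (intro wt_ge_add) simp_all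
  moreover have "(F - 1) * G + (G - 1) = F * G - 1" by (simp add: algebra_simps)
  ultimately show ?thesis by simp
qed

definition neg_sum :: "nat \<Rightarrow> weight \<Rightarrow> int" where
  "neg_sum n \<kappa> = - coord_sum n \<kappa>"

lemma additive_form_neg_sum: "additive_form (neg_sum n)"
  using additive_form_coord_sum by (auto simp: additive_form_def neg_sum_def)

lemma neg_sum_roots:
  shows "\<alpha> \<in> diff_roots n \<Longrightarrow> neg_sum n \<alpha> = 0" and "\<alpha> \<in> sum_roots n \<Longrightarrow> neg_sum n \<alpha> = - 2"
  by (simp_all add: neg_sum_def coord_sum_diff_roots coord_sum_sum_roots)

lemma neg_sum_uminus: "neg_sum n (- \<alpha>) = - neg_sum n \<alpha>"
  by (rule additive_form_uminus[OF additive_form_neg_sum])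

lemma theta_psi:
  "theta n = psi n * ((\<Prod>\<alpha>\<in>sum_roots n. 1 - emon (- \<alpha>)) *
     ((\<Prod>\<alpha>\<in>diff_roots n. geometric_root \<alpha>) *
     ((\<Prod>\<alpha>\<in>diff_roots n. geometric_root (- \<alpha>)) * (\<Prod>\<alpha>\<in>sum_roots n. geometric_root (- \<alpha>)))))"
  unfolding theta_def denominator_def sym_series_def psi_def prod_pos_roots prod.distrib
  by (simp only: mult_ac)

text \<open>For a sum root \<open>\<beta>\<close> the monomial \<open>t e^\<beta>\<close> has weight
  0, and for a difference root \<open>\<alpha>\<close> so has \<open>e^-\<alpha>\<close>. All other
  factors of \<open>theta\<close> are 1 plus terms of positive weight: 2 for
  \<open>e^-\<beta>\<close>, \<open>t e^\<alpha>\<close> and \<open>t e^-\<alpha>\<close>, 4 for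
  \<open>t e^-\<beta>\<close>.\<close>

lemma wt_ge_psi: "wt_ge (neg_sum n) 2 (neg_sum n (half_sum n)) (psi n)"
  and wt_ge_theta_minus_psi: "wt_ge (neg_sum n) 2 (neg_sum n (half_sum n) + 1) (theta n - psi n)"
proof -
  note g = additive_form_neg_sum[of n]
  have emon: "wt_ge (neg_sum n) 2 (- neg_sum n \<alpha>) (1 - emon (- \<alpha>) - 1)" for \<alpha>
    using wt_ge_uminus[OF wt_ge_emon[of "neg_sum n" "- \<alpha>" "- neg_sum n \<alpha>" 2]]
    by (simp add: neg_sum_uminus)
  have diff: "wt_ge (neg_sum n) 2 0 (1 - emon (- \<alpha>))" if "\<alpha> \<in> diff_roots n" for \<alpha>
    by (rule wt_ge_of_minus_1[OF g emon]) (simp add: neg_sum_roots that)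
  have sum: "wt_ge (neg_sum n) 2 0 (geometric_root \<alpha>)" if "\<alpha> \<in> sum_roots n" for \<alpha>
    by (rule wt_ge_of_minus_1[OF g wt_ge_geometric_root_minus_1[OF g refl]]) (simp_all add: neg_sum_roots that)
  have "wt_ge (neg_sum n) 2 (neg_sum n (half_sum n) + 0 + 0) (psi n)"
    unfolding psi_def
    by (intro wt_ge_mult[OF g] wt_ge_emon[OF refl] wt_ge_prod[OF g] diff sum)
  then show psi: "wt_ge (neg_sum n) 2 (neg_sum n (half_sum n)) (psi n)" by simp
  let ?Y = "(\<Prod>\<alpha>\<in>sum_roots n. 1 - emon (- \<alpha>)) *
     ((\<Prod>\<alpha>\<in>diff_roots n. geometric_root \<alpha>) *
     ((\<Prod>\<alpha>\<in>diff_roots n. geometric_root (- \<alpha>)) * (\<Prod>\<alpha>\<in>sum_roots n. geometric_root (- \<alpha>))))"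
  have geom: "wt_ge (neg_sum n) 2 1 (geometric_root \<alpha> - 1)" if "2 + neg_sum n \<alpha> \<ge> 1" for \<alpha>
    by (rule wt_ge_mono[OF wt_ge_geometric_root_minus_1[OF g refl]]) (use that in simp_all)
  have "wt_ge (neg_sum n) 2 1 (?Y - 1)"
  proof (intro wt_ge_mult_minus_1[OF g] wt_ge_prod_minus_1[OF g] geom)
    fix \<alpha> assume "\<alpha> \<in> sum_roots n"
    then show "wt_ge (neg_sum n) 2 1 (1 - emon (- \<alpha>) - 1)"
      by (intro wt_ge_mono[OF emon]) (simp add: neg_sum_roots)
  qed (simp_all add: neg_sum_roots neg_sum_uminus)
  from wt_ge_mult[OF g psi this]
  show "wt_ge (neg_sum n) 2 (neg_sum n (half_sum n) + 1) (theta n - psi n)"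
    unfolding theta_psi by (simp add: algebra_simps)
qed

text \<open>\<open>\<kappa>\<close> carries the shift by \<open>\<rho>\<close>: at
  \<open>\<kappa> = \<lambda> + \<rho>\<close> this is \<open>2d - |\<lambda>|\<close>.\<close>

definition excess :: "nat \<Rightarrow> nat \<Rightarrow> weight \<Rightarrow> int" where
  "excess n d \<kappa> = 2 * int d - coord_sum n \<kappa> + coord_sum n (half_sum n)"

lemma coef_theta_neg_excess: "excess n d \<kappa> < 0 \<Longrightarrow> coef (theta n) d \<kappa> = 0"
proof (rule ccontr)
  assume neg: "excess n d \<kappa> < 0" and "coef (theta n) d \<kappa> \<noteq> 0"
  then have "coef (psi n) d \<kappa> \<noteq> 0 \<or> coef (theta n - psi n) d \<kappa> \<noteq> 0" by (simp only: coef_diff) auto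
  with wt_geD[OF wt_ge_psi, of n d \<kappa>] wt_geD[OF wt_ge_theta_minus_psi, of n d \<kappa>] neg
  show False unfolding excess_def neg_sum_def by linarith
qed

text \<open>The opposite grading bounds \<open>psi\<close> from the other side, so
  \<open>psi\<close> is homogeneous of excess 0, while \<open>theta - psi\<close> has positive
  excess.\<close>

lemma coef_psi: "coef (psi n) d \<kappa> = (if excess n d \<kappa> = 0 then coef (theta n) d \<kappa> else 0)"
proof (cases "excess n d \<kappa> = 0")
  case True
  have "coef (theta n - psi n) d \<kappa> = 0"
    using wt_geD[OF wt_ge_theta_minus_psi, of n d \<kappa>] True unfolding excess_def neg_sum_def by linarith
  with True show ?thesis by simp
next
  case False
  note g = additive_form_coord_sum[of n]
  have emon: "wt_ge (coord_sum n) (- 2) (- coord_sum n \<alpha>) (1 - emon (- \<alpha>) - 1)" for \<alpha>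
    using wt_ge_uminus[OF wt_ge_emon[of "coord_sum n" "- \<alpha>" "- coord_sum n \<alpha>" "- 2"]]
    by (simp add: additive_form_uminus[OF g])
  have diff: "wt_ge (coord_sum n) (- 2) 0 (1 - emon (- \<alpha>))" if "\<alpha> \<in> diff_roots n" for \<alpha>
    by (rule wt_ge_of_minus_1[OF g emon]) (simp add: coord_sum_diff_roots that)
  have sum: "wt_ge (coord_sum n) (- 2) 0 (geometric_root \<alpha>)" if "\<alpha> \<in> sum_roots n" for \<alpha>
    by (rule wt_ge_of_minus_1[OF g wt_ge_geometric_root_minus_1[OF g refl]])
       (simp_all add: coord_sum_sum_roots that)
  have "wt_ge (coord_sum n) (- 2) (coord_sum n (half_sum n) + 0 + 0) (psi n)"
    unfolding psi_def
    by (intro wt_ge_mult[OF g] wt_ge_emon[OF refl] wt_ge_prod[OF g] diff sum)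
  then have "coef (psi n) d \<kappa> = 0"
    using wt_geD[of "coord_sum n" "- 2" _ "psi n" d \<kappa>] wt_geD[OF wt_ge_psi, of n d \<kappa>] False
    unfolding excess_def neg_sum_def by fastforce
  with False show ?thesis by simp
qed

lemma coef_theta_swap:
  assumes "1 \<le> i" "i < n"
  shows "coef (theta n) d (\<kappa>(i := \<kappa> (Suc i), Suc i := \<kappa> i)) = - coef (theta n) d \<kappa>"
proof -
  have "simple_refl n i \<kappa> = \<kappa>(i := \<kappa> (Suc i), Suc i := \<kappa> i)"
    using assms by (auto simp: fun_eq_iff refl_less_apply)
  then show ?thesis using antisym_coef[OF antisym_theta, of i n d \<kappa>] assms by simp
qed

lemma coef_psi_eq_0:
  assumes "1 \<le> i" "i < n" "\<kappa> i = \<kappa> (Suc i)"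
  shows "coef (psi n) d \<kappa> = 0"
proof -
  have "\<kappa>(i := \<kappa> (Suc i), Suc i := \<kappa> i) = \<kappa>" using assms(3) by (auto simp: fun_eq_iff)
  then show ?thesis using coef_theta_swap[OF assms(1,2), of d \<kappa>] by (simp add: coef_psi)
qed

lemma coef_psi_outside:
  assumes "k \<notin> {1..n}" "coef (psi n) d \<kappa> \<noteq> 0" shows "\<kappa> k = 0"
proof -
  have "wt_ge g 0 0 (psi n)" if g: "additive_form g" and r: "\<And>\<alpha>. \<alpha> \<in> pos_roots n \<Longrightarrow> g \<alpha> = 0"
    and h: "g (half_sum n) = 0" for g
  proof -
    have emon: "wt_ge g 0 0 (1 - emon (- \<alpha>))" if "\<alpha> \<in> pos_roots n" for \<alpha>
      by (intro wt_ge_diff wt_ge_1[OF g] wt_ge_emon) (simp add: additive_form_uminus[OF g] r that)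
    have geom: "wt_ge g 0 0 (geometric_root \<alpha>)" if "\<alpha> \<in> pos_roots n" for \<alpha>
      by (rule wt_ge_of_minus_1[OF g wt_ge_geometric_root_minus_1[OF g refl]]) (simp_all add: r that)
    have "wt_ge g 0 (g (half_sum n) + 0 + 0) (psi n)"
      unfolding psi_def
      by (intro wt_ge_mult[OF g] wt_ge_emon[OF refl] wt_ge_prod[OF g] emon geom)
         (simp_all add: pos_roots_Un)
    then show ?thesis by (simp add: h)
  qed
  note * = this
  have "wt_ge (\<lambda>v. v k) 0 0 (psi n)" "wt_ge (\<lambda>v. - v k) 0 0 (psi n)"
    using assms(1)
    by (auto intro!: * simp: additive_form_def pos_root_outside half_sum_apply simp del: atLeastAtMost_iff)
  from wt_geD[OF this(1) assms(2)] wt_geD[OF this(2) assms(2)] show ?thesis by simp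
qed

subsection \<open>Adding one variable\<close>

lemma diff_roots_Suc:
  "diff_roots (Suc n) = diff_roots n \<union> (\<lambda>i. eps i - eps (Suc n)) ` {1..n}"
proof
  show "diff_roots (Suc n) \<subseteq> diff_roots n \<union> (\<lambda>i. eps i - eps (Suc n)) ` {1..n}"
  proof
    fix \<alpha> assume "\<alpha> \<in> diff_roots (Suc n)"
    then obtain i j where *: "\<alpha> = eps i - eps j" "1 \<le> i" "i < j" "j \<le> Suc n"
      unfolding diff_roots_def by blast
    show "\<alpha> \<in> diff_roots n \<union> (\<lambda>i. eps i - eps (Suc n)) ` {1..n}"
    proof (cases "j = Suc n")
      case True
      then show ?thesis using * by (intro UnI2 image_eqI[of _ _ i]) auto
    next
      case False
      then show ?thesis using * diff_rootsI[of i j n] by auto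
    qed
  qed
  show "diff_roots n \<union> (\<lambda>i. eps i - eps (Suc n)) ` {1..n} \<subseteq> diff_roots (Suc n)"
  proof (intro Un_least subsetI)
    fix \<alpha> assume "\<alpha> \<in> diff_roots n"
    then obtain i j where "\<alpha> = eps i - eps j" "1 \<le> i" "i < j" "j \<le> n"
      unfolding diff_roots_def by blast
    then show "\<alpha> \<in> diff_roots (Suc n)" using diff_rootsI[of i j "Suc n"] by simp
  next
    fix \<alpha> assume "\<alpha> \<in> (\<lambda>i. eps i - eps (Suc n)) ` {1..n}"
    then show "\<alpha> \<in> diff_roots (Suc n)" by (auto intro!: diff_rootsI)
  qed
qed

lemma sum_roots_Suc:
  "sum_roots (Suc n) = sum_roots n \<union> (\<lambda>i. eps i + eps (Suc n)) ` {1..Suc n}"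
proof
  show "sum_roots (Suc n) \<subseteq> sum_roots n \<union> (\<lambda>i. eps i + eps (Suc n)) ` {1..Suc n}"
  proof
    fix \<alpha> assume "\<alpha> \<in> sum_roots (Suc n)"
    then obtain i j where *: "\<alpha> = eps i + eps j" "1 \<le> i" "i \<le> j" "j \<le> Suc n"
      unfolding sum_roots_def by blast
    show "\<alpha> \<in> sum_roots n \<union> (\<lambda>i. eps i + eps (Suc n)) ` {1..Suc n}"
    proof (cases "j = Suc n")
      case True
      then show ?thesis using * by (intro UnI2 image_eqI[of _ _ i]) auto
    next
      case False
      then show ?thesis using * sum_rootsI[of i n j] by auto
    qed
  qed
  show "sum_roots n \<union> (\<lambda>i. eps i + eps (Suc n)) ` {1..Suc n} \<subseteq> sum_roots (Suc n)"
  proof (intro Un_least subsetI)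
    fix \<alpha> assume "\<alpha> \<in> sum_roots n"
    then obtain i j where "\<alpha> = eps i + eps j" "1 \<le> i" "i \<le> j" "j \<le> n"
      unfolding sum_roots_def by blast
    then show "\<alpha> \<in> sum_roots (Suc n)" using sum_rootsI[of i "Suc n" j] by simp
  next
    fix \<alpha> assume "\<alpha> \<in> (\<lambda>i. eps i + eps (Suc n)) ` {1..Suc n}"
    then show "\<alpha> \<in> sum_roots (Suc n)" by (auto intro!: sum_rootsI)
  qed
qed

lemma roots_Suc_disjoint:
  shows "diff_roots n \<inter> (\<lambda>i. eps i - eps (Suc n)) ` {1..n} = {}"
    and "sum_roots n \<inter> (\<lambda>i. eps i + eps (Suc n)) ` {1..Suc n} = {}"
proof -
  have "\<alpha> (Suc n) = 0" if "\<alpha> \<in> diff_roots n \<or> \<alpha> \<in> sum_roots n" for \<alpha>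
    using pos_root_outside[of \<alpha> n "Suc n"] that by (auto simp: pos_roots_Un)
  then show "diff_roots n \<inter> (\<lambda>i. eps i - eps (Suc n)) ` {1..n} = {}"
    and "sum_roots n \<inter> (\<lambda>i. eps i + eps (Suc n)) ` {1..Suc n} = {}"
    by (force simp: eps_def split: if_splits)+
qed

lemma eps_inj: "eps i = eps j \<longleftrightarrow> i = j"
  by (metis eps_def zero_neq_one)

lemma inj_on_roots_Suc: "inj_on (\<lambda>i. eps i - v) A" "inj_on (\<lambda>i. eps i + v) A"
  by (auto simp: inj_on_def eps_inj)

lemma fold_roots_Suc:
  fixes f :: "weight \<Rightarrow> weight_series"
  shows "(\<Prod>\<alpha>\<in>diff_roots (Suc n). f \<alpha>) = (\<Prod>\<alpha>\<in>diff_roots n. f \<alpha>) * (\<Prod>i\<in>{1..n}. f (eps i - eps (Suc n)))"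
    and "(\<Prod>\<alpha>\<in>sum_roots (Suc n). f \<alpha>) = (\<Prod>\<alpha>\<in>sum_roots n. f \<alpha>) * (\<Prod>i\<in>{1..Suc n}. f (eps i + eps (Suc n)))"
  unfolding diff_roots_Suc sum_roots_Suc
  by (simp_all only: prod.union_disjoint[OF _ _ roots_Suc_disjoint(1)] prod.union_disjoint[OF _ _ roots_Suc_disjoint(2)]
      finite_diff_roots finite_sum_roots finite_imageI finite_atLeastAtMost prod.reindex[OF inj_on_roots_Suc(1)]
      prod.reindex[OF inj_on_roots_Suc(2)] o_def)

lemma sum_roots_Suc_sum:
  fixes f :: "weight \<Rightarrow> int"
  shows "(\<Sum>\<alpha>\<in>diff_roots (Suc n). f \<alpha>) = (\<Sum>\<alpha>\<in>diff_roots n. f \<alpha>) + (\<Sum>i\<in>{1..n}. f (eps i - eps (Suc n)))"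
    and "(\<Sum>\<alpha>\<in>sum_roots (Suc n). f \<alpha>) = (\<Sum>\<alpha>\<in>sum_roots n. f \<alpha>) + (\<Sum>i\<in>{1..Suc n}. f (eps i + eps (Suc n)))"
  unfolding diff_roots_Suc sum_roots_Suc
  by (simp_all only: sum.union_disjoint[OF _ _ roots_Suc_disjoint(1)] sum.union_disjoint[OF _ _ roots_Suc_disjoint(2)]
      finite_diff_roots finite_sum_roots finite_imageI finite_atLeastAtMost sum.reindex[OF inj_on_roots_Suc(1)]
      sum.reindex[OF inj_on_roots_Suc(2)] o_def)

definition ones :: "nat \<Rightarrow> weight" where
  "ones n = (\<lambda>k. if k \<in> {1..n} then 1 else 0)"

lemma half_sum_Suc: "half_sum (Suc n) = half_sum n + ones (Suc n)"
  by (auto simp: fun_eq_iff half_sum_apply ones_def)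

text \<open>The denominators that contain the new variable \<open>x_N\<close> are cleared, so that
  the remaining products can be expanded over subsets of \<open>{1..n}\<close>.\<close>

lemma psi_Suc:
  "psi (Suc n) * (\<Prod>i\<in>{1..n}. 1 - tmon (eps i + eps (Suc n))) * (1 - tmon (eps (Suc n) + eps (Suc n)))
    = emon (ones (Suc n)) * psi n * (\<Prod>i\<in>{1..n}. 1 - emon (eps (Suc n) - eps i))"
proof -
  let ?N = "Suc n"
  have last: "(\<Prod>i\<in>{1..?N}. h i) = h ?N * (\<Prod>i\<in>{1..n}. h i)" for h :: "nat \<Rightarrow> weight_series"
    by (rule prod.nat_ivl_Suc') simp
  have "(\<Prod>i\<in>{1..?N}. geometric_root (eps i + eps ?N)) * ((\<Prod>i\<in>{1..n}. 1 - tmon (eps i + eps ?N)) * (1 - tmon (eps ?N + eps ?N)))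
      = (\<Prod>i\<in>{1..?N}. geometric_root (eps i + eps ?N) * (1 - tmon (eps i + eps ?N)))"
    by (simp only: prod.distrib last[of "\<lambda>i. 1 - tmon (eps i + eps ?N)"] mult_ac)
  also have "\<dots> = 1" by (simp only: geometric_root_tmon prod.neutral_const)
  finally have geom: "(\<Prod>i\<in>{1..?N}. geometric_root (eps i + eps ?N)) *
      ((\<Prod>i\<in>{1..n}. 1 - tmon (eps i + eps ?N)) * (1 - tmon (eps ?N + eps ?N))) = 1" .
  have "psi ?N * (\<Prod>i\<in>{1..n}. 1 - tmon (eps i + eps ?N)) * (1 - tmon (eps ?N + eps ?N))
    = emon (ones ?N) * psi n * (\<Prod>i\<in>{1..n}. 1 - emon (- (eps i - eps ?N))) *
      ((\<Prod>i\<in>{1..?N}. geometric_root (eps i + eps ?N)) * ((\<Prod>i\<in>{1..n}. 1 - tmon (eps i + eps ?N)) * (1 - tmon (eps ?N + eps ?N))))"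
    unfolding psi_def fold_roots_Suc half_sum_Suc emon_add by (simp only: mult_ac)
  then show ?thesis unfolding geom by simp
qed

lemma coef_prod_tmon:
  assumes "finite X"
  shows "coef ((\<Prod>i\<in>X. tmon (v i)) * F) d \<kappa>
    = (if card X \<le> d then coef F (d - card X) (\<kappa> - (\<Sum>i\<in>X. v i)) else 0)"
  using assms
proof (induction X arbitrary: d \<kappa> rule: finite_induct)
  case empty
  then show ?case by (simp only: prod.empty sum.empty mult_1 card.empty diff_zero) simp
next
  case (insert x X)
  have *: "\<kappa> - v x - (\<Sum>i\<in>X. v i) = \<kappa> - (\<Sum>i\<in>insert x X. v i)"
    by (simp only: sum.insert[OF insert.hyps] diff_diff_eq)
  have "coef ((\<Prod>i\<in>insert x X. tmon (v i)) * F) d \<kappa> = coef (tmon (v x) * ((\<Prod>i\<in>X. tmon (v i)) * F)) d \<kappa>"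
    by (simp only: prod.insert[OF insert.hyps] mult.assoc)
  also have "\<dots> = (if d = 0 then 0 else if card X \<le> d - 1
      then coef F (d - 1 - card X) (\<kappa> - (\<Sum>i\<in>insert x X. v i)) else 0)"
    by (simp only: coef_tmon_mult insert.IH *)
  also have "\<dots> = (if card (insert x X) \<le> d
      then coef F (d - card (insert x X)) (\<kappa> - (\<Sum>i\<in>insert x X. v i)) else 0)"
    using insert.hyps by auto
  finally show ?case .
qed

lemma coef_prod_emon:
  assumes "finite X"
  shows "coef ((\<Prod>i\<in>X. emon (v i)) * F) d \<kappa> = coef F d (\<kappa> - (\<Sum>i\<in>X. v i))"
  using emon_sum[OF assms, of v] by (metis coef_emon_mult)

text \<open>The exponent left over when the terms \<open>t x_i x_N\<close>,
  \<open>i \<in> X\<close>, are chosen, possibly along with \<open>t x_N^2\<close>, which makes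
  \<open>m = card X + 2\<close>. Its counterpart \<open>raise\<close> belongs to the terms
  \<open>x_N / x_i\<close>.\<close>

definition lower :: "weight \<Rightarrow> nat set \<Rightarrow> nat \<Rightarrow> nat \<Rightarrow> weight" where
  "lower \<kappa> X N m = (\<lambda>k. \<kappa> k - (if k \<in> X then 1 else 0) - (if k = N then int m else 0))"

definition raise :: "weight \<Rightarrow> nat set \<Rightarrow> nat \<Rightarrow> weight" where
  "raise \<kappa> X N = (\<lambda>k. \<kappa> k - ones N k + (if k \<in> X then 1 else 0) - (if k = N then int (card X) else 0))"

definition even_shape :: "nat \<Rightarrow> weight \<Rightarrow> bool" where
  "even_shape n \<kappa> \<longleftrightarrow> (\<forall>i\<in>{1..n}. even (\<kappa> i - half_sum n i) \<and> 1 \<le> \<kappa> i)"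

text \<open>The coefficient of \<open>t^d e^\<kappa>\<close> in \<open>psi_Suc\<close>. The first
  term for the empty set is the unknown \<open>coef (psi N) d \<kappa>\<close>; all other terms on
  the left lie in smaller degree, which allows an induction on \<open>d\<close>.\<close>

lemma coef_psi_Suc:
  fixes n d \<kappa>
  defines "N \<equiv> Suc n"
  defines "T \<equiv> \<lambda>X m s. if s \<le> d then coef (psi N) (d - s) (lower \<kappa> X N m) else 0"
  shows "(\<Sum>X\<in>Pow {1..n}. (-1) ^ card X * (T X (card X) (card X) - T X (card X + 2) (card X + 1)))
    = (\<Sum>X\<in>Pow {1..n}. (-1) ^ card X * coef (psi n) d (raise \<kappa> X N))"
proof -
  have ind: "(\<Sum>i\<in>X. eps i k) = (if k \<in> X then 1 else 0)" if "finite X" for X k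
  proof -
    have "(\<Sum>i\<in>X. eps i k) = (\<Sum>i\<in>X. if i = k then 1 else 0)"
      by (rule sum.cong) (auto simp: eps_def)
    with that show ?thesis by simp
  qed
  have eN: "eps N k = (if k = N then 1 else 0)" for k
    by (simp add: eps_def)
  have fin: "finite X" if "X \<in> Pow {1..n}" for X using that finite_subset by auto
  have low: "\<kappa> - (\<Sum>i\<in>X. eps i + eps N) = lower \<kappa> X N (card X)" if "finite X" for X
    by (rule ext) (simp add: lower_def weight_sum_apply sum.distrib ind[OF that] eN)
  have low2: "lower \<kappa> X N m - (eps N + eps N) = lower \<kappa> X N (m + 2)" for X m
    by (rule ext) (simp add: lower_def eps_def)
  have low2': "\<kappa> - (eps N + eps N) - (\<Sum>i\<in>X. eps i + eps N) = lower \<kappa> X N (card X + 2)" if "finite X" for X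
    unfolding low2[symmetric] low[OF that, symmetric] by (simp add: algebra_simps)
  have up: "\<kappa> - ones N - (\<Sum>i\<in>X. eps N - eps i) = raise \<kappa> X N" if "finite X" for X
    by (rule ext) (simp add: raise_def weight_sum_apply sum_subtractf ind[OF that] eN)
  have "coef (psi N * (\<Prod>i\<in>{1..n}. 1 - tmon (eps i + eps N)) * (1 - tmon (eps N + eps N))) d \<kappa>
      = coef ((1 - tmon (eps N + eps N)) * (\<Sum>X\<in>Pow {1..n}. (-1) ^ card X * ((\<Prod>i\<in>X. tmon (eps i + eps N)) * psi N))) d \<kappa>"
    by (subst prod_diff_conv_sum) (simp_all add: sum_distrib_left sum_distrib_right mult_ac)
  also have "\<dots> = (\<Sum>X\<in>Pow {1..n}. (-1) ^ card X * (T X (card X) (card X)))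
      - (if d = 0 then 0 else (\<Sum>X\<in>Pow {1..n}. (-1) ^ card X *
          (if card X \<le> d - 1 then coef (psi N) (d - 1 - card X) (lower \<kappa> X N (card X + 2)) else 0)))"
    unfolding left_diff_distrib mult_1 coef_diff coef_tmon_mult coef_sum coef_sign_mult T_def
    by (simp only: coef_prod_tmon[OF fin] low[OF fin] low2'[OF fin] cong: sum.cong)
  also have "(if d = 0 then 0 else (\<Sum>X\<in>Pow {1..n}. (-1) ^ card X *
          (if card X \<le> d - 1 then coef (psi N) (d - 1 - card X) (lower \<kappa> X N (card X + 2)) else 0)))
      = (\<Sum>X\<in>Pow {1..n}. (-1) ^ card X * T X (card X + 2) (card X + 1))"
  proof (cases d)
    case 0
    then show ?thesis by (simp add: T_def)
  next
    case (Suc d')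
    then show ?thesis by (auto simp: T_def intro!: sum.cong)
  qed
  finally have lhs: "coef (psi N * (\<Prod>i\<in>{1..n}. 1 - tmon (eps i + eps N)) * (1 - tmon (eps N + eps N))) d \<kappa>
      = (\<Sum>X\<in>Pow {1..n}. (-1) ^ card X * (T X (card X) (card X) - T X (card X + 2) (card X + 1)))"
    by (simp only: sum_subtractf right_diff_distrib)
  have "coef (emon (ones N) * psi n * (\<Prod>i\<in>{1..n}. 1 - emon (eps N - eps i))) d \<kappa>
      = coef (emon (ones N) * (\<Sum>X\<in>Pow {1..n}. (-1) ^ card X * ((\<Prod>i\<in>X. emon (eps N - eps i)) * psi n))) d \<kappa>"
    by (subst prod_diff_conv_sum) (simp_all add: sum_distrib_left sum_distrib_right mult_ac)
  also have "\<dots> = (\<Sum>X\<in>Pow {1..n}. (-1) ^ card X * coef (psi n) d (raise \<kappa> X N))"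
    unfolding coef_emon_mult coef_sum coef_sign_mult
    by (simp only: coef_prod_emon[OF fin] up[OF fin] cong: sum.cong)
  finally show ?thesis using lhs unfolding N_def psi_Suc by simp
qed

text \<open>Neighbouring coordinates of \<open>\<rho>\<close> have opposite parity, so the parity
  condition turns a decreasing \<open>\<kappa>\<close> into a strictly decreasing one. Being
  positive, it dominates \<open>\<rho>\<close>, and \<open>\<kappa> - \<rho>\<close> is a partition
  with even parts.\<close>

lemma even_shape_ge_half_sum:
  assumes dec: "\<And>i. 1 \<le> i \<Longrightarrow> i < n \<Longrightarrow> \<kappa> (Suc i) \<le> \<kappa> i" and es: "even_shape n \<kappa>"
  shows "coord_sum n (half_sum n) \<le> coord_sum n \<kappa>"
proof -
  have ge: "half_sum n (n - m) \<le> \<kappa> (n - m)" if "m < n" for m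
    using that
  proof (induction m)
    case 0
    then show ?case using es by (auto simp: even_shape_def half_sum_apply)
  next
    case (Suc m)
    let ?i = "n - Suc m"
    have i: "1 \<le> ?i" "?i < n" "Suc ?i = n - m" using Suc.prems by auto
    have h: "half_sum n ?i = half_sum n (n - m) + 1" using Suc.prems by (auto simp: half_sum_apply)
    have "even (\<kappa> ?i - half_sum n ?i)" "even (\<kappa> (n - m) - half_sum n (n - m))"
      using es i Suc.prems by (auto simp: even_shape_def)
    then have "\<kappa> ?i \<noteq> \<kappa> (n - m)" using h by presburger
    then show ?case using dec[OF i(1,2)] Suc h i(3) by simp
  qed
  show ?thesis unfolding coord_sum_def
  proof (rule sum_mono)
    fix k assume "k \<in> {1..n}"
    then show "half_sum n k \<le> \<kappa> k" using ge[of "n - k"] by auto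
  qed
qed

text \<open>Littlewood's identity \<open>\<Prod> 1/(1 - t x\<^sub>i x\<^sub>j) = \<Sum> t\<^sup>d s\<^sub>\<nu>\<close> over the partitions \<open>\<nu>\<close> of \<open>2d\<close> with even parts.
  The induction on the number of variables works because moving an \<open>r\<close>-subset of the coordinates
  up by one or down by one makes all parities right for the same subset, the set of wrong coordinates.\<close>

lemma coef_psi_littlewood:
  assumes "\<And>i. 1 \<le> i \<Longrightarrow> i < n \<Longrightarrow> \<kappa> (Suc i) \<le> \<kappa> i"
    and "\<And>k. k \<notin> {1..n} \<Longrightarrow> \<kappa> k = 0" and "excess n d \<kappa> = 0"
  shows "coef (psi n) d \<kappa> = of_bool (even_shape n \<kappa>)"
  using assms
proof (induction n arbitrary: d \<kappa>)
  case 0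
  have "half_sum 0 = 0" by (simp add: fun_eq_iff half_sum_apply)
  moreover have "diff_roots 0 = {}" "sum_roots 0 = {}" by (auto simp: diff_roots_def sum_roots_def)
  ultimately have psi: "psi 0 = 1" by (simp add: psi_def)
  have \<kappa>: "\<kappa> = 0" using 0 by (auto simp: fun_eq_iff)
  have d: "d = 0" using 0 by (simp add: excess_def coord_sum_def)
  have "coef 1 0 0 = 1" by (simp only: coef_1 simp_thms if_True)
  moreover have "even_shape 0 0" by (simp only: even_shape_def) simp
  ultimately show ?case unfolding psi \<kappa> d by (simp only: of_bool_eq)
next
  case (Suc n)
  note outer = Suc.IH
  let ?N = "Suc n"
  have hs: "half_sum ?N i = half_sum n i + 1" if "i \<in> {1..n}" for i
    using that by (simp add: half_sum_apply)
  have hN: "half_sum ?N ?N = 1" by (simp add: half_sum_apply)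
  show ?case
    using Suc.prems
  proof (induction d arbitrary: \<kappa> rule: less_induct)
    case (less d)
    note dec = less.prems(1) and out = less.prems(2) and exc = less.prems(3)
    show ?case
    proof (cases "\<exists>i. 1 \<le> i \<and> i < ?N \<and> \<kappa> i = \<kappa> (Suc i)")
      case True
      then obtain i where i: "1 \<le> i" "i < ?N" "\<kappa> i = \<kappa> (Suc i)" by blast
      have "half_sum ?N i = half_sum ?N (Suc i) + 1" using i by (simp add: half_sum_apply)
      then have "\<not> (even (\<kappa> i - half_sum ?N i) \<and> even (\<kappa> (Suc i) - half_sum ?N (Suc i)))"
        using i(3) by presburger
      moreover have "i \<in> {1..?N}" "Suc i \<in> {1..?N}" using i by auto
      ultimately have "\<not> even_shape ?N \<kappa>" unfolding even_shape_def by blast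
      then show ?thesis using coef_psi_eq_0[OF i] by simp
    next
      case False
      with dec have strict: "\<kappa> (Suc i) < \<kappa> i" if "1 \<le> i" "i \<le> n" for i
        using that by (metis le_imp_less_Suc le_less)
      have gt: "\<kappa> ?N < \<kappa> (?N - m)" if "1 \<le> m" "m \<le> n" for m
        using that
      proof (induction m rule: nat_induct_at_least)
        case base
        then show ?case using strict[of n] by simp
      next
        case (Suc m)
        moreover from this have "1 \<le> n - m" by simp
        ultimately show ?case using strict[of "n - m"] by (simp add: Suc_diff_le)
      qed
      have gtN: "\<kappa> ?N < \<kappa> i" if "i \<in> {1..n}" for i
        using gt[of "?N - i"] that by auto
      define B where "B = {i \<in> {1..n}. odd (\<kappa> i - half_sum ?N i)}"
      \<comment> \<open>The condition on the last coordinate once it is lowered by \<open>m\<close>.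
        The other coordinates are larger, so their positivity follows from it.\<close>
      define P where "P m \<longleftrightarrow> even (\<kappa> ?N - int m - 1) \<and> 1 \<le> \<kappa> ?N - int m" for m
      have es: "even_shape ?N (lower \<kappa> X ?N m) \<longleftrightarrow> X = B \<and> P m" if X: "X \<subseteq> {1..n}" for X m
      proof -
        have "?N \<notin> X" using X by auto
        then have eN: "lower \<kappa> X ?N m ?N = \<kappa> ?N - int m" by (simp add: lower_def)
        have ei: "lower \<kappa> X ?N m i = \<kappa> i - of_bool (i \<in> X)" if "i \<in> {1..n}" for i
          using that by (auto simp: lower_def)
        have "even_shape ?N (lower \<kappa> X ?N m) \<longleftrightarrow>
            (\<forall>i\<in>{1..n}. even (\<kappa> i - of_bool (i \<in> X) - half_sum ?N i) \<and> 1 \<le> \<kappa> i - of_bool (i \<in> X)) \<and> P m"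
          unfolding even_shape_def P_def
          using eN ei hN by (auto simp: atLeastAtMostSuc_conv)
        also have "\<dots> \<longleftrightarrow> (\<forall>i\<in>{1..n}. even (\<kappa> i - of_bool (i \<in> X) - half_sum ?N i)) \<and> P m"
          using gtN by (fastforce simp: P_def)
        also have "(\<forall>i\<in>{1..n}. even (\<kappa> i - of_bool (i \<in> X) - half_sum ?N i)) \<longleftrightarrow> (\<forall>i\<in>{1..n}. i \<in> X \<longleftrightarrow> i \<in> B)"
          unfolding B_def by (intro ball_cong) auto
        also have "\<dots> \<longleftrightarrow> X = B" using X by (auto simp: B_def)
        finally show ?thesis .
      qed
      have csN: "coord_sum ?N (lower \<kappa> X ?N m) = coord_sum ?N \<kappa> - int (card X) - int m" if X: "X \<subseteq> {1..n}" for X m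
      proof -
        have "(\<Sum>k = 1..?N. if k \<in> X then 1 else 0 :: int) = int (card X)"
          using X by (subst sum.If_cases) (auto intro!: arg_cong[of _ _ card])
        moreover have "(\<Sum>k = 1..?N. if k = ?N then int m else 0) = int m" by simp
        ultimately show ?thesis by (simp add: coord_sum_def lower_def sum_subtractf)
      qed
      define T where "T X m s = (if s \<le> d then coef (psi ?N) (d - s) (lower \<kappa> X ?N m) else 0)" for X m s
      have T: "T X m s = of_bool (X = B \<and> P m)"
        if X: "X \<subseteq> {1..n}" and s: "card X + m = 2 * s" "1 \<le> s" "card X \<le> m" for X m s
      proof -
        let ?k = "lower \<kappa> X ?N m"
        have wdec: "?k (Suc i) \<le> ?k i" if i: "1 \<le> i" "i < ?N" for i
        proof (cases "i = n")
          case True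
          have "m \<ge> 1" using s by linarith
          moreover have "?N \<notin> X" using X by auto
          ultimately show ?thesis using strict[of n] i True by (auto simp: lower_def)
        next
          case False
          then show ?thesis using strict[of i] i by (auto simp: lower_def)
        qed
        show ?thesis
        proof (cases "s \<le> d")
          case True
          have "excess ?N (d - s) ?k = 0"
            using exc s(1) True csN[OF X, of m] unfolding excess_def by simp
          moreover have "?k j = 0" if "j \<notin> {1..?N}" for j
            using that out[OF that] X by (auto simp: lower_def)
          ultimately have "coef (psi ?N) (d - s) ?k = of_bool (even_shape ?N ?k)"
            using s(2) True wdec by (intro less.IH) auto
          then show ?thesis using True by (simp add: T_def es[OF X])
        next
          case False
          \<comment> \<open>Here the term is 0 for lack of degree. An even shape has at least the
            coordinate sum of \<open>\<rho>\<close>, which would force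
            \<open>s \<le> d\<close>.\<close>
          have "\<not> even_shape ?N ?k"
          proof
            assume "even_shape ?N ?k"
            from even_shape_ge_half_sum[OF wdec this] have "coord_sum ?N (half_sum ?N) \<le> coord_sum ?N ?k" .
            then show False using exc s(1) False csN[OF X, of m] unfolding excess_def by linarith
          qed
          then show ?thesis using False by (simp add: T_def es[OF X])
        qed
      qed
      have low0: "lower \<kappa> {} ?N 0 = \<kappa>" by (rule ext) (simp add: lower_def)
      have T0: "T {} 0 0 = coef (psi ?N) d \<kappa>" by (simp add: T_def low0)
      have es0: "even_shape ?N \<kappa> \<longleftrightarrow> {} = B \<and> P 0" using es[of "{}" 0] by (simp add: low0)
      \<comment> \<open>The deviation from the claim. It enters the expansion once, at
        \<open>X = {}\<close>, and the two sides agree without it.\<close>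
      define \<delta> where "\<delta> = coef (psi ?N) d \<kappa> - of_bool (even_shape ?N \<kappa>)"
      have T1: "T X (card X) (card X) = of_bool (X = B \<and> P (card X)) + (if X = {} then \<delta> else 0)"
        if X: "X \<subseteq> {1..n}" for X
      proof (cases "X = {}")
        case True
        then show ?thesis using T0 es0 by (simp add: \<delta>_def)
      next
        case False
        then have "1 \<le> card X" using X finite_subset by (auto simp: Suc_le_eq card_gt_0_iff)
        then show ?thesis using False T[OF X, of "card X" "card X"] by simp
      qed
      have T2: "T X (card X + 2) (card X + 1) = of_bool (X = B \<and> P (card X + 2))" if X: "X \<subseteq> {1..n}" for X
        using T[OF X, of "card X + 2" "card X + 1"] by simp
      have BP: "B \<in> Pow {1..n}" by (auto simp: B_def)
      have R: "coef (psi n) d (raise \<kappa> X ?N) = of_bool (X = B \<and> \<kappa> ?N = 1 + int (card X))" if X: "X \<subseteq> {1..n}" for X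
      proof -
        let ?k = "raise \<kappa> X ?N"
        have N: "?k ?N = \<kappa> ?N - 1 - int (card X)" using X by (auto simp: raise_def ones_def)
        show ?thesis
        proof (cases "\<kappa> ?N = 1 + int (card X)")
          case False
          then have "?k ?N \<noteq> 0" using N by simp
          then have "coef (psi n) d ?k = 0" using coef_psi_outside[of ?N n d ?k] by auto
          with False show ?thesis by simp
        next
          case True
          have ki: "?k i = \<kappa> i - 1 + of_bool (i \<in> X)" if "i \<in> {1..n}" for i
            using that by (auto simp: raise_def ones_def)
          have wdec: "?k (Suc i) \<le> ?k i" if i: "1 \<le> i" "i < n" for i
            using strict[of i] ki[of i] ki[of "Suc i"] i by (auto split: if_splits)
          have outk: "?k j = 0" if "j \<notin> {1..n}" for j
          proof (cases "j = ?N")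
            case True
            with N \<open>\<kappa> ?N = 1 + int (card X)\<close> show ?thesis by simp
          next
            case False
            then have "j \<notin> {1..?N}" "j \<notin> X" using that X by auto
            then show ?thesis using out[of j] False by (auto simp: raise_def ones_def)
          qed
          have "(\<Sum>k = 1..n. of_bool (k \<in> X) :: int) = int (card X)"
            using X by (simp add: of_bool_def sum.If_cases Int_absorb1)
          then have "coord_sum n ?k = coord_sum n \<kappa> - int n + int (card X)"
            unfolding coord_sum_def by (simp add: ki sum.distrib sum_subtractf)
          moreover have "coord_sum ?N \<kappa> = coord_sum n \<kappa> + \<kappa> ?N" by (simp add: coord_sum_def)
          moreover have "coord_sum ?N (half_sum ?N) = coord_sum n (half_sum n) + int n + 1"
            by (simp add: coord_sum_def hs hN sum.distrib)
          ultimately have "excess n d ?k = 0" using exc True unfolding excess_def by linarith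
          from outer[OF wdec outk this] have "coef (psi n) d ?k = of_bool (even_shape n ?k)" .
          moreover have "even_shape n ?k \<longleftrightarrow> X = B"
          proof -
            have "even_shape n ?k \<longleftrightarrow> (\<forall>i\<in>{1..n}. even (\<kappa> i - 1 + of_bool (i \<in> X) - half_sum n i) \<and> 1 \<le> \<kappa> i - 1 + of_bool (i \<in> X))"
              unfolding even_shape_def using ki by auto
            also have "\<dots> \<longleftrightarrow> (\<forall>i\<in>{1..n}. even (\<kappa> i - 1 + of_bool (i \<in> X) - half_sum n i))"
              using gtN True by fastforce
            also have "\<dots> \<longleftrightarrow> (\<forall>i\<in>{1..n}. i \<in> X \<longleftrightarrow> i \<in> B)"
              unfolding B_def by (intro ball_cong) (auto simp: hs)
            also have "\<dots> \<longleftrightarrow> X = B" using X by (auto simp: B_def)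
            finally show ?thesis .
          qed
          ultimately show ?thesis using True by simp
        qed
      qed
      \<comment> \<open>The factor \<open>1 - t x_N^2\<close> makes the admissible values telescope:
        what survives is the case where the last coordinate is lowered exactly to 1. It matches the
        right-hand side, where \<open>x_N\<close> has to disappear.\<close>
      have P2: "of_bool (P m) - of_bool (P (m + 2)) = (of_bool (\<kappa> ?N = 1 + int m) :: int)" for m
      proof -
        have "P (m + 2) \<longleftrightarrow> P m \<and> \<kappa> ?N \<noteq> 1 + int m" unfolding P_def by presburger
        moreover have "\<kappa> ?N = 1 + int m \<Longrightarrow> P m" unfolding P_def by simp
        ultimately show ?thesis by auto
      qed
      have single: "(\<Sum>X\<in>Pow {1..n}. (-1) ^ card X * (of_bool (X = B \<and> Q (card X)) :: int))
          = (-1) ^ card B * of_bool (Q (card B))" for Q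
      proof -
        have "(\<Sum>X\<in>Pow {1..n}. (-1) ^ card X * (of_bool (X = B \<and> Q (card X)) :: int))
            = (\<Sum>X\<in>Pow {1..n}. if X = B then (-1) ^ card B * of_bool (Q (card B)) else 0)"
          by (rule sum.cong) auto
        then show ?thesis using BP by (simp only: sum.delta finite_Pow_iff finite_atLeastAtMost if_True)
      qed
      have "(\<Sum>X\<in>Pow {1..n}. (-1) ^ card X * (T X (card X) (card X) - T X (card X + 2) (card X + 1)))
          = (\<Sum>X\<in>Pow {1..n}. (-1) ^ card X * coef (psi n) d (raise \<kappa> X ?N))"
        unfolding T_def by (rule coef_psi_Suc)
      also have "\<dots> = (-1) ^ card B * of_bool (\<kappa> ?N = 1 + int (card B))"
        unfolding single[of "\<lambda>m. \<kappa> ?N = 1 + int m", symmetric] by (intro sum.cong) (simp_all add: R)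
      also have "(\<Sum>X\<in>Pow {1..n}. (-1) ^ card X * (T X (card X) (card X) - T X (card X + 2) (card X + 1)))
          = (\<Sum>X\<in>Pow {1..n}. (-1) ^ card X * of_bool (X = B \<and> P (card X))
              - (-1) ^ card X * of_bool (X = B \<and> P (card X + 2)) + (if X = {} then \<delta> else 0))"
      proof (rule sum.cong[OF refl])
        fix X assume "X \<in> Pow {1..n}"
        then have X: "X \<subseteq> {1..n}" by simp
        show "(-1) ^ card X * (T X (card X) (card X) - T X (card X + 2) (card X + 1))
          = (-1) ^ card X * of_bool (X = B \<and> P (card X))
              - (-1) ^ card X * of_bool (X = B \<and> P (card X + 2)) + (if X = {} then \<delta> else 0)"
          unfolding T1[OF X] T2[OF X] by (cases "X = {}") (simp_all add: right_diff_distrib)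
      qed
      also have "\<dots> = (-1) ^ card B * of_bool (P (card B)) - (-1) ^ card B * of_bool (P (card B + 2)) + \<delta>"
        unfolding sum.distrib sum_subtractf single[of P] single[of "\<lambda>m. P (m + 2)"] by simp
      also have "\<dots> = (-1) ^ card B * of_bool (\<kappa> ?N = 1 + int (card B)) + \<delta>"
        unfolding P2[symmetric] by (simp add: right_diff_distrib)
      finally show ?thesis by (simp add: \<delta>_def)
    qed
  qed
qed

subsection \<open>A recursion from the Euler derivation\<close>

lemma euler_1: "additive_form g \<Longrightarrow> euler g c 1 = 0"
  by (rule coef_eqI) (simp add: coef_euler coef_1 additive_form_0)

lemma euler_tmon: "additive_form g \<Longrightarrow> euler g c (tmon \<alpha>) = of_int (c + g \<alpha>) * tmon \<alpha>"
proof -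
  assume g: "additive_form g"
  have "euler g c fps_X = of_int c * fps_X"
  proof (rule coef_eqI)
    fix d \<kappa>
    have X: "coef fps_X d \<kappa> = (if d = 1 \<and> \<kappa> = 0 then 1 else 0)" for d \<kappa>
      by (simp add: coef_def fps_X_def lookup_one when_def)
    have "coef (of_int c * fps_X) d \<kappa> = c * coef fps_X d \<kappa>"
      using coef_mult_const[of 0 c fps_X d \<kappa>]
      by (metis diff_zero fps_of_int of_int_eq_id id_apply single_of_int)
    then show "coef (euler g c fps_X) d \<kappa> = coef (of_int c * fps_X) d \<kappa>"
      by (simp add: coef_euler X additive_form_0[OF g])
  qed
  then show ?thesis
    unfolding tmon_def euler_mult[OF g] euler_emon by (simp add: algebra_simps)
qed

text \<open>The logarithmic derivative of \<open>1/(1 - t e^\<alpha>)\<close>, from differentiating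
  \<open>geometric_root_tmon\<close>.\<close>

lemma euler_geometric_root:
  assumes g: "additive_form g"
  shows "euler g c (geometric_root \<alpha>) = geometric_root \<alpha> * (of_int (c + g \<alpha>) * (tmon \<alpha> * geometric_root \<alpha>))"
proof -
  let ?G = "geometric_root \<alpha>"
  have "euler g c (?G * (1 - tmon \<alpha>)) = 0" by (simp only: geometric_root_tmon euler_1[OF g])
  then have *: "euler g c ?G * (1 - tmon \<alpha>) = ?G * (of_int (c + g \<alpha>) * tmon \<alpha>)"
    by (simp add: euler_mult[OF g] euler_diff euler_1[OF g] euler_tmon[OF g] algebra_simps)
  have "euler g c ?G * (?G * (1 - tmon \<alpha>)) = euler g c ?G * (1 - tmon \<alpha>) * ?G"
    by (simp only: mult_ac)
  also have "\<dots> = ?G * (of_int (c + g \<alpha>) * (tmon \<alpha> * ?G))"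
    unfolding * by (simp only: mult_ac)
  finally show ?thesis by (simp only: geometric_root_tmon mult_1_right)
qed

lemma euler_prod_log:
  assumes g: "additive_form g" and "\<And>i. i \<in> I \<Longrightarrow> euler g c (F i) = F i * u i"
  shows "euler g c (\<Prod>i\<in>I. F i) = (\<Prod>i\<in>I. F i) * (\<Sum>i\<in>I. u i)"
  using assms(2)
proof (induction I rule: infinite_finite_induct)
  case (insert i I)
  then show ?case by (simp add: euler_mult[OF g] algebra_simps)
qed (simp_all add: euler_1[OF g])

text \<open>Meant for the factors \<open>1 - e^-\<alpha>\<close>, whose logarithmic derivatives are
  not in the ring: the differentiated factor is replaced, not factored out.\<close>

lemma euler_prod:
  assumes g: "additive_form g" and "finite I"
  shows "euler g c (\<Prod>i\<in>I. F i) = (\<Sum>i\<in>I. euler g c (F i) * (\<Prod>j\<in>I - {i}. F j))"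
  using assms(2)
proof (induction I rule: finite_induct)
  case (insert i I)
  have "(\<Prod>j\<in>insert i I - {k}. F j) = F i * (\<Prod>j\<in>I - {k}. F j)" if "k \<in> I" for k
  proof -
    have "insert i I - {k} = insert i (I - {k})" using that insert.hyps by auto
    then show ?thesis using insert.hyps by simp
  qed
  moreover have "insert i I - {i} = I" using insert.hyps by auto
  ultimately show ?case
    using insert by (simp add: euler_mult[OF g] sum_distrib_left algebra_simps)
qed (simp add: euler_1[OF g])

section \<open>Coefficients of the logarithmic derivatives\<close>

definition scale :: "int \<Rightarrow> weight \<Rightarrow> weight" where
  "scale c v = (\<lambda>k. c * v k)"

lemma coef_geometric_mult:
  "coef (geometric_root \<alpha> * F) d \<kappa> = (\<Sum>k=0..d. coef F (d - k) (\<kappa> - scale (int k) \<alpha>))"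
proof (induction d arbitrary: \<kappa>)
  case 0
  have "coef (geometric_root \<alpha> * F) 0 \<kappa> = coef (F + tmon \<alpha> * (geometric_root \<alpha> * F)) 0 \<kappa>"
    by (subst geometric_root_unfold) (simp add: algebra_simps)
  moreover have "\<kappa> - scale 0 \<alpha> = \<kappa>" by (rule ext) (simp add: scale_def)
  ultimately show ?case by simp
next
  case (Suc d)
  have "coef (geometric_root \<alpha> * F) (Suc d) \<kappa> = coef (F + tmon \<alpha> * (geometric_root \<alpha> * F)) (Suc d) \<kappa>"
    by (subst geometric_root_unfold) (simp add: algebra_simps)
  also have "\<dots> = coef F (Suc d) \<kappa> + coef (geometric_root \<alpha> * F) d (\<kappa> - \<alpha>)"
    by (simp only: coef_add coef_tmon_mult nat.distinct if_False diff_Suc_1)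
  also have "\<dots> = coef F (Suc d) \<kappa> + (\<Sum>k=0..d. coef F (Suc d - Suc k) (\<kappa> - scale (int (Suc k)) \<alpha>))"
  proof -
    have "\<kappa> - \<alpha> - scale (int k) \<alpha> = \<kappa> - scale (int (Suc k)) \<alpha>" for k
      by (rule ext) (simp add: scale_def algebra_simps)
    then show ?thesis by (simp only: Suc.IH diff_Suc_Suc)
  qed
  also have "\<dots> = (\<Sum>k=0..Suc d. coef F (Suc d - k) (\<kappa> - scale (int k) \<alpha>))"
  proof -
    have "\<kappa> - scale (int 0) \<alpha> = \<kappa>" by (rule ext) (simp add: scale_def)
    then show ?thesis by (simp only: sum.atLeast0_atMost_Suc_shift o_def diff_zero)
  qed
  finally show ?case .
qed

lemma coef_tmon_geometric_mult:
  "coef (tmon \<alpha> * geometric_root \<alpha> * F) d \<kappa> = (\<Sum>k=1..d. coef F (d - k) (\<kappa> - scale (int k) \<alpha>))"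
proof (cases d)
  case 0
  then show ?thesis by (simp add: mult.assoc)
next
  case (Suc d')
  have *: "\<kappa> - \<alpha> - scale (int k) \<alpha> = \<kappa> - scale (int (Suc k)) \<alpha>" for k
    by (rule ext) (simp add: scale_def algebra_simps)
  have "coef (tmon \<alpha> * geometric_root \<alpha> * F) d \<kappa> = coef (geometric_root \<alpha> * F) d' (\<kappa> - \<alpha>)"
    by (simp only: Suc mult.assoc coef_tmon_mult nat.distinct if_False diff_Suc_1)
  also have "\<dots> = (\<Sum>k=0..d'. coef F (Suc d' - Suc k) (\<kappa> - scale (int (Suc k)) \<alpha>))"
    by (simp only: coef_geometric_mult * diff_Suc_Suc)
  also have "\<dots> = (\<Sum>k=1..Suc d'. coef F (Suc d' - k) (\<kappa> - scale (int k) \<alpha>))"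
    using sum.shift_bounds_cl_Suc_ivl[of "\<lambda>k. coef F (Suc d' - k) (\<kappa> - scale (int k) \<alpha>)" 0 d'] by simp
  finally show ?thesis by (simp only: Suc)
qed

text \<open>\<open>e\<^sup>-\<^sup>\<beta> / (1 - e\<^sup>-\<^sup>\<beta>)\<close> is not in the ring, but expanding it as a series acts correctly on a multiple of
  \<open>1 - e\<^sup>-\<^sup>\<beta>\<close>, since the supports are finite.\<close>

lemma coef_cofactor:
  assumes "\<beta> k0 \<noteq> 0"
  shows "\<forall>\<^sub>F K in sequentially. coef (emon (- \<beta>) * R) d \<kappa>
    = (\<Sum>k=1..K. coef ((1 - emon (- \<beta>)) * R) d (\<kappa> + scale (int k) \<beta>))"
proof -
  let ?S = "{\<mu>. coef R d \<mu> \<noteq> 0}" and ?f = "\<lambda>K. \<kappa> + scale (int (Suc K)) \<beta>"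
  have "inj ?f"
  proof (rule injI)
    fix x y assume "?f x = ?f y"
    then have "?f x k0 = ?f y k0" by simp
    then have "(int (Suc x) - int (Suc y)) * \<beta> k0 = 0" by (simp add: scale_def algebra_simps)
    then show "x = y" using assms by simp
  qed
  then have "finite (?f -` ?S)" by (intro finite_vimageI finite_coef)
  then have ev: "\<forall>\<^sub>F K in sequentially. K \<notin> ?f -` ?S"
    by (simp add: eventually_cofinite flip: cofinite_eq_sequentially)
  define a r where "a k = coef ((1 - emon (- \<beta>)) * R) d (\<kappa> + scale (int k) \<beta>)" and "r K = coef R d (?f K)" for k K
  define L where "L = coef (emon (- \<beta>) * R) d \<kappa>"
  have base: "L = r 0"
  proof -
    have "\<kappa> - - \<beta> = ?f 0" by (rule ext) (simp add: scale_def)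
    then show ?thesis by (simp only: L_def coef_emon_mult r_def)
  qed
  have step: "a (Suc K) = r K - r (Suc K)" for K
  proof -
    have "?f K - - \<beta> = ?f (Suc K)" by (rule ext) (simp add: scale_def algebra_simps)
    then show ?thesis by (simp only: a_def r_def left_diff_distrib mult_1 coef_diff coef_emon_mult)
  qed
  \<comment> \<open>Telescoping. The remainder \<open>r K\<close> vanishes for all but finitely many
    \<open>K\<close>, when its argument has left the finite support of \<open>R\<close>.\<close>
  have expand: "L = (\<Sum>k=1..K. a k) + r K" for K
    by (induction K) (simp_all add: base step)
  from ev show ?thesis
  proof (rule eventually_mono)
    fix K assume "K \<notin> ?f -` ?S"
    then have "r K = 0" by (simp only: vimage_eq mem_Collect_eq not_not r_def)
    with expand[of K] show "coef (emon (- \<beta>) * R) d \<kappa>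
      = (\<Sum>k=1..K. coef ((1 - emon (- \<beta>)) * R) d (\<kappa> + scale (int k) \<beta>))"
      by (simp only: L_def a_def add_0_right)
  qed
qed

text \<open>Each factor contributes in proportion to the weight of its monomial. The difference root
  factors of the Weyl denominator and Littlewood's product have weight 0 and drop out.\<close>

lemma euler_theta:
  "euler (neg_sum n) 2 (theta n)
    = of_int (neg_sum n (half_sum n)) * theta n
      + (\<Sum>\<beta>\<in>sum_roots n. 2 * (- (emon (- \<beta>) *
          (emon (half_sum n) * (\<Prod>\<alpha>\<in>pos_roots n - {\<beta>}. 1 - emon (- \<alpha>)) * sym_series n))))
      + (\<Sum>\<alpha>\<in>diff_roots n. 2 * (tmon \<alpha> * geometric_root \<alpha> * theta n)
          + 2 * (tmon (- \<alpha>) * geometric_root (- \<alpha>) * theta n))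
      + (\<Sum>\<alpha>\<in>sum_roots n. 4 * (tmon (- \<alpha>) * geometric_root (- \<alpha>) * theta n))"
proof -
  let ?E = "euler (neg_sum n) 2"
  note g = additive_form_neg_sum[of n]
  let ?u = "\<lambda>\<alpha>. of_int (2 + neg_sum n \<alpha>) * (tmon \<alpha> * geometric_root \<alpha>)
      + of_int (2 - neg_sum n \<alpha>) * (tmon (- \<alpha>) * geometric_root (- \<alpha>))"
  have "?E (geometric_root \<alpha> * geometric_root (- \<alpha>)) = geometric_root \<alpha> * geometric_root (- \<alpha>) * ?u \<alpha>" for \<alpha>
    by (simp add: euler_mult[OF g] euler_geometric_root[OF g] neg_sum_uminus algebra_simps)
  then have "?E (sym_series n) = sym_series n * (\<Sum>\<alpha>\<in>pos_roots n. ?u \<alpha>)"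
    unfolding sym_series_def by (intro euler_prod_log[OF g])
  also have "(\<Sum>\<alpha>\<in>pos_roots n. ?u \<alpha>)
      = (\<Sum>\<alpha>\<in>diff_roots n. 2 * (tmon \<alpha> * geometric_root \<alpha>) + 2 * (tmon (- \<alpha>) * geometric_root (- \<alpha>)))
      + (\<Sum>\<alpha>\<in>sum_roots n. 4 * (tmon (- \<alpha>) * geometric_root (- \<alpha>)))"
    unfolding sum_pos_roots by (intro arg_cong2[of _ _ _ _ "(+)"] sum.cong refl) (simp_all add: neg_sum_roots)
  finally have sym: "?E (sym_series n) = sym_series n * \<dots>" .
  let ?P = "\<Prod>\<alpha>\<in>pos_roots n. 1 - emon (- \<alpha>)" and ?Q = "\<lambda>\<beta>. \<Prod>\<alpha>\<in>pos_roots n - {\<beta>}. 1 - emon (- \<alpha>)"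
  have e: "?E (1 - emon (- \<alpha>)) = of_int (neg_sum n \<alpha>) * emon (- \<alpha>)" for \<alpha>
    by (simp add: euler_diff euler_1[OF g] euler_emon neg_sum_uminus)
  have "?E ?P = (\<Sum>\<alpha>\<in>pos_roots n. of_int (neg_sum n \<alpha>) * emon (- \<alpha>) * ?Q \<alpha>)"
    unfolding euler_prod[OF g finite_pos_roots] e ..
  also have "\<dots> = (\<Sum>\<beta>\<in>sum_roots n. - 2 * (emon (- \<beta>) * ?Q \<beta>))"
    unfolding sum_pos_roots by (simp add: neg_sum_roots mult.assoc cong: sum.cong)
  finally have P: "?E ?P = (\<Sum>\<beta>\<in>sum_roots n. - 2 * (emon (- \<beta>) * ?Q \<beta>))" .
  show ?thesis
    unfolding theta_def denominator_def euler_mult[OF g] P sym euler_emon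
    by (simp add: sum_distrib_left sum_distrib_right distrib_left distrib_right sum.distrib mult_ac)
qed

section \<open>Sums over roots as power sums\<close>

text \<open>On coefficients this is multiplication by the power sum
  \<open>\<Sum> x_i^(-k)\<close>.\<close>

definition shift :: "nat \<Rightarrow> int \<Rightarrow> (weight \<Rightarrow> 'a::comm_ring_1) \<Rightarrow> weight \<Rightarrow> 'a" where
  "shift n k f \<kappa> = (\<Sum>i=1..n. f (\<kappa>(i := \<kappa> i + k)))"

lemma sum_square_Suc:
  fixes g :: "nat \<Rightarrow> nat \<Rightarrow> int"
  shows "(\<Sum>i=1..Suc n. \<Sum>j=1..Suc n. g i j) = (\<Sum>i=1..n. \<Sum>j=1..n. g i j)
    + ((\<Sum>i=1..n. g i (Suc n)) + (\<Sum>i=1..n. g (Suc n) i)) + g (Suc n) (Suc n)"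
  by (simp add: sum.distrib)

lemma sum_diff_roots:
  fixes f :: "weight \<Rightarrow> int"
  shows "(\<Sum>\<alpha>\<in>diff_roots n. f \<alpha> + f (- \<alpha>)) = (\<Sum>i=1..n. \<Sum>j=1..n. f (eps i - eps j)) - int n * f 0"
proof (induction n)
  case 0
  have "diff_roots 0 = {}" by (auto simp: diff_roots_def)
  then show ?case by simp
next
  case (Suc n)
  let ?N = "Suc n"
  have "(\<Sum>\<alpha>\<in>diff_roots ?N. f \<alpha> + f (- \<alpha>))
      = (\<Sum>\<alpha>\<in>diff_roots n. f \<alpha> + f (- \<alpha>)) + (\<Sum>i=1..n. f (eps i - eps ?N) + f (- (eps i - eps ?N)))"
    by (rule sum_roots_Suc_sum(1))
  also have "(\<Sum>i=1..n. f (eps i - eps ?N) + f (- (eps i - eps ?N)))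
      = (\<Sum>i=1..n. f (eps i - eps ?N)) + (\<Sum>i=1..n. f (eps ?N - eps i))"
    by (simp only: sum.distrib minus_diff_eq)
  finally show ?case
    unfolding Suc.IH sum_square_Suc[where n = n and g = "\<lambda>i j. f (eps i - eps j)"] diff_self
    by (simp only: of_nat_Suc distrib_right mult_1)
qed

text \<open>Among ordered pairs short roots occur twice and long roots once; adding the diagonal
  again gives every root twice. In symmetric functions: \<open>2 h_2 = p_1^2 + p_2\<close>.\<close>

lemma sum_sum_roots:
  fixes f :: "weight \<Rightarrow> int"
  shows "2 * (\<Sum>\<alpha>\<in>sum_roots n. f \<alpha>) = (\<Sum>i=1..n. \<Sum>j=1..n. f (eps i + eps j)) + (\<Sum>i=1..n. f (eps i + eps i))"
proof (induction n)
  case 0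
  have "sum_roots 0 = {}" by (auto simp: sum_roots_def)
  then show ?case by simp
next
  case (Suc n)
  let ?N = "Suc n"
  have last: "(\<Sum>i=1..?N. g i) = (\<Sum>i=1..n. g i) + g ?N" for g :: "nat \<Rightarrow> int" by simp
  have "(\<Sum>i=1..n. f (eps ?N + eps i)) = (\<Sum>i=1..n. f (eps i + eps ?N))"
    by (simp only: add.commute[of "eps ?N"])
  then show ?case
    using Suc.IH sum_square_Suc[of "\<lambda>i j. f (eps i + eps j)" n] sum_roots_Suc_sum(2)[of f n]
      last[of "\<lambda>i. f (eps i + eps i)"] last[of "\<lambda>i. f (eps i + eps ?N)"]
    by linarith
qed

lemma shift_shift:
  "shift n k (shift n l f) \<kappa> = (\<Sum>i=1..n. \<Sum>j=1..n. f (\<kappa> + scale k (eps i) + scale l (eps j)))"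
proof -
  have "(\<kappa>(i := \<kappa> i + k))(j := (\<kappa>(i := \<kappa> i + k)) j + l) = \<kappa> + scale k (eps i) + scale l (eps j)" for i j
    by (rule ext) (simp add: scale_def eps_def)
  then show ?thesis unfolding shift_def by (simp only:)
qed

lemma shift_eps: "shift n k f \<kappa> = (\<Sum>i=1..n. f (\<kappa> + scale k (eps i)))"
proof -
  have "\<kappa>(i := \<kappa> i + k) = \<kappa> + scale k (eps i)" for i
    by (rule ext) (simp add: scale_def eps_def)
  then show ?thesis unfolding shift_def by (simp only:)
qed

lemma sum_sum_roots_shift:
  fixes f :: "weight \<Rightarrow> int"
  shows "2 * (\<Sum>\<beta>\<in>sum_roots n. f (\<kappa> + scale k \<beta>)) = shift n k (shift n k f) \<kappa> + shift n (2 * k) f \<kappa>"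
proof -
  have "\<kappa> + scale k (eps i + eps j) = \<kappa> + scale k (eps i) + scale k (eps j)" for i j
    by (rule ext) (simp add: scale_def algebra_simps)
  moreover have "\<kappa> + scale k (eps i) + scale k (eps i) = \<kappa> + scale (2 * k) (eps i)" for i
    by (rule ext) (simp add: scale_def algebra_simps)
  ultimately show ?thesis
    unfolding sum_sum_roots shift_shift shift_eps by (simp only:)
qed

lemma sum_diff_roots_shift:
  fixes f :: "weight \<Rightarrow> int"
  shows "(\<Sum>\<alpha>\<in>diff_roots n. f (\<kappa> - scale k \<alpha>) + f (\<kappa> - scale k (- \<alpha>)))
    = shift n (- k) (shift n k f) \<kappa> - int n * f \<kappa>"
proof -
  have "\<kappa> - scale k (eps i - eps j) = \<kappa> + scale (- k) (eps i) + scale k (eps j)" for i j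
    by (rule ext) (simp add: scale_def algebra_simps)
  moreover have "\<kappa> - scale k 0 = \<kappa>" by (rule ext) (simp add: scale_def)
  ultimately show ?thesis
    using sum_diff_roots[of "\<lambda>\<alpha>. f (\<kappa> - scale k \<alpha>)" n] unfolding shift_shift by (simp only:)
qed

text \<open>The coefficient form of \<open>euler_theta\<close>. Geometric factors lead to the
  smaller degrees \<open>d - k\<close>; the factors \<open>1 - e^-\<beta>\<close> keep the degree
  and bring in the minus sign. \<open>K\<close> truncates the expansion of their cofactors, and how
  large it must be depends on \<open>d\<close> and \<open>\<kappa>\<close>.\<close>

lemma theta_recursion:
  fixes n d \<kappa>
  defines "f \<equiv> \<lambda>d. coef (theta n) d"
  shows "\<forall>\<^sub>F K in sequentially. excess n d \<kappa> * f d \<kappa>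
    = (\<Sum>k=1..d. 2 * (shift n (- int k) (shift n (int k) (f (d - k))) \<kappa> - int n * f (d - k) \<kappa>)
        + 2 * (shift n (int k) (shift n (int k) (f (d - k))) \<kappa> + shift n (2 * int k) (f (d - k)) \<kappa>))
      - (\<Sum>k=1..K. shift n (int k) (shift n (int k) (f d)) \<kappa> + shift n (2 * int k) (f d) \<kappa>)"
proof -
  let ?R = "\<lambda>\<beta>. emon (half_sum n) * (\<Prod>\<alpha>\<in>pos_roots n - {\<beta>}. 1 - emon (- \<alpha>)) * sym_series n"
  have theta: "theta n = (1 - emon (- \<beta>)) * ?R \<beta>" if \<beta>: "\<beta> \<in> sum_roots n" for \<beta>
  proof -
    have "\<beta> \<in> pos_roots n" using \<beta> by (simp add: pos_roots_Un)
    then show ?thesis unfolding theta_def denominator_def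
      by (subst prod.remove[OF finite_pos_roots]) (simp_all only: mult_ac)
  qed
  have nz: "\<exists>k0. \<beta> k0 \<noteq> 0" if "\<beta> \<in> sum_roots n" for \<beta>
    using coord_sum_sum_roots[OF that] unfolding coord_sum_def
    by (metis sum.neutral zero_neq_numeral)
  have "\<forall>\<^sub>F K in sequentially. \<forall>\<beta>\<in>sum_roots n. coef (emon (- \<beta>) * ?R \<beta>) d \<kappa>
      = (\<Sum>k=1..K. f d (\<kappa> + scale (int k) \<beta>))"
  proof (rule eventually_ball_finite[OF finite_sum_roots], rule ballI)
    fix \<beta> assume \<beta>: "\<beta> \<in> sum_roots n"
    then obtain k0 where "\<beta> k0 \<noteq> 0" using nz by blast
    from coef_cofactor[where \<beta> = \<beta> and R = "?R \<beta>", OF this]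
    show "\<forall>\<^sub>F K in sequentially. coef (emon (- \<beta>) * ?R \<beta>) d \<kappa> = (\<Sum>k=1..K. f d (\<kappa> + scale (int k) \<beta>))"
      unfolding theta[OF \<beta>, symmetric] f_def .
  qed
  then show ?thesis
  proof (rule eventually_mono)
    fix K assume K: "\<forall>\<beta>\<in>sum_roots n. coef (emon (- \<beta>) * ?R \<beta>) d \<kappa>
      = (\<Sum>k=1..K. f d (\<kappa> + scale (int k) \<beta>))"
    have of_int: "coef (of_int c * F) d \<kappa> = c * coef F d \<kappa>" for c F
      by (induction c rule: int_induct[of _ 0]) (simp_all add: algebra_simps)
    have two: "coef (2 * F) d \<kappa> = 2 * coef F d \<kappa>" and four: "coef (4 * F) d \<kappa> = 4 * coef F d \<kappa>" for F
      using of_int[of 2 F] of_int[of 4 F] by simp_all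
    have plus: "\<kappa> - scale (int k) (- \<beta>) = \<kappa> + scale (int k) \<beta>" for k \<beta>
      by (rule ext) (simp add: scale_def)
    have "(2 * int d + neg_sum n \<kappa>) * f d \<kappa> = coef (euler (neg_sum n) 2 (theta n)) d \<kappa>"
      by (simp add: coef_euler f_def)
    also have "\<dots> = neg_sum n (half_sum n) * f d \<kappa>
        - (\<Sum>\<beta>\<in>sum_roots n. 2 * (\<Sum>k=1..K. f d (\<kappa> + scale (int k) \<beta>)))
        + (\<Sum>\<alpha>\<in>diff_roots n. \<Sum>k=1..d. 2 * (f (d - k) (\<kappa> - scale (int k) \<alpha>) + f (d - k) (\<kappa> - scale (int k) (- \<alpha>))))
        + (\<Sum>\<alpha>\<in>sum_roots n. \<Sum>k=1..d. 4 * f (d - k) (\<kappa> + scale (int k) \<alpha>))"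
      unfolding euler_theta coef_add coef_sum of_int two four coef_uminus coef_tmon_geometric_mult plus
      using K by (simp add: f_def sum_negf sum_distrib_left sum.distrib distrib_left plus)
    also have "(\<Sum>\<alpha>\<in>diff_roots n. \<Sum>k=1..d. 2 * (f (d - k) (\<kappa> - scale (int k) \<alpha>) + f (d - k) (\<kappa> - scale (int k) (- \<alpha>))))
        = (\<Sum>k=1..d. 2 * (shift n (- int k) (shift n (int k) (f (d - k))) \<kappa> - int n * f (d - k) \<kappa>))"
      by (subst sum.swap) (simp only: sum_diff_roots_shift[symmetric] sum_distrib_left)
    also have "(\<Sum>\<beta>\<in>sum_roots n. 2 * (\<Sum>k=1..K. f d (\<kappa> + scale (int k) \<beta>)))
        = (\<Sum>k=1..K. shift n (int k) (shift n (int k) (f d)) \<kappa> + shift n (2 * int k) (f d) \<kappa>)"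
      unfolding sum_distrib_left by (subst sum.swap) (simp only: sum_sum_roots_shift[symmetric] sum_distrib_left)
    also have "(\<Sum>\<alpha>\<in>sum_roots n. \<Sum>k=1..d. 4 * f (d - k) (\<kappa> + scale (int k) \<alpha>))
        = (\<Sum>k=1..d. 2 * (shift n (int k) (shift n (int k) (f (d - k))) \<kappa> + shift n (2 * int k) (f (d - k)) \<kappa>))"
    proof (subst sum.swap, rule sum.cong[OF refl])
      fix k
      have "(\<Sum>\<alpha>\<in>sum_roots n. 4 * f (d - k) (\<kappa> + scale (int k) \<alpha>))
          = 2 * (2 * (\<Sum>\<alpha>\<in>sum_roots n. f (d - k) (\<kappa> + scale (int k) \<alpha>)))"
        by (simp add: sum_distrib_left)
      then show "(\<Sum>\<alpha>\<in>sum_roots n. 4 * f (d - k) (\<kappa> + scale (int k) \<alpha>))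
          = 2 * (shift n (int k) (shift n (int k) (f (d - k))) \<kappa> + shift n (2 * int k) (f (d - k)) \<kappa>)"
        by (simp only: sum_sum_roots_shift)
    qed
    finally show "excess n d \<kappa> * f d \<kappa>
    = (\<Sum>k=1..d. 2 * (shift n (- int k) (shift n (int k) (f (d - k))) \<kappa> - int n * f (d - k) \<kappa>)
        + 2 * (shift n (int k) (shift n (int k) (f (d - k))) \<kappa> + shift n (2 * int k) (f (d - k)) \<kappa>))
      - (\<Sum>k=1..K. shift n (int k) (shift n (int k) (f d)) \<kappa> + shift n (2 * int k) (f d) \<kappa>)"
      unfolding sum.distrib by (simp add: excess_def neg_sum_def algebra_simps)
  qed
qed

subsection \<open>Moving one entry of a strictly decreasing sequence\<close>

definition alternating :: "nat \<Rightarrow> (weight \<Rightarrow> 'a::ab_group_add) \<Rightarrow> bool" where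
  "alternating n f \<longleftrightarrow> (\<forall>\<kappa> i. 1 \<le> i \<and> i < n \<longrightarrow> f (\<kappa>(i := \<kappa> (Suc i), Suc i := \<kappa> i)) = - f \<kappa>)"

definition strictly_decr :: "nat \<Rightarrow> weight \<Rightarrow> bool" where
  "strictly_decr n \<kappa> \<longleftrightarrow> (\<forall>i. 1 \<le> i \<and> i < n \<longrightarrow> \<kappa> (Suc i) < \<kappa> i)"

text \<open>Entry \<open>j\<close> is replaced by \<open>x\<close> and carried \<open>r\<close>
  places to the left by adjacent swaps; for the right \<open>r\<close> this resorts the
  sequence.\<close>

definition insert_at :: "weight \<Rightarrow> nat \<Rightarrow> nat \<Rightarrow> int \<Rightarrow> weight" where
  "insert_at \<kappa> j r x = (\<lambda>p. if p = j - r then x else if j - r < p \<and> p \<le> j then \<kappa> (p - 1) else \<kappa> p)"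

text \<open>For \<open>c = n + 1\<close> the part \<open>\<lambda>_p\<close> of
  \<open>\<kappa> = \<lambda> + \<rho>\<close>. The constant is left free because reversing the
  sequence turns \<open>c\<close> into \<open>n + 1 - c\<close>.\<close>

definition lam :: "int \<Rightarrow> weight \<Rightarrow> nat \<Rightarrow> int" where
  "lam c \<kappa> p = \<kappa> p + int p - c"

definition odds :: "nat \<Rightarrow> int \<Rightarrow> weight \<Rightarrow> nat set" where
  "odds n c \<kappa> = {p \<in> {1..n}. odd (lam c \<kappa> p)}"

definition prof :: "nat \<Rightarrow> int \<Rightarrow> weight \<Rightarrow> int multiset" where
  "prof n c \<kappa> = image_mset (lam c \<kappa>) (mset_set (odds n c \<kappa>))"

definition add_set :: "weight \<Rightarrow> nat set \<Rightarrow> weight" where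
  "add_set \<kappa> A = (\<lambda>p. \<kappa> p + (if p \<in> A then 1 else 0))"

text \<open>The first \<open>k\<close> entries of a run of equal odd parts end at \<open>j\<close>.
  As the part before them differs, they can be raised together by one.\<close>

definition block_ends :: "nat \<Rightarrow> int \<Rightarrow> nat \<Rightarrow> weight \<Rightarrow> nat set" where
  "block_ends n c k \<kappa> = {j \<in> {1..n}. k \<le> j \<and> (\<forall>p. j < p + k \<and> p \<le> j \<longrightarrow> odd (lam c \<kappa> p) \<and> lam c \<kappa> p = lam c \<kappa> j)
     \<and> (k < j \<longrightarrow> lam c \<kappa> (j - k) \<noteq> lam c \<kappa> j)}"

text \<open>The effect of \<open>shift\<close> on functions of the profile, up to sign:
  \<open>k\<close> equal odd parts disappear.\<close>

definition block_sum :: "nat \<Rightarrow> (int multiset \<Rightarrow> real) \<Rightarrow> int multiset \<Rightarrow> real" where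
  "block_sum k \<tau> m = (\<Sum>l\<in>{l \<in> set_mset m. k \<le> count m l}. \<tau> (m - replicate_mset k l))"

lemma finite_odds [simp]: "finite (odds n c \<kappa>)"
  by (simp add: odds_def)

lemma size_prof: "size (prof n c \<kappa>) = card (odds n c \<kappa>)"
  by (simp add: prof_def)

lemma insert_at_Suc:
  assumes "Suc r < j"
  shows "insert_at \<kappa> j (Suc r) x = (insert_at \<kappa> j r x)
    (j - Suc r := insert_at \<kappa> j r x (Suc (j - Suc r)), Suc (j - Suc r) := insert_at \<kappa> j r x (j - Suc r))"
  using assms by (auto simp: insert_at_def fun_eq_iff)

lemma insert_at_0: "insert_at \<kappa> j 0 x = \<kappa>(j := x)"
  by (auto simp: insert_at_def fun_eq_iff)

lemma alternating_insert_at: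
  fixes f :: "weight \<Rightarrow> real"
  assumes f: "alternating n f" and "j \<le> n" "r < j"
  shows "f (\<kappa>(j := x)) = (-1) ^ r * f (insert_at \<kappa> j r x)"
  using assms(3)
proof (induction r)
  case (Suc r)
  have "f (insert_at \<kappa> j (Suc r) x) = - f (insert_at \<kappa> j r x)"
    unfolding insert_at_Suc[OF Suc.prems]
    by (rule f[unfolded alternating_def, rule_format]) (use Suc.prems \<open>j \<le> n\<close> in auto)
  with Suc show ?case by simp
qed (simp add: insert_at_0)

lemma coord_sum_swap:
  assumes "1 \<le> i" "i < n"
  shows "coord_sum n (\<kappa>(i := \<kappa> (Suc i), Suc i := \<kappa> i)) = coord_sum n \<kappa>"
proof -
  have "\<kappa>(i := \<kappa> (Suc i), Suc i := \<kappa> i) = \<kappa> \<circ> Transposition.transpose i (Suc i)"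
    by (auto simp: fun_eq_iff Transposition.transpose_def)
  moreover have "Transposition.transpose i (Suc i) permutes {1..n}"
    using assms by (intro permutes_swap_id) auto
  ultimately show ?thesis
    unfolding coord_sum_def using sum.permute[of "Transposition.transpose i (Suc i)" "{1..n}" \<kappa>] by simp
qed

lemma coord_sum_upd: "j \<in> {1..n} \<Longrightarrow> coord_sum n (\<kappa>(j := \<kappa> j + x)) = coord_sum n \<kappa> + x"
proof -
  assume j: "j \<in> {1..n}"
  have "(\<kappa>(j := \<kappa> j + x)) k = \<kappa> k + (if k = j then x else 0)" for k by simp
  then show ?thesis unfolding coord_sum_def using j by (simp add: sum.distrib del: fun_upd_apply)
qed

lemma coord_sum_insert_at:
  assumes "j \<le> n" "r < j"
  shows "coord_sum n (insert_at \<kappa> j r x) = coord_sum n (\<kappa>(j := x))"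
  using assms(2)
proof (induction r)
  case (Suc r)
  have "coord_sum n (insert_at \<kappa> j (Suc r) x) = coord_sum n (insert_at \<kappa> j r x)"
    unfolding insert_at_Suc[OF Suc.prems] using Suc.prems \<open>j \<le> n\<close> by (intro coord_sum_swap) auto
  with Suc show ?case by simp
qed (simp add: insert_at_0)

lemma strictly_decr_gap:
  assumes "strictly_decr n \<kappa>" "1 \<le> p" "p \<le> q" "q \<le> n"
  shows "\<kappa> q + int (q - p) \<le> \<kappa> p"
  using assms(3,4)
proof (induction q rule: dec_induct)
  case (step q)
  then have "\<kappa> (Suc q) < \<kappa> q" using assms(1,2) by (auto simp: strictly_decr_def)
  with step show ?case by (simp add: Suc_diff_le)
qed simp

lemma lam_antimono: "strictly_decr n \<kappa> \<Longrightarrow> 1 \<le> p \<Longrightarrow> p \<le> q \<Longrightarrow> q \<le> n \<Longrightarrow> lam c \<kappa> q \<le> lam c \<kappa> p"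
  using strictly_decr_gap[of n \<kappa> p q] by (simp add: lam_def of_nat_diff)

text \<open>Once the moved entry is carried next to its equal, swapping the two changes the sign but
  not the sequence.\<close>

lemma alternating_eq_0:
  fixes f :: "weight \<Rightarrow> real"
  assumes f: "alternating n f" and j: "j \<le> n" and p: "1 \<le> p" "p < j" and x: "\<kappa> p = x"
  shows "f (\<kappa>(j := x)) = 0"
proof -
  let ?r = "j - Suc p"
  let ?\<mu> = "insert_at \<kappa> j ?r x"
  have r: "?r < j" "j - ?r = Suc p" using p by auto
  have "?\<mu> p = ?\<mu> (Suc p)" using x r p by (simp add: insert_at_def)
  then have "?\<mu>(p := ?\<mu> (Suc p), Suc p := ?\<mu> p) = ?\<mu>" by (auto simp: fun_eq_iff)
  moreover have "f (?\<mu>(p := ?\<mu> (Suc p), Suc p := ?\<mu> p)) = - f ?\<mu>"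
    using f p j by (auto simp: alternating_def)
  ultimately have "f ?\<mu> = 0" by simp
  then show ?thesis using alternating_insert_at[OF f j r(1), of \<kappa> x] by simp
qed

text \<open>A raised entry overtakes at most \<open>k - 1\<close> others, and only the entries involved can change parity.\<close>

lemma raise_entry:
  fixes f :: "weight \<Rightarrow> real" and h :: int
  assumes f: "alternating n f" and sd: "strictly_decr n \<kappa>" and j: "j \<in> {1..n}" and k: "1 \<le> k"
    and van: "\<And>\<mu>. strictly_decr n \<mu> \<Longrightarrow> (\<forall>p. p \<notin> {1..n} \<longrightarrow> \<mu> p = \<kappa> p) \<Longrightarrow>
      coord_sum n \<mu> = coord_sum n \<kappa> + int k \<Longrightarrow> int (card (odds n c \<mu>)) > h - int k \<Longrightarrow> f \<mu> = 0"
    and h: "int (card (odds n c \<kappa>)) \<ge> h" and nz: "f (\<kappa>(j := \<kappa> j + int k)) \<noteq> 0"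
  shows "int (card (odds n c \<kappa>)) = h \<and> j \<in> block_ends n c k \<kappa>"
proof -
  let ?x = "\<kappa> j + int k"
  \<comment> \<open>The place of the raised entry after resorting. Equality with an earlier entry is
    excluded, as \<open>f\<close> would vanish.\<close>
  define q where "q = (LEAST p. 1 \<le> p \<and> \<kappa> p < ?x)"
  have jx: "1 \<le> j \<and> \<kappa> j < ?x" using j k by simp
  have q: "1 \<le> q" "\<kappa> q < ?x" unfolding q_def using LeastI[of "\<lambda>p. 1 \<le> p \<and> \<kappa> p < ?x", OF jx] by auto
  have qj: "q \<le> j" unfolding q_def by (rule Least_le[of "\<lambda>p. 1 \<le> p \<and> \<kappa> p < ?x", OF jx])
  have before: "\<kappa> p > ?x" if p: "1 \<le> p" "p < q" for p
  proof -
    have "\<not> \<kappa> p < ?x" using not_less_Least[of p "\<lambda>p. 1 \<le> p \<and> \<kappa> p < ?x"] p by (auto simp: q_def)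
    moreover have "\<kappa> p \<noteq> ?x" using alternating_eq_0[OF f, of j p \<kappa> ?x] nz p qj j by auto
    ultimately show ?thesis by simp
  qed
  define r where "r = j - q"
  have r: "r < j" "j - r = q" using qj q by (auto simp: r_def)
  let ?\<mu> = "insert_at \<kappa> j r ?x"
  have sd\<mu>: "strictly_decr n ?\<mu>"
    unfolding strictly_decr_def
  proof (intro allI impI)
    fix i assume i: "1 \<le> i \<and> i < n"
    have sdi: "\<kappa> (Suc i) < \<kappa> i" if "1 \<le> i" "i < n" for i using sd that by (auto simp: strictly_decr_def)
    consider "Suc i < q" | "Suc i = q" | "i = q" "i < j" | "i = q" "i = j" | "q < i" "i < j" | "q < i" "i = j" | "q < i" "j < i"
      using qj by linarith
    then show "?\<mu> (Suc i) < ?\<mu> i"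
    proof cases
      case 1
      then show ?thesis using sdi[of i] i r by (simp add: insert_at_def)
    next
      case 2
      then show ?thesis using before[of i] i r by (simp add: insert_at_def)
    next
      case 3
      then show ?thesis using q r by (simp add: insert_at_def)
    next
      case 4
      then show ?thesis using sdi[of i] i r k by (simp add: insert_at_def)
    next
      case 5
      then have "1 \<le> i - 1" "i - 1 < n" "Suc (i - 1) = i" using q i by linarith+
      with 5 sdi[of "i - 1"] have "\<kappa> i < \<kappa> (i - 1)" by simp
      with 5 show ?thesis using sdi[of "i - 1"] i r q by (simp add: insert_at_def)
    next
      case 6
      then have "1 \<le> i - 1" "i - 1 < n" "Suc (i - 1) = i" using q i by linarith+
      with 6 sdi[of "i - 1"] have "\<kappa> i < \<kappa> (i - 1)" by simp
      with 6 show ?thesis using sdi[of "i - 1"] sdi[of i] i r q by (simp add: insert_at_def)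
    next
      case 7
      then show ?thesis using sdi[of i] i r by (simp add: insert_at_def)
    qed
  qed
  have f\<mu>: "f ?\<mu> \<noteq> 0" using alternating_insert_at[OF f _ r(1), of \<kappa> ?x] j nz by auto
  have out: "\<forall>p. p \<notin> {1..n} \<longrightarrow> ?\<mu> p = \<kappa> p" using j q r by (auto simp: insert_at_def)
  have cs: "coord_sum n ?\<mu> = coord_sum n \<kappa> + int k"
    using coord_sum_insert_at[of j n r \<kappa> ?x] coord_sum_upd[OF j, of \<kappa> "int k"] j r by simp
  have card\<mu>: "int (card (odds n c ?\<mu>)) \<le> h - int k"
    using van[OF sd\<mu> out cs] f\<mu> by (meson not_le)
  let ?A = "{q..j}"
  have cA: "card ?A = Suc r" using qj by (simp add: r_def)
  have rk: "Suc r \<le> k"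
    using strictly_decr_gap[OF sd, of q j] q qj j by (simp add: r_def)
  have outside: "odds n c \<kappa> - ?A = odds n c ?\<mu> - ?A"
    using r by (auto simp: odds_def lam_def insert_at_def)
  have "card (odds n c \<kappa>) = card (odds n c \<kappa> - ?A) + card (odds n c \<kappa> \<inter> ?A)"
    by (metis add.commute card_Int_Diff finite_odds)
  moreover have "card (odds n c ?\<mu>) = card (odds n c ?\<mu> - ?A) + card (odds n c ?\<mu> \<inter> ?A)"
    by (metis add.commute card_Int_Diff finite_odds)
  moreover have le: "card (odds n c \<kappa> \<inter> ?A) \<le> card ?A" by (rule card_mono) auto
  \<comment> \<open>At least \<open>h\<close> odd parts before, at most \<open>h - k\<close> after,
    and only \<open>Suc r \<le> k\<close> positions affected: equality holds everywhere.\<close>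
  ultimately have eq: "int (card (odds n c \<kappa>)) = h" "card (odds n c \<kappa> \<inter> ?A) = card ?A" "k = Suc r"
    using arg_cong[OF outside, of card] card\<mu> h cA rk by linarith+
  have sub: "?A \<subseteq> odds n c \<kappa>"
    using card_subset_eq[of ?A "odds n c \<kappa> \<inter> ?A"] eq(2) by auto
  have lam_eq: "lam c \<kappa> p = lam c \<kappa> j" if p: "p \<in> ?A" for p
  proof -
    have "lam c \<kappa> j \<le> lam c \<kappa> p" "lam c \<kappa> p \<le> lam c \<kappa> q"
      using lam_antimono[OF sd, of p j c] lam_antimono[OF sd, of q p c] p q j by auto
    moreover have "lam c \<kappa> q \<le> lam c \<kappa> j"
      using q(2) eq(3) qj by (simp add: lam_def r_def)
    ultimately show ?thesis by simp
  qed
  have "lam c \<kappa> (j - k) \<noteq> lam c \<kappa> j" if "k < j"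
  proof -
    have "j - k = q - 1" "1 \<le> q - 1" using that eq(3) r by auto
    then show ?thesis using before[of "q - 1"] that by (simp add: lam_def)
  qed
  moreover have "odd (lam c \<kappa> p) \<and> lam c \<kappa> p = lam c \<kappa> j" if "j < p + k" "p \<le> j" for p
  proof -
    have "p \<in> ?A" using that eq(3) r by auto
    then have "p \<in> odds n c \<kappa>" and eq: "lam c \<kappa> p = lam c \<kappa> j" using sub lam_eq by blast+
    then have "odd (lam c \<kappa> p)" by (simp add: odds_def)
    with eq show ?thesis by blast
  qed
  moreover have "k \<le> j" using eq(3) r by simp
  ultimately have "j \<in> block_ends n c k \<kappa>" unfolding block_ends_def using j by blast
  with eq(1) show ?thesis by simp
qed

lemma block_endsD:
  assumes "j \<in> block_ends n c k \<kappa>"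
  shows "j \<in> {1..n}" "k \<le> j" "k < j \<Longrightarrow> lam c \<kappa> (j - k) \<noteq> lam c \<kappa> j"
    and "j < p + k \<Longrightarrow> p \<le> j \<Longrightarrow> lam c \<kappa> p = lam c \<kappa> j"
    and "j < p + k \<Longrightarrow> p \<le> j \<Longrightarrow> odd (lam c \<kappa> p)"
  using assms unfolding block_ends_def by blast+

text \<open>Equal parts mean consecutive entries of \<open>\<kappa>\<close>. Moving the last of
  \<open>k\<close> such entries up by \<open>k\<close> and resorting therefore raises each of them
  by one, at the cost of \<open>k - 1\<close> swaps.\<close>

lemma raise_block:
  fixes f :: "weight \<Rightarrow> real"
  assumes f: "alternating n f" and k: "1 \<le> k" and j: "j \<in> block_ends n c k \<kappa>"
  shows "f (\<kappa>(j := \<kappa> j + int k)) = (-1) ^ (k - 1) * f (add_set \<kappa> {Suc j - k..j})"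
proof -
  note jj = block_endsD(1,2)[OF j]
  have \<kappa>p: "\<kappa> p = \<kappa> j + int j - int p" if "j < p + k" "p \<le> j" for p
    using block_endsD(4)[OF j that] by (simp add: lam_def)
  have "insert_at \<kappa> j (k - 1) (\<kappa> j + int k) = add_set \<kappa> {Suc j - k..j}"
  proof
    fix p
    consider "p = Suc j - k" | "Suc j - k < p" "p \<le> j" | "p < Suc j - k \<or> j < p" by linarith
    then show "insert_at \<kappa> j (k - 1) (\<kappa> j + int k) p = add_set \<kappa> {Suc j - k..j} p"
    proof cases
      case 1
      then show ?thesis using \<kappa>p[of p] jj k by (auto simp: insert_at_def add_set_def of_nat_diff)
    next
      case 2
      then show ?thesis using \<kappa>p[of p] \<kappa>p[of "p - 1"] jj k by (auto simp: insert_at_def add_set_def of_nat_diff)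
    next
      case 3
      then show ?thesis using jj k by (auto simp: insert_at_def add_set_def)
    qed
  qed
  then show ?thesis using alternating_insert_at[OF f, of j "k - 1" \<kappa> "\<kappa> j + int k"] jj k by simp
qed

text \<open>The only gap that shrinks is the one in front of the block. There the parts differ, so
  the entries differ by at least 2.\<close>

lemma strictly_decr_add_block:
  assumes sd: "strictly_decr n \<kappa>" and j: "j \<in> block_ends n c k \<kappa>"
  shows "strictly_decr n (add_set \<kappa> {Suc j - k..j})"
  unfolding strictly_decr_def
proof (intro allI impI)
  fix i assume i: "1 \<le> i \<and> i < n"
  have sdi: "\<kappa> (Suc i) < \<kappa> i" using sd i by (auto simp: strictly_decr_def)
  note jj = block_endsD(1,2)[OF j]
  show "add_set \<kappa> {Suc j - k..j} (Suc i) < add_set \<kappa> {Suc j - k..j} i"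
  proof (cases "Suc i = Suc j - k \<and> 0 < k")
    case True
    then have i': "i = j - k" "k < j" using i jj by auto
    then have "lam c \<kappa> i \<noteq> lam c \<kappa> j" using block_endsD(3)[OF j] by simp
    moreover have "lam c \<kappa> (Suc i) = lam c \<kappa> j"
      using i' True by (intro block_endsD(4)[OF j]) auto
    ultimately have "lam c \<kappa> i \<noteq> lam c \<kappa> (Suc i)" by simp
    then show ?thesis using sdi by (auto simp: add_set_def lam_def)
  next
    case False
    then show ?thesis using sdi by (auto simp: add_set_def)
  qed
qed

lemma odds_add_set: "A \<subseteq> odds n c \<kappa> \<Longrightarrow> odds n c (add_set \<kappa> A) = odds n c \<kappa> - A"
  by (auto simp: odds_def add_set_def lam_def)

lemma prof_add_set:
  assumes "A \<subseteq> odds n c \<kappa>"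
  shows "prof n c (add_set \<kappa> A) = prof n c \<kappa> - image_mset (lam c \<kappa>) (mset_set A)"
proof -
  have "prof n c (add_set \<kappa> A) = image_mset (lam c \<kappa>) (mset_set (odds n c \<kappa> - A))"
    unfolding prof_def odds_add_set[OF assms]
    by (intro image_mset_cong) (auto simp: lam_def add_set_def)
  also have "mset_set (odds n c \<kappa> - A) = mset_set (odds n c \<kappa>) - mset_set A"
    using assms by (simp add: mset_set_Diff)
  also have "image_mset (lam c \<kappa>) \<dots> = prof n c \<kappa> - image_mset (lam c \<kappa>) (mset_set A)"
    unfolding prof_def using assms by (intro image_mset_Diff) (rule subset_imp_msubset_mset_set, simp_all)
  finally show ?thesis .
qed

lemma block_subset_odds: "j \<in> block_ends n c k \<kappa> \<Longrightarrow> 1 \<le> k \<Longrightarrow> {Suc j - k..j} \<subseteq> odds n c \<kappa>"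
proof
  fix p assume j: "j \<in> block_ends n c k \<kappa>" and k: "1 \<le> k" and p: "p \<in> {Suc j - k..j}"
  have "odd (lam c \<kappa> p)" using p block_endsD(2)[OF j] by (intro block_endsD(5)[OF j]) auto
  then show "p \<in> odds n c \<kappa>" using p block_endsD(1,2)[OF j] by (auto simp: odds_def)
qed

lemma prof_add_block:
  assumes j: "j \<in> block_ends n c k \<kappa>" and k: "1 \<le> k"
  shows "prof n c (add_set \<kappa> {Suc j - k..j}) = prof n c \<kappa> - replicate_mset k (lam c \<kappa> j)"
proof -
  have "k \<le> j" using j by (simp add: block_ends_def)
  have "image_mset (lam c \<kappa>) (mset_set {Suc j - k..j}) = image_mset (\<lambda>_. lam c \<kappa> j) (mset_set {Suc j - k..j})"
    using block_endsD(2)[OF j] by (intro image_mset_cong block_endsD(4)[OF j]) auto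
  also have "\<dots> = replicate_mset k (lam c \<kappa> j)"
    using \<open>k \<le> j\<close> by (simp add: image_mset_const_eq)
  finally show ?thesis using prof_add_set[OF block_subset_odds[OF j k]] by simp
qed

lemma count_prof: "odd l \<Longrightarrow> count (prof n c \<kappa>) l = card {p \<in> {1..n}. lam c \<kappa> p = l}"
proof -
  assume "odd l"
  have "count (prof n c \<kappa>) l = (\<Sum>p\<in>lam c \<kappa> -` {l} \<inter> odds n c \<kappa>. 1)"
    unfolding prof_def count_image_mset by (rule sum.cong) auto
  also have "\<dots> = card (lam c \<kappa> -` {l} \<inter> odds n c \<kappa>)" by simp
  also have "lam c \<kappa> -` {l} \<inter> odds n c \<kappa> = {p \<in> {1..n}. lam c \<kappa> p = l}"
    using \<open>odd l\<close> by (auto simp: odds_def)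
  finally show ?thesis .
qed

text \<open>Parts decrease weakly, so equal ones form one run, and a run of length at least
  \<open>k\<close> has exactly one \<open>k\<close>-th entry.\<close>

lemma bij_betw_block_ends:
  assumes sd: "strictly_decr n \<kappa>" and k: "1 \<le> k"
  shows "bij_betw (lam c \<kappa>) (block_ends n c k \<kappa>)
    {l \<in> set_mset (prof n c \<kappa>). k \<le> count (prof n c \<kappa>) l}"
  unfolding bij_betw_def
proof
  let ?L = "lam c \<kappa>"
  have *: False if j: "j \<in> block_ends n c k \<kappa>" "j' \<in> block_ends n c k \<kappa>" "?L j = ?L j'" "j < j'" for j j'
  proof -
    have jj: "k \<le> j" "j' \<le> n" using block_endsD(1,2)[OF j(1)] block_endsD(1)[OF j(2)] by auto
    have ne: "?L (j' - k) \<noteq> ?L j'" using jj j(4) by (intro block_endsD(3)[OF j(2)]) auto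
    have eq: "?L (Suc j - k) = ?L j" using jj k by (intro block_endsD(4)[OF j(1)]) auto
    have "?L (j' - k) \<le> ?L (Suc j - k)" "?L j' \<le> ?L (j' - k)"
      using jj j(4) by (intro lam_antimono[OF sd]; simp)+
    with ne eq j(3) show False by simp
  qed
  show "inj_on ?L (block_ends n c k \<kappa>)"
    by (rule inj_onI) (metis * nat_neq_iff)
  show "?L ` block_ends n c k \<kappa> = {l \<in> set_mset (prof n c \<kappa>). k \<le> count (prof n c \<kappa>) l}" (is "_ = ?R")
  proof
    show "?L ` block_ends n c k \<kappa> \<subseteq> ?R"
    proof
      fix l assume "l \<in> ?L ` block_ends n c k \<kappa>"
      then obtain j where j: "j \<in> block_ends n c k \<kappa>" "l = ?L j" by blast
      have kj: "k \<le> j" "j \<le> n" using block_endsD(1,2)[OF j(1)] by auto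
      have "odd l" unfolding j(2) using k by (intro block_endsD(5)[OF j(1)]) auto
      have sub: "{Suc j - k..j} \<subseteq> {p \<in> {1..n}. ?L p = l}"
      proof
        fix p assume p: "p \<in> {Suc j - k..j}"
        then have "?L p = ?L j" using kj by (intro block_endsD(4)[OF j(1)]) auto
        then show "p \<in> {p \<in> {1..n}. ?L p = l}" using p kj j(2) by (simp only: mem_Collect_eq) auto
      qed
      from card_mono[OF _ sub] kj have "k \<le> count (prof n c \<kappa>) l"
        unfolding count_prof[OF \<open>odd l\<close>] by simp
      moreover from this have "l \<in># prof n c \<kappa>" using k by (metis count_greater_zero_iff less_le_trans zero_less_one)
      ultimately show "l \<in> ?R" by simp
    qed
    show "?R \<subseteq> ?L ` block_ends n c k \<kappa>"
    proof
      fix l assume l: "l \<in> ?R"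
      then have "odd l" by (auto simp: prof_def odds_def)
      let ?B = "{p \<in> {1..n}. ?L p = l}"
      have kB: "k \<le> card ?B" using l count_prof[OF \<open>odd l\<close>] by simp
      then have ne: "?B \<noteq> {}" using k by (metis card.empty not_one_le_zero le_trans)
      define q where "q = Min ?B"
      define e where "e = Max ?B"
      have q: "q \<in> ?B" and e: "e \<in> ?B" unfolding q_def e_def using ne by (intro Min_in Max_in; simp)+
      have sub: "?B \<subseteq> {q..e}" unfolding q_def e_def by auto
      have "k \<le> card {q..e}" using kB card_mono[OF _ sub] by simp
      then have ke: "q + k \<le> Suc e" using k by simp
      have mid: "?L p = l" if "q \<le> p" "p \<le> e" for p
        using lam_antimono[OF sd, of q p c] lam_antimono[OF sd, of p e c] q e that by auto
      let ?j = "q + k - 1"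
      have lj: "?L ?j = l" using ke k by (intro mid) auto
      have ne: "?L (?j - k) \<noteq> ?L ?j" if "k < ?j"
      proof
        assume "?L (?j - k) = ?L ?j"
        then have "?L (?j - k) = l" by (simp only: lj)
        moreover have "?j - k \<in> {1..n}" using that e ke by auto
        ultimately have "?j - k \<in> ?B" by blast
        then have "q \<le> ?j - k" unfolding q_def by (intro Min_le) auto
        then show False using that k by simp
      qed
      have blk: "odd (?L p)" "?L p = ?L ?j" if "?j < p + k" "p \<le> ?j" for p
        using mid[of p] lj that ke k \<open>odd l\<close> by auto
      have rng: "?j \<in> {1..n}" "k \<le> ?j" using q e ke k by auto
      have "?j \<in> block_ends n c k \<kappa>"
        unfolding block_ends_def
        by (intro CollectI conjI allI impI, rule rng(1), rule rng(2), elim conjE, erule (1) blk(1),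
            elim conjE, erule (1) blk(2), erule ne)
      then show "l \<in> ?L ` block_ends n c k \<kappa>" using lj by blast
    qed
  qed
qed

text \<open>By \<open>raise_entry\<close> only block ends contribute, and only in the critical case.
  They correspond to the values of multiplicity at least \<open>k\<close>, which turns the sum over
  entries into one over the profile.\<close>

lemma shift_up:
  fixes f :: "weight \<Rightarrow> real" and h :: int
  assumes f: "alternating n f" and sd: "strictly_decr n \<kappa>" and k: "1 \<le> k"
    and van: "\<forall>\<mu>. strictly_decr n \<mu> \<and> (\<forall>p. p \<notin> {1..n} \<longrightarrow> \<mu> p = \<kappa> p) \<and>
      coord_sum n \<mu> = coord_sum n \<kappa> + int k \<and> int (card (odds n c \<mu>)) > h - int k \<longrightarrow> f \<mu> = 0"
  shows "int (card (odds n c \<kappa>)) > h \<Longrightarrow> shift n (int k) f \<kappa> = 0"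
    and "int (card (odds n c \<kappa>)) = h \<Longrightarrow>
      (\<And>A. A \<subseteq> odds n c \<kappa> \<Longrightarrow> card A = k \<Longrightarrow> strictly_decr n (add_set \<kappa> A) \<Longrightarrow>
        f (add_set \<kappa> A) = \<tau> (prof n c (add_set \<kappa> A))) \<Longrightarrow>
      shift n (int k) f \<kappa> = (-1) ^ (k - 1) * block_sum k \<tau> (prof n c \<kappa>)"
proof -
  have entry: "int (card (odds n c \<kappa>)) = h \<and> j \<in> block_ends n c k \<kappa>"
    if "j \<in> {1..n}" "int (card (odds n c \<kappa>)) \<ge> h" "f (\<kappa>(j := \<kappa> j + int k)) \<noteq> 0" for j
    by (rule raise_entry[OF f sd that(1) k _ that(2,3)]) (use van in blast)
  show "shift n (int k) f \<kappa> = 0" if "int (card (odds n c \<kappa>)) > h"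
    unfolding shift_def
  proof (rule sum.neutral, rule ballI, rule ccontr)
    fix j assume j: "j \<in> {1..n}" and nz: "f (\<kappa>(j := \<kappa> j + int k)) \<noteq> 0"
    from that have "int (card (odds n c \<kappa>)) \<ge> h" by simp
    from entry[OF j this nz] that show False by simp
  qed
  assume card: "int (card (odds n c \<kappa>)) = h"
    and \<tau>: "\<And>A. A \<subseteq> odds n c \<kappa> \<Longrightarrow> card A = k \<Longrightarrow> strictly_decr n (add_set \<kappa> A) \<Longrightarrow>
        f (add_set \<kappa> A) = \<tau> (prof n c (add_set \<kappa> A))"
  let ?J = "block_ends n c k \<kappa>"
  have J: "?J \<subseteq> {1..n}" by (auto simp: block_ends_def)
  have "shift n (int k) f \<kappa> = (\<Sum>j\<in>?J. f (\<kappa>(j := \<kappa> j + int k)))"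
    unfolding shift_def
  proof (rule sum.mono_neutral_right[OF finite_atLeastAtMost J], rule ballI, rule ccontr)
    fix j assume j: "j \<in> {1..n} - ?J" and nz: "f (\<kappa>(j := \<kappa> j + int k)) \<noteq> 0"
    from card have "int (card (odds n c \<kappa>)) \<ge> h" by simp
    from entry[OF _ this nz] j show False by blast
  qed
  also have "\<dots> = (\<Sum>j\<in>?J. (-1) ^ (k - 1) * \<tau> (prof n c \<kappa> - replicate_mset k (lam c \<kappa> j)))"
  proof (rule sum.cong[OF refl])
    fix j assume j: "j \<in> ?J"
    have "k \<le> j" using j by (simp add: block_ends_def)
    then have "f (add_set \<kappa> {Suc j - k..j}) = \<tau> (prof n c (add_set \<kappa> {Suc j - k..j}))"
      by (intro \<tau> block_subset_odds[OF j k] strictly_decr_add_block[OF sd j]) simp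
    then show "f (\<kappa>(j := \<kappa> j + int k)) = (-1) ^ (k - 1) * \<tau> (prof n c \<kappa> - replicate_mset k (lam c \<kappa> j))"
      by (simp only: raise_block[OF f k j] prof_add_block[OF j k])
  qed
  also have "\<dots> = (-1) ^ (k - 1) * block_sum k \<tau> (prof n c \<kappa>)"
    unfolding block_sum_def sum_distrib_left[symmetric]
    using sum.reindex_bij_betw[OF bij_betw_block_ends[OF sd k, of c],
        of "\<lambda>l. \<tau> (prof n c \<kappa> - replicate_mset k l)"] by simp
  finally show "shift n (int k) f \<kappa> = (-1) ^ (k - 1) * block_sum k \<tau> (prof n c \<kappa>)" .
qed

section \<open>Lowering entries by reversal\<close>

definition sub_set :: "weight \<Rightarrow> nat set \<Rightarrow> weight" where
  "sub_set \<kappa> A = (\<lambda>p. \<kappa> p - (if p \<in> A then 1 else 0))"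

text \<open>Negation with reversal preserves strict decrease and exchanges lowering with raising, so
  that \<open>shift_down\<close> follows from \<open>shift_up\<close>.\<close>

definition mirror :: "nat \<Rightarrow> weight \<Rightarrow> weight" where
  "mirror n \<kappa> = (\<lambda>p. if p \<in> {1..n} then - \<kappa> (n + 1 - p) else \<kappa> p)"

lemma mirror_mirror: "mirror n (mirror n \<kappa>) = \<kappa>"
  by (auto simp: mirror_def fun_eq_iff)

lemma alternatingD:
  "alternating n f \<Longrightarrow> 1 \<le> i \<Longrightarrow> i < n \<Longrightarrow> f (\<kappa>(i := \<kappa> (Suc i), Suc i := \<kappa> i)) = - f \<kappa>"
  unfolding alternating_def by blast

lemma alternating_mirror:
  assumes "alternating n f" shows "alternating n (\<lambda>\<kappa>. f (mirror n \<kappa>))"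
  unfolding alternating_def
proof (intro allI impI)
  fix \<kappa> i assume i: "1 \<le> i \<and> i < n"
  let ?\<mu> = "mirror n \<kappa>"
  have "mirror n (\<kappa>(i := \<kappa> (Suc i), Suc i := \<kappa> i)) = ?\<mu>(n - i := ?\<mu> (Suc (n - i)), Suc (n - i) := ?\<mu> (n - i))"
  proof
    fix p
    have c: "n + 1 - (n - i) = Suc i" "n + 1 - Suc (n - i) = i" "n - i \<in> {1..n}" "Suc (n - i) \<in> {1..n}"
      using i by auto
    consider "p \<notin> {1..n}" | "p = n - i" | "p = Suc (n - i)" | "p \<in> {1..n}" "p \<noteq> n - i" "p \<noteq> Suc (n - i)" by blast
    then show "mirror n (\<kappa>(i := \<kappa> (Suc i), Suc i := \<kappa> i)) p
      = (?\<mu>(n - i := ?\<mu> (Suc (n - i)), Suc (n - i) := ?\<mu> (n - i))) p"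
    proof cases
      case 1
      then have "p \<noteq> i" "p \<noteq> Suc i" "p \<noteq> n - i" "p \<noteq> Suc (n - i)" using i by auto
      with 1 show ?thesis by (auto simp: mirror_def)
    next
      case 2
      then show ?thesis using c by (simp add: mirror_def)
    next
      case 3
      then show ?thesis using c by (simp add: mirror_def)
    next
      case 4
      then have "n + 1 - p \<noteq> i" "n + 1 - p \<noteq> Suc i" by auto
      with 4 show ?thesis by (simp add: mirror_def)
    qed
  qed
  then show "f (mirror n (\<kappa>(i := \<kappa> (Suc i), Suc i := \<kappa> i))) = - f ?\<mu>"
    using i by (simp only:, intro alternatingD[OF assms]) auto
qed

lemma strictly_decr_mirror: "strictly_decr n \<kappa> \<Longrightarrow> strictly_decr n (mirror n \<kappa>)"
  unfolding strictly_decr_def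
proof (intro allI impI)
  fix i assume *: "\<forall>i. 1 \<le> i \<and> i < n \<longrightarrow> \<kappa> (Suc i) < \<kappa> i" and i: "1 \<le> i \<and> i < n"
  have "1 \<le> n - i \<and> n - i < n" using i by auto
  with * have "\<kappa> (Suc (n - i)) < \<kappa> (n - i)" by blast
  then show "mirror n \<kappa> (Suc i) < mirror n \<kappa> i" using i by (auto simp: mirror_def Suc_diff_le)
qed

lemma bij_betw_mirror: "bij_betw (\<lambda>p. n + 1 - p) {1..n} {1..n}" for n :: nat
  by (rule bij_betw_byWitness[where f' = "\<lambda>p. n + 1 - p"]) auto

lemma coord_sum_mirror: "coord_sum n (mirror n \<kappa>) = - coord_sum n \<kappa>"
proof -
  have "coord_sum n (mirror n \<kappa>) = (\<Sum>p=1..n. - \<kappa> (n + 1 - p))"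
    unfolding coord_sum_def by (rule sum.cong) (auto simp: mirror_def)
  also have "\<dots> = (\<Sum>p=1..n. - \<kappa> p)"
    by (rule sum.reindex_bij_betw[OF bij_betw_mirror, of "\<lambda>p. - \<kappa> p"])
  finally show ?thesis by (simp add: coord_sum_def sum_negf)
qed

lemma lam_mirror: "p \<in> {1..n} \<Longrightarrow> lam (int n + 1 - c) (mirror n \<kappa>) p = - lam c \<kappa> (n + 1 - p)"
  by (auto simp: lam_def mirror_def of_nat_diff)

lemma odds_mirror: "odds n (int n + 1 - c) (mirror n \<kappa>) = (\<lambda>p. n + 1 - p) ` odds n c \<kappa>"
proof
  show "odds n (int n + 1 - c) (mirror n \<kappa>) \<subseteq> (\<lambda>p. n + 1 - p) ` odds n c \<kappa>"
  proof
    fix p assume "p \<in> odds n (int n + 1 - c) (mirror n \<kappa>)"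
    then have "p \<in> {1..n}" "odd (lam c \<kappa> (n + 1 - p))" using lam_mirror[of p n c \<kappa>] by (auto simp: odds_def)
    then show "p \<in> (\<lambda>p. n + 1 - p) ` odds n c \<kappa>"
      by (intro image_eqI[of _ _ "n + 1 - p"]) (auto simp: odds_def)
  qed
  show "(\<lambda>p. n + 1 - p) ` odds n c \<kappa> \<subseteq> odds n (int n + 1 - c) (mirror n \<kappa>)"
  proof
    fix p assume "p \<in> (\<lambda>p. n + 1 - p) ` odds n c \<kappa>"
    then obtain q where q: "q \<in> {1..n}" "odd (lam c \<kappa> q)" "p = n + 1 - q" by (auto simp: odds_def)
    then have "p \<in> {1..n}" "n + 1 - p = q" by auto
    then show "p \<in> odds n (int n + 1 - c) (mirror n \<kappa>)"
      using q(2) lam_mirror[of p n c \<kappa>] by (auto simp: odds_def)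
  qed
qed

lemma inj_on_mirror: "A \<subseteq> {1..n} \<Longrightarrow> inj_on (\<lambda>p. n + 1 - p) A" for n :: nat
  by (rule inj_on_inverseI[of _ "\<lambda>p. n + 1 - p"]) auto

lemma odds_subset: "odds n c \<kappa> \<subseteq> {1..n}"
  by (auto simp: odds_def)

lemma card_odds_mirror: "card (odds n (int n + 1 - c) (mirror n \<kappa>)) = card (odds n c \<kappa>)"
  unfolding odds_mirror by (rule card_image[OF inj_on_mirror[OF odds_subset]])

lemma prof_mirror: "prof n (int n + 1 - c) (mirror n \<kappa>) = image_mset uminus (prof n c \<kappa>)"
proof -
  let ?r = "\<lambda>p. n + 1 - p"
  have "mset_set (?r ` odds n c \<kappa>) = image_mset ?r (mset_set (odds n c \<kappa>))"
    by (rule image_mset_mset_set[OF inj_on_mirror[OF odds_subset], symmetric])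
  then have "prof n (int n + 1 - c) (mirror n \<kappa>)
      = image_mset (\<lambda>p. lam (int n + 1 - c) (mirror n \<kappa>) (?r p)) (mset_set (odds n c \<kappa>))"
    by (simp only: prof_def odds_mirror image_mset.compositionality o_def)
  also have "\<dots> = image_mset (\<lambda>p. - lam c \<kappa> p) (mset_set (odds n c \<kappa>))"
  proof (rule image_mset_cong)
    fix p assume "p \<in># mset_set (odds n c \<kappa>)"
    then have p: "p \<in> {1..n}" using odds_subset[of n c \<kappa>] by auto
    then have "?r p \<in> {1..n}" "n + 1 - ?r p = p" by auto
    then show "lam (int n + 1 - c) (mirror n \<kappa>) (?r p) = - lam c \<kappa> p"
      using lam_mirror[of "?r p" n c \<kappa>] by (simp only:)
  qed
  finally show ?thesis by (simp add: prof_def image_mset.compositionality o_def)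
qed

lemma shift_mirror: "shift n (- k) f \<kappa> = shift n k (\<lambda>\<kappa>. f (mirror n \<kappa>)) (mirror n \<kappa>)"
proof -
  have "mirror n ((mirror n \<kappa>)(i := mirror n \<kappa> i + k)) = \<kappa>(n + 1 - i := \<kappa> (n + 1 - i) + - k)"
    if "i \<in> {1..n}" for i
  proof
    fix p
    have "n + 1 - p = i \<longleftrightarrow> p = n + 1 - i" if "p \<in> {1..n}" using that \<open>i \<in> {1..n}\<close> by auto
    then show "mirror n ((mirror n \<kappa>)(i := mirror n \<kappa> i + k)) p = (\<kappa>(n + 1 - i := \<kappa> (n + 1 - i) + - k)) p"
      using that by (cases "p \<in> {1..n}") (auto simp: mirror_def)
  qed
  then have "shift n k (\<lambda>\<kappa>. f (mirror n \<kappa>)) (mirror n \<kappa>)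
      = (\<Sum>i=1..n. f (\<kappa>(n + 1 - i := \<kappa> (n + 1 - i) + - k)))"
    unfolding shift_def by (intro sum.cong refl) simp
  also have "\<dots> = shift n (- k) f \<kappa>"
    unfolding shift_def
    by (rule sum.reindex_bij_betw[OF bij_betw_mirror, of "\<lambda>i. f (\<kappa>(i := \<kappa> i + - k))"])
  finally show ?thesis ..
qed

lemma add_set_mirror:
  assumes "A \<subseteq> {1..n}"
  shows "add_set (mirror n \<kappa>) A = mirror n (sub_set \<kappa> ((\<lambda>p. n + 1 - p) ` A))"
proof
  fix p
  have "n + 1 - p \<in> (\<lambda>p. n + 1 - p) ` A \<longleftrightarrow> p \<in> A" if "p \<in> {1..n}"
  proof
    assume "n + 1 - p \<in> (\<lambda>p. n + 1 - p) ` A"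
    then obtain q where "q \<in> A" "n + 1 - p = n + 1 - q" by blast
    moreover have "q \<in> {1..n}" using \<open>q \<in> A\<close> assms by blast
    ultimately have "p = q" using that by auto
    with \<open>q \<in> A\<close> show "p \<in> A" by simp
  qed blast
  moreover have "p \<notin> A" "p \<notin> (\<lambda>p. n + 1 - p) ` A" if "p \<notin> {1..n}"
    using that assms by (auto simp: subset_iff)
  ultimately show "add_set (mirror n \<kappa>) A p = mirror n (sub_set \<kappa> ((\<lambda>p. n + 1 - p) ` A)) p"
    by (auto simp: add_set_def sub_set_def mirror_def)
qed

text \<open>Reversal negates the parts, which leaves the multiplicities alone.\<close>

lemma block_sum_uminus:
  "block_sum k (\<lambda>m. \<tau> (image_mset uminus m)) (image_mset uminus m) = block_sum k \<tau> m"
proof -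
  have count: "count (image_mset uminus M) l = count M (- l)" for M :: "int multiset" and l
    by (induction M) auto
  have mset: "image_mset uminus (image_mset uminus m - replicate_mset k (- l)) = m - replicate_mset k l" for l :: int
    by (rule multiset_eqI) (simp add: count)
  have "bij_betw uminus {l \<in> set_mset m. k \<le> count m l}
    {l \<in> set_mset (image_mset uminus m). k \<le> count (image_mset uminus m) l}"
    by (rule bij_betw_byWitness[where f' = uminus]) (auto simp: count)
  from sum.reindex_bij_betw[OF this, of "\<lambda>l. \<tau> (image_mset uminus (image_mset uminus m - replicate_mset k l))"]
  show ?thesis unfolding block_sum_def mset by simp
qed

lemma shift_down:
  fixes f :: "weight \<Rightarrow> real" and h :: int
  assumes f: "alternating n f" and sd: "strictly_decr n \<kappa>" and k: "1 \<le> k"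
    and van: "\<forall>\<mu>. strictly_decr n \<mu> \<and> (\<forall>p. p \<notin> {1..n} \<longrightarrow> \<mu> p = \<kappa> p) \<and>
      coord_sum n \<mu> = coord_sum n \<kappa> - int k \<and> int (card (odds n c \<mu>)) > h - int k \<longrightarrow> f \<mu> = 0"
  shows "int (card (odds n c \<kappa>)) > h \<Longrightarrow> shift n (- int k) f \<kappa> = 0"
    and "int (card (odds n c \<kappa>)) = h \<Longrightarrow>
      (\<And>A. A \<subseteq> odds n c \<kappa> \<Longrightarrow> card A = k \<Longrightarrow> strictly_decr n (sub_set \<kappa> A) \<Longrightarrow>
        f (sub_set \<kappa> A) = \<tau> (prof n c (sub_set \<kappa> A))) \<Longrightarrow>
      shift n (- int k) f \<kappa> = (-1) ^ (k - 1) * block_sum k \<tau> (prof n c \<kappa>)"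
proof -
  let ?f = "\<lambda>\<kappa>. f (mirror n \<kappa>)" and ?\<kappa> = "mirror n \<kappa>" and ?c = "int n + 1 - c"
  have cc: "int n + 1 - ?c = c" by simp
  have van': "\<forall>\<mu>. strictly_decr n \<mu> \<and> (\<forall>p. p \<notin> {1..n} \<longrightarrow> \<mu> p = ?\<kappa> p) \<and>
      coord_sum n \<mu> = coord_sum n ?\<kappa> + int k \<and> int (card (odds n ?c \<mu>)) > h - int k \<longrightarrow> ?f \<mu> = 0"
  proof (intro allI impI, elim conjE)
    fix \<mu>
    assume *: "strictly_decr n \<mu>" "\<forall>p. p \<notin> {1..n} \<longrightarrow> \<mu> p = ?\<kappa> p"
      "coord_sum n \<mu> = coord_sum n ?\<kappa> + int k" "int (card (odds n ?c \<mu>)) > h - int k"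
    have "strictly_decr n (mirror n \<mu>)" using *(1) by (rule strictly_decr_mirror)
    moreover have "\<forall>p. p \<notin> {1..n} \<longrightarrow> mirror n \<mu> p = \<kappa> p" using *(2) by (auto simp: mirror_def)
    moreover have "coord_sum n (mirror n \<mu>) = coord_sum n \<kappa> - int k" using *(3) by (simp add: coord_sum_mirror)
    moreover have "int (card (odds n c (mirror n \<mu>))) > h - int k"
      using *(4) card_odds_mirror[of n ?c \<mu>] by (simp only: cc)
    ultimately show "?f \<mu> = 0" using van by blast
  qed
  note up = shift_up[OF alternating_mirror[OF f] strictly_decr_mirror[OF sd] k van']
  show "shift n (- int k) f \<kappa> = 0" if "int (card (odds n c \<kappa>)) > h"
    unfolding shift_mirror using that by (intro up(1)) (simp only: card_odds_mirror)
  assume card: "int (card (odds n c \<kappa>)) = h"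
    and \<tau>: "\<And>A. A \<subseteq> odds n c \<kappa> \<Longrightarrow> card A = k \<Longrightarrow> strictly_decr n (sub_set \<kappa> A) \<Longrightarrow>
        f (sub_set \<kappa> A) = \<tau> (prof n c (sub_set \<kappa> A))"
  have "shift n (int k) ?f ?\<kappa> = (-1) ^ (k - 1) * block_sum k (\<lambda>m. \<tau> (image_mset uminus m)) (prof n ?c ?\<kappa>)"
  proof (rule up(2))
    show "int (card (odds n ?c ?\<kappa>)) = h" using card by (simp only: card_odds_mirror)
    fix A assume A: "A \<subseteq> odds n ?c ?\<kappa>" "card A = k" "strictly_decr n (add_set ?\<kappa> A)"
    let ?A = "(\<lambda>p. n + 1 - p) ` A"
    have An: "A \<subseteq> {1..n}" using A(1) odds_subset by blast
    have eq: "mirror n (add_set ?\<kappa> A) = sub_set \<kappa> ?A"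
      unfolding add_set_mirror[OF An] mirror_mirror ..
    have "?A \<subseteq> odds n c \<kappa>"
      using image_mono[OF A(1), of "\<lambda>p. n + 1 - p"] odds_mirror[of n ?c ?\<kappa>]
      by (simp only: cc mirror_mirror)
    moreover have "card ?A = k" using card_image[OF inj_on_mirror[OF An]] A(2) by simp
    moreover have "strictly_decr n (sub_set \<kappa> ?A)"
      using strictly_decr_mirror[OF A(3)] by (simp only: eq)
    ultimately have "f (sub_set \<kappa> ?A) = \<tau> (prof n c (sub_set \<kappa> ?A))" by (rule \<tau>)
    then show "f (mirror n (add_set ?\<kappa> A)) = \<tau> (image_mset uminus (prof n ?c (add_set ?\<kappa> A)))"
      using prof_mirror[of n ?c "add_set ?\<kappa> A"] by (simp only: eq cc)
  qed
  then show "shift n (- int k) f \<kappa> = (-1) ^ (k - 1) * block_sum k \<tau> (prof n c \<kappa>)"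
    by (simp only: shift_mirror prof_mirror block_sum_uminus)
qed

text \<open>A transposition permutes the summands, each of which changes sign.\<close>

lemma alternating_shift:
  fixes f :: "weight \<Rightarrow> real"
  assumes f: "alternating n f" shows "alternating n (shift n k f)"
  unfolding alternating_def
proof (intro allI impI)
  fix \<kappa> i assume i: "1 \<le> i \<and> i < n"
  let ?t = "Transposition.transpose i (Suc i)"
  let ?s = "\<lambda>\<mu> :: weight. \<mu>(i := \<mu> (Suc i), Suc i := \<mu> i)"
  have t: "?t permutes {1..n}" using i by (intro permutes_swap_id) auto
  have "(?s \<kappa>)(?t j := ?s \<kappa> (?t j) + k) = ?s (\<kappa>(j := \<kappa> j + k))" for j
    by (rule ext) (auto simp: Transposition.transpose_def)
  moreover have "f (?s \<mu>) = - f \<mu>" for \<mu> using i by (intro alternatingD[OF f]) auto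
  ultimately have "f ((?s \<kappa>)(?t j := ?s \<kappa> (?t j) + k)) = - f (\<kappa>(j := \<kappa> j + k))" for j by (simp only:)
  moreover have "shift n k f (?s \<kappa>) = (\<Sum>j=1..n. f ((?s \<kappa>)(?t j := ?s \<kappa> (?t j) + k)))"
    unfolding shift_def using sum.permute[OF t, of "\<lambda>j. f ((?s \<kappa>)(j := ?s \<kappa> j + k))"] by (simp only: o_def)
  ultimately show "shift n k f (?s \<kappa>) = - shift n k f \<kappa>"
    by (simp only: shift_def sum_negf)
qed

subsection \<open>Leading coefficients\<close>

text \<open>\<open>E - coord_sum n \<kappa>\<close> is the excess, \<open>E\<close> being \<open>2d + |\<rho>|\<close> for the coefficients of \<open>theta n\<close> in degree \<open>d\<close>; the bound \<open>B\<close>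
  on it makes an induction possible.\<close>

definition leading :: "nat \<Rightarrow> int \<Rightarrow> int \<Rightarrow> (int multiset \<Rightarrow> real) \<Rightarrow> (weight \<Rightarrow> real) \<Rightarrow> bool" where
  "leading n E B \<tau> g \<longleftrightarrow> alternating n g \<and>
    (\<forall>\<kappa>. strictly_decr n \<kappa> \<and> (\<forall>p. p \<notin> {1..n} \<longrightarrow> \<kappa> p = 0) \<and> E - coord_sum n \<kappa> < B \<longrightarrow>
      (E - coord_sum n \<kappa> < int (card (odds n (int n + 1) \<kappa>)) \<longrightarrow> g \<kappa> = 0) \<and>
      (E - coord_sum n \<kappa> = int (card (odds n (int n + 1) \<kappa>)) \<and> (\<forall>p\<in>{1..n}. 1 \<le> \<kappa> p) \<longrightarrow>
        g \<kappa> = \<tau> (prof n (int n + 1) \<kappa>)))"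

lemma leadingD:
  assumes "leading n E B \<tau> g"
  shows "alternating n g"
    and "strictly_decr n \<kappa> \<Longrightarrow> (\<forall>p. p \<notin> {1..n} \<longrightarrow> \<kappa> p = 0) \<Longrightarrow> E - coord_sum n \<kappa> < B \<Longrightarrow>
      E - coord_sum n \<kappa> < int (card (odds n (int n + 1) \<kappa>)) \<Longrightarrow> g \<kappa> = 0"
    and "strictly_decr n \<kappa> \<Longrightarrow> (\<forall>p. p \<notin> {1..n} \<longrightarrow> \<kappa> p = 0) \<Longrightarrow> E - coord_sum n \<kappa> < B \<Longrightarrow>
      E - coord_sum n \<kappa> = int (card (odds n (int n + 1) \<kappa>)) \<Longrightarrow> (\<forall>p\<in>{1..n}. 1 \<le> \<kappa> p) \<Longrightarrow>
      g \<kappa> = \<tau> (prof n (int n + 1) \<kappa>)"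
  using assms unfolding leading_def by blast+

lemma coord_sum_add_set: "A \<subseteq> {1..n} \<Longrightarrow> coord_sum n (add_set \<kappa> A) = coord_sum n \<kappa> + int (card A)"
  by (simp add: coord_sum_def add_set_def sum.distrib sum.If_cases Int_absorb1)

lemma coord_sum_sub_set: "A \<subseteq> {1..n} \<Longrightarrow> coord_sum n (sub_set \<kappa> A) = coord_sum n \<kappa> - int (card A)"
  by (simp add: coord_sum_def sub_set_def sum_subtractf sum.If_cases Int_absorb1)

lemma odds_sub_set: "A \<subseteq> odds n c \<kappa> \<Longrightarrow> odds n c (sub_set \<kappa> A) = odds n c \<kappa> - A"
  by (auto simp: odds_def sub_set_def lam_def)

lemma strictly_decr_ge:
  assumes "strictly_decr n \<kappa>" "\<forall>p\<in>{1..n}. 1 \<le> \<kappa> p" "p \<in> {1..n}"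
  shows "int n + 1 - int p \<le> \<kappa> p"
proof -
  have p: "1 \<le> p" "p \<le> n" using assms(3) by auto
  then have "1 \<le> \<kappa> n" using assms(2) by simp
  moreover have "\<kappa> n + int (n - p) \<le> \<kappa> p" by (rule strictly_decr_gap[OF assms(1) p order_refl])
  ultimately show ?thesis using p by (simp add: of_nat_diff)
qed

text \<open>Raising an entry by \<open>k\<close> lowers the excess by \<open>k\<close>, the most odd
  parts that it can destroy, so the bound \<open>B\<close> improves by \<open>k\<close>.\<close>

lemma leading_shift_up:
  assumes g: "leading n E B \<tau> g" and k: "1 \<le> k"
  shows "leading n E (B + int k) (\<lambda>m. (-1) ^ (k - 1) * block_sum k \<tau> m) (shift n (int k) g)"
  unfolding leading_def
proof (intro conjI allI impI)
  show "alternating n (shift n (int k) g)" by (rule alternating_shift[OF leadingD(1)[OF g]])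
next
  fix \<kappa>
  let ?c = "int n + 1" and ?h = "E - coord_sum n \<kappa>"
  assume *: "strictly_decr n \<kappa> \<and> (\<forall>p. p \<notin> {1..n} \<longrightarrow> \<kappa> p = 0) \<and> E - coord_sum n \<kappa> < B + int k"
  then have sd: "strictly_decr n \<kappa>" and out: "\<forall>p. p \<notin> {1..n} \<longrightarrow> \<kappa> p = 0" and B: "?h < B + int k" by auto
  have van: "\<forall>\<mu>. strictly_decr n \<mu> \<and> (\<forall>p. p \<notin> {1..n} \<longrightarrow> \<mu> p = \<kappa> p) \<and>
      coord_sum n \<mu> = coord_sum n \<kappa> + int k \<and> int (card (odds n ?c \<mu>)) > ?h - int k \<longrightarrow> g \<mu> = 0"
    using out B by (intro allI impI leadingD(2)[OF g]) auto
  note up = shift_up[OF leadingD(1)[OF g] sd k van]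
  show "shift n (int k) g \<kappa> = 0" if "?h < int (card (odds n ?c \<kappa>))"
    by (rule up(1)[OF that])
  assume **: "?h = int (card (odds n ?c \<kappa>)) \<and> (\<forall>p\<in>{1..n}. 1 \<le> \<kappa> p)"
  show "shift n (int k) g \<kappa> = (-1) ^ (k - 1) * block_sum k \<tau> (prof n ?c \<kappa>)"
  proof (rule up(2))
    show "int (card (odds n ?c \<kappa>)) = ?h" using ** by simp
    fix A assume A: "A \<subseteq> odds n ?c \<kappa>" "card A = k" "strictly_decr n (add_set \<kappa> A)"
    have An: "A \<subseteq> {1..n}" using A(1) odds_subset by blast
    have "card (odds n ?c \<kappa> - A) = card (odds n ?c \<kappa>) - k"
      using A by (simp add: card_Diff_subset finite_subset[OF A(1)])
    moreover have "k \<le> card (odds n ?c \<kappa>)" using A card_mono[OF finite_odds A(1)] by simp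
    ultimately have card: "int (card (odds n ?c (add_set \<kappa> A))) = int (card (odds n ?c \<kappa>)) - int k"
      by (simp only: odds_add_set[OF A(1)] of_nat_diff)
    have out': "\<forall>p. p \<notin> {1..n} \<longrightarrow> add_set \<kappa> A p = 0" using out An by (auto simp: add_set_def)
    have pos: "\<forall>p\<in>{1..n}. 1 \<le> add_set \<kappa> A p" using ** by (auto simp: add_set_def)
    show "g (add_set \<kappa> A) = \<tau> (prof n ?c (add_set \<kappa> A))"
      by (rule leadingD(3)[OF g A(3) out' _ _ pos])
         (use A(2) card ** B coord_sum_add_set[OF An, of \<kappa>] in linarith)+
  qed
qed

text \<open>Lowering an entry by \<open>k\<close> raises \<open>E - coord_sum n \<kappa>\<close> by
  \<open>k\<close>; measured from \<open>E + 2k\<close> it is a drop by \<open>k\<close> again. In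
  the recursion the extra \<open>2k\<close> comes from a degree reduced by \<open>k\<close>.\<close>

lemma leading_shift_down:
  assumes g: "leading n E B \<tau> g" and k: "1 \<le> k"
  shows "leading n (E + 2 * int k) (B + int k) (\<lambda>m. (-1) ^ (k - 1) * block_sum k \<tau> m) (shift n (- int k) g)"
  unfolding leading_def
proof (intro conjI allI impI)
  show "alternating n (shift n (- int k) g)" by (rule alternating_shift[OF leadingD(1)[OF g]])
next
  fix \<kappa>
  let ?c = "int n + 1" and ?h = "E + 2 * int k - coord_sum n \<kappa>"
  assume *: "strictly_decr n \<kappa> \<and> (\<forall>p. p \<notin> {1..n} \<longrightarrow> \<kappa> p = 0) \<and> ?h < B + int k"
  then have sd: "strictly_decr n \<kappa>" and out: "\<forall>p. p \<notin> {1..n} \<longrightarrow> \<kappa> p = 0" and B: "?h < B + int k" by auto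
  have van: "\<forall>\<mu>. strictly_decr n \<mu> \<and> (\<forall>p. p \<notin> {1..n} \<longrightarrow> \<mu> p = \<kappa> p) \<and>
      coord_sum n \<mu> = coord_sum n \<kappa> - int k \<and> int (card (odds n ?c \<mu>)) > ?h - int k \<longrightarrow> g \<mu> = 0"
    using out B by (intro allI impI leadingD(2)[OF g]) auto
  note down = shift_down[OF leadingD(1)[OF g] sd k van]
  show "shift n (- int k) g \<kappa> = 0" if "?h < int (card (odds n ?c \<kappa>))"
    by (rule down(1)[OF that])
  assume **: "?h = int (card (odds n ?c \<kappa>)) \<and> (\<forall>p\<in>{1..n}. 1 \<le> \<kappa> p)"
  show "shift n (- int k) g \<kappa> = (-1) ^ (k - 1) * block_sum k \<tau> (prof n ?c \<kappa>)"
  proof (rule down(2))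
    show "int (card (odds n ?c \<kappa>)) = ?h" using ** by simp
    fix A assume A: "A \<subseteq> odds n ?c \<kappa>" "card A = k" "strictly_decr n (sub_set \<kappa> A)"
    have An: "A \<subseteq> {1..n}" using A(1) odds_subset by blast
    have pos: "1 \<le> sub_set \<kappa> A p" if p: "p \<in> {1..n}" for p
    proof (cases "p \<in> A")
      case True
      then have "odd (lam ?c \<kappa> p)" using A(1) by (auto simp: odds_def)
      moreover have "0 \<le> lam ?c \<kappa> p" using strictly_decr_ge[OF sd _ p] ** by (simp add: lam_def)
      \<comment> \<open>An odd part is at least 1, so the positivity of the entries, which the case
        of excess 0 relies on, survives lowering.\<close>
      ultimately have "1 \<le> lam ?c \<kappa> p" by presburger
      then show ?thesis using p True by (simp add: lam_def sub_set_def)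
    qed (use p ** in \<open>simp add: sub_set_def\<close>)
    have "card (odds n ?c \<kappa> - A) = card (odds n ?c \<kappa>) - k"
      using A by (simp add: card_Diff_subset finite_subset[OF A(1)])
    moreover have "k \<le> card (odds n ?c \<kappa>)" using A card_mono[OF finite_odds A(1)] by simp
    ultimately have card: "int (card (odds n ?c (sub_set \<kappa> A))) = int (card (odds n ?c \<kappa>)) - int k"
      by (simp only: odds_sub_set[OF A(1)] of_nat_diff)
    have out': "\<forall>p. p \<notin> {1..n} \<longrightarrow> sub_set \<kappa> A p = 0" using out An by (auto simp: sub_set_def)
    show "g (sub_set \<kappa> A) = \<tau> (prof n ?c (sub_set \<kappa> A))"
      by (rule leadingD(3)[OF g A(3) out'])
         (use A(2) card ** B coord_sum_sub_set[OF An, of \<kappa>] pos in \<open>linarith | blast\<close>)+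
  qed
qed

lemma alternating_theta: "alternating n (\<lambda>\<kappa>. real_of_int (coef (theta n) d \<kappa>))"
  unfolding alternating_def using coef_theta_swap[of _ n d] by auto

lemma lam_half_sum: "p \<in> {1..n} \<Longrightarrow> lam (int n + 1) \<kappa> p = \<kappa> p - half_sum n p"
  by (auto simp: lam_def half_sum_apply of_nat_diff)

lemma coord_sum_ge_half_sum:
  assumes "strictly_decr n \<kappa>" "\<forall>p\<in>{1..n}. 1 \<le> \<kappa> p"
  shows "coord_sum n (half_sum n) \<le> coord_sum n \<kappa>"
  unfolding coord_sum_def
proof (rule sum_mono)
  fix p assume p: "p \<in> {1..n}"
  then show "half_sum n p \<le> \<kappa> p" using strictly_decr_ge[OF assms p] by (auto simp: half_sum_apply of_nat_diff)
qed

text \<open>Negative excess gives 0, and excess 0 is Littlewood's identity, with leading coefficient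
  1 at the empty profile.\<close>

lemma leading_theta_1:
  "leading n (2 * int d + coord_sum n (half_sum n)) 1 (\<lambda>_. 1) (\<lambda>\<kappa>. real_of_int (coef (theta n) d \<kappa>))"
  unfolding leading_def
proof (intro conjI allI impI alternating_theta)
  fix \<kappa>
  let ?c = "int n + 1" and ?h = "2 * int d + coord_sum n (half_sum n) - coord_sum n \<kappa>"
  assume *: "strictly_decr n \<kappa> \<and> (\<forall>p. p \<notin> {1..n} \<longrightarrow> \<kappa> p = 0) \<and> ?h < 1"
  have ex: "excess n d \<kappa> = ?h" by (simp add: excess_def)
  have zero: "coef (theta n) d \<kappa> = of_bool (even_shape n \<kappa>)" if "?h = 0"
  proof -
    have "coef (psi n) d \<kappa> = of_bool (even_shape n \<kappa>)"
      using * that ex by (intro coef_psi_littlewood) (auto simp: strictly_decr_def less_imp_le)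
    then show ?thesis using that ex by (simp add: coef_psi)
  qed
  have odd: "odds n ?c \<kappa> = {p \<in> {1..n}. odd (\<kappa> p - half_sum n p)}"
    unfolding odds_def by (intro Collect_cong conj_cong refl) (simp add: lam_half_sum)
  show "real_of_int (coef (theta n) d \<kappa>) = 0" if "?h < int (card (odds n ?c \<kappa>))"
  proof (cases "?h = 0")
    case True
    with that have "odds n ?c \<kappa> \<noteq> {}" by auto
    then have "\<not> even_shape n \<kappa>" unfolding odd even_shape_def by blast
    then show ?thesis using zero[OF True] by simp
  next
    case False
    with * have "excess n d \<kappa> < 0" unfolding ex by linarith
    then show ?thesis using coef_theta_neg_excess by simp
  qed
  show "real_of_int (coef (theta n) d \<kappa>) = 1" if "?h = int (card (odds n ?c \<kappa>)) \<and> (\<forall>p\<in>{1..n}. 1 \<le> \<kappa> p)"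
  proof -
    from that * have h0: "?h = 0" and "card (odds n ?c \<kappa>) = 0" by linarith+
    then have "odds n ?c \<kappa> = {}" by simp
    then have "even_shape n \<kappa>" using that unfolding odd even_shape_def by blast
    then show ?thesis using zero[OF h0] by simp
  qed
qed

section \<open>The recursion on leading coefficients\<close>

definition block_pairs :: "nat \<Rightarrow> (int multiset \<Rightarrow> real) \<Rightarrow> int multiset \<Rightarrow> real" where
  "block_pairs k \<tau> m = block_sum k (block_sum k \<tau>) m + block_sum (2 * k) \<tau> m"

lemma block_sum_scale: "block_sum k (\<lambda>m. c * \<tau> m) m = c * block_sum k \<tau> m"
  by (simp add: block_sum_def sum_distrib_left)

lemma block_sum_eq_0: "size m < k \<Longrightarrow> block_sum k \<tau> m = 0"
  unfolding block_sum_def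
proof (rule sum.neutral, rule ballI)
  fix l assume "size m < k" and "l \<in> {l \<in> set_mset m. k \<le> count m l}"
  then show "\<tau> (m - replicate_mset k l) = 0" using count_le_size[of m l] by simp
qed

lemma block_sum_cong:
  assumes "\<And>m'. size m' + k = size m \<Longrightarrow> \<tau> m' = \<tau>' m'"
  shows "block_sum k \<tau> m = block_sum k \<tau>' m"
  unfolding block_sum_def
proof (intro sum.cong refl assms)
  fix l assume "l \<in> {l \<in> set_mset m. k \<le> count m l}"
  then have "replicate_mset k l \<subseteq># m" by (simp add: count_le_replicate_mset_subset_eq)
  then show "size (m - replicate_mset k l) + k = size m"
    by (metis size_Diff_submset size_mset_mono size_replicate_mset le_add_diff_inverse2)
qed

lemma block_pairs_eq_0:
  assumes "size m < 2 * k" shows "block_pairs k \<tau> m = 0"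
proof -
  have "block_sum k (block_sum k \<tau>) m = block_sum k (\<lambda>_. 0) m"
    using assms by (intro block_sum_cong block_sum_eq_0) simp
  also have "\<dots> = 0" by (simp add: block_sum_def)
  finally show ?thesis using assms by (simp add: block_pairs_def block_sum_eq_0)
qed

text \<open>One step of the induction on the excess: by the recursion, the leading coefficient at excess \<open>H\<close>
  is \<open>1/H\<close> times a sum of earlier ones.  Up to the sign \<open>(-1)\<^sup>k\<^sup>-\<^sup>1\<close>, raising and lowering
  have the same effect on leading coefficients, and in this way all signs cancel.\<close>

lemma leading_theta_step:
  fixes n H
  assumes H: "1 \<le> H"
    and lead: "\<And>d. leading n (2 * int d + coord_sum n (half_sum n)) (int H) \<tau> (\<lambda>\<kappa>. real_of_int (coef (theta n) d \<kappa>))"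
    and sd: "strictly_decr n \<kappa>" and out: "\<forall>p. p \<notin> {1..n} \<longrightarrow> \<kappa> p = 0" and ex: "excess n d \<kappa> = int H"
  shows "H < card (odds n (int n + 1) \<kappa>) \<Longrightarrow> coef (theta n) d \<kappa> = 0"
    and "H = card (odds n (int n + 1) \<kappa>) \<Longrightarrow> (\<forall>p\<in>{1..n}. 1 \<le> \<kappa> p) \<Longrightarrow>
      real_of_int (coef (theta n) d \<kappa>) = (\<Sum>k=1..H. block_pairs k \<tau> (prof n (int n + 1) \<kappa>)) / real H"
proof -
  let ?c = "int n + 1" and ?E = "2 * int d + coord_sum n (half_sum n)"
  let ?m = "prof n ?c \<kappa>" and ?o = "card (odds n ?c \<kappa>)"
  define f where "f d \<kappa> = real_of_int (coef (theta n) d \<kappa>)" for d \<kappa>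
  have lead: "leading n (2 * int d + coord_sum n (half_sum n)) (int H) \<tau> (f d)" for d
    using lead unfolding f_def .
  have h: "?E - coord_sum n \<kappa> = int H" using ex by (simp add: excess_def)
  have E: "2 * int (d - k) + coord_sum n (half_sum n) = ?E - 2 * int k" if "k \<le> d" for k
    using that by (simp add: of_nat_diff)
  \<comment> \<open>The excess has dropped by \<open>2k\<close> with all odd parts still
    present.\<close>
  have low: "f (d - k) \<kappa> = 0" if "1 \<le> k" "k \<le> d" "H \<le> ?o" for k
    by (rule leadingD(2)[OF lead[of "d - k", unfolded E[OF that(2)]] sd out]) (use h that in linarith)+
  \<comment> \<open>The excess falls by \<open>4k\<close>, while two moves by \<open>k\<close>
    destroy at most \<open>2k\<close> odd parts.\<close>
  have low_pp: "shift n (int k) (shift n (int k) (f (d - k))) \<kappa> = 0" if k: "1 \<le> k" "k \<le> d" "H \<le> ?o" for k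
    by (rule leadingD(2)[OF leading_shift_up[OF leading_shift_up[OF lead[of "d - k", unfolded E[OF k(2)]] k(1)] k(1)] sd out])
       (use h k in linarith)+
  have low_p2: "shift n (2 * int k) (f (d - k)) \<kappa> = 0" if k: "1 \<le> k" "k \<le> d" "H \<le> ?o" for k
  proof -
    have "1 \<le> 2 * k" using k by simp
    from leadingD(2)[OF leading_shift_up[OF lead[of "d - k", unfolded E[OF k(2)]] this] sd out] h k
    show ?thesis by simp
  qed
  \<comment> \<open>Degree \<open>d - k\<close> costs \<open>2k\<close> in \<open>E\<close>, and the
    downward move gives it back.\<close>
  have lead_mp: "leading n ?E (int H + int k + int k) (\<lambda>m. (-1) ^ (k - 1) * block_sum k (\<lambda>m. (-1) ^ (k - 1) * block_sum k \<tau> m) m)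
      (shift n (- int k) (shift n (int k) (f (d - k))))" if k: "1 \<le> k" "k \<le> d" for k
    using leading_shift_down[OF leading_shift_up[OF lead[of "d - k", unfolded E[OF k(2)]] k(1)] k(1)] by simp
  have lead_pp: "leading n ?E (int H + int k + int k) (\<lambda>m. (-1) ^ (k - 1) * block_sum k (\<lambda>m. (-1) ^ (k - 1) * block_sum k \<tau> m) m)
      (shift n (int k) (shift n (int k) (f d)))" if k: "1 \<le> k" for k
    by (rule leading_shift_up[OF leading_shift_up[OF lead k] k])
  have lead_p2: "leading n ?E (int H + int (2 * k)) (\<lambda>m. (-1) ^ (2 * k - 1) * block_sum (2 * k) \<tau> m)
      (shift n (int (2 * k)) (f d))" if k: "1 \<le> k" for k
    by (rule leading_shift_up[OF lead]) (use k in simp)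
  obtain K where K: "d \<le> K" "H \<le> K" and rec: "excess n d \<kappa> * coef (theta n) d \<kappa>
    = (\<Sum>k=1..d. 2 * (shift n (- int k) (shift n (int k) (coef (theta n) (d - k))) \<kappa> - int n * coef (theta n) (d - k) \<kappa>)
        + 2 * (shift n (int k) (shift n (int k) (coef (theta n) (d - k))) \<kappa> + shift n (2 * int k) (coef (theta n) (d - k)) \<kappa>))
      - (\<Sum>k=1..K. shift n (int k) (shift n (int k) (coef (theta n) d)) \<kappa> + shift n (2 * int k) (coef (theta n) d) \<kappa>)"
  proof -
    from eventually_conj[OF eventually_ge_at_top[of "max d H"] theta_recursion[of n d \<kappa>]]
    show ?thesis using that unfolding eventually_at_top_linorder by (metis (no_types, lifting) max.boundedE order_refl)
  qed
  have real_shift: "real_of_int (shift n k g \<mu>) = shift n k (\<lambda>\<mu>. real_of_int (g \<mu>)) \<mu>" for k g \<mu>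
    by (simp add: shift_def)
  from rec have "real_of_int (excess n d \<kappa> * coef (theta n) d \<kappa>) = real_of_int (
    (\<Sum>k=1..d. 2 * (shift n (- int k) (shift n (int k) (coef (theta n) (d - k))) \<kappa> - int n * coef (theta n) (d - k) \<kappa>)
        + 2 * (shift n (int k) (shift n (int k) (coef (theta n) (d - k))) \<kappa> + shift n (2 * int k) (coef (theta n) (d - k)) \<kappa>))
      - (\<Sum>k=1..K. shift n (int k) (shift n (int k) (coef (theta n) d)) \<kappa> + shift n (2 * int k) (coef (theta n) d) \<kappa>))"
    by (simp only:)
  then have rec: "real H * f d \<kappa>
    = (\<Sum>k=1..d. 2 * (shift n (- int k) (shift n (int k) (f (d - k))) \<kappa> - real n * f (d - k) \<kappa>)
        + 2 * (shift n (int k) (shift n (int k) (f (d - k))) \<kappa> + shift n (2 * int k) (f (d - k)) \<kappa>))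
      - (\<Sum>k=1..K. shift n (int k) (shift n (int k) (f d)) \<kappa> + shift n (2 * int k) (f d) \<kappa>)"
    unfolding ex f_def by (simp add: real_shift)
  have rec': "real H * f d \<kappa> = (\<Sum>k=1..d. 2 * shift n (- int k) (shift n (int k) (f (d - k))) \<kappa>)
      - (\<Sum>k=1..K. shift n (int k) (shift n (int k) (f d)) \<kappa> + shift n (2 * int k) (f d) \<kappa>)" if "H \<le> ?o"
    unfolding rec using that by (intro arg_cong2[of _ _ _ _ minus] sum.cong refl) (simp_all add: low low_pp low_p2)
  show "coef (theta n) d \<kappa> = 0" if o: "H < ?o"
  proof -
    have "shift n (- int k) (shift n (int k) (f (d - k))) \<kappa> = 0" if "k \<in> {1..d}" for k
      using that o h by (intro leadingD(2)[OF lead_mp[of k] sd out]) auto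
    moreover have "shift n (int k) (shift n (int k) (f d)) \<kappa> = 0" if "k \<in> {1..K}" for k
      using that o h by (intro leadingD(2)[OF lead_pp[of k] sd out]) auto
    moreover have "shift n (2 * int k) (f d) \<kappa> = 0" if "k \<in> {1..K}" for k
      using that o h leadingD(2)[OF lead_p2[of k] sd out] by auto
    ultimately have "real H * f d \<kappa> = 0" using rec' o by simp
    then show ?thesis using H by (simp add: f_def)
  qed
  assume o: "H = ?o" and pos: "\<forall>p\<in>{1..n}. 1 \<le> \<kappa> p"
  have sq: "(-1) ^ (k - 1) * block_sum k (\<lambda>m. (-1) ^ (k - 1) * block_sum k \<tau> m) ?m = block_sum k (block_sum k \<tau>) ?m" for k
    unfolding block_sum_scale by (simp add: mult.assoc[symmetric] power_add[symmetric])
  have mp: "shift n (- int k) (shift n (int k) (f (d - k))) \<kappa> = block_sum k (block_sum k \<tau>) ?m" if "k \<in> {1..d}" for k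
    using that o h leadingD(3)[OF lead_mp[of k] sd out _ _ pos] by (simp only: sq) auto
  have pp: "shift n (int k) (shift n (int k) (f d)) \<kappa> = block_sum k (block_sum k \<tau>) ?m" if "k \<in> {1..K}" for k
    using that o h leadingD(3)[OF lead_pp[of k] sd out _ _ pos] by (simp only: sq) auto
  have p2: "shift n (2 * int k) (f d) \<kappa> = - block_sum (2 * k) \<tau> ?m" if "k \<in> {1..K}" for k
  proof -
    have "(-1 :: real) ^ (2 * k - 1) = - 1" using that by (cases k) auto
    then show ?thesis using that o h leadingD(3)[OF lead_p2[of k] sd out _ _ pos] by auto
  qed
  \<comment> \<open>As \<open>H = 2d - |\<lambda>|\<close>, a pair of blocks with
    \<open>k > d\<close> would need more than \<open>H\<close> odd parts; so the sum up to
    \<open>d\<close> can be extended to \<open>K\<close>.\<close>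
  have "H \<le> 2 * d" using coord_sum_ge_half_sum[OF sd pos] h by linarith
  have size: "size ?m = H" using o by (simp add: size_prof)
  have "(\<Sum>k=1..d. 2 * shift n (- int k) (shift n (int k) (f (d - k))) \<kappa>) = (\<Sum>k=1..d. 2 * block_sum k (block_sum k \<tau>) ?m)"
    using mp by (intro sum.cong) auto
  also have "\<dots> = (\<Sum>k=1..K. 2 * block_sum k (block_sum k \<tau>) ?m)"
  proof (rule sum.mono_neutral_left)
    show "\<forall>k\<in>{1..K} - {1..d}. 2 * block_sum k (block_sum k \<tau>) ?m = 0"
    proof
      fix k assume "k \<in> {1..K} - {1..d}"
      then have lt: "size ?m < 2 * k" using \<open>H \<le> 2 * d\<close> size by auto
      have "block_pairs k \<tau> ?m = 0" by (rule block_pairs_eq_0[OF lt])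
      then show "2 * block_sum k (block_sum k \<tau>) ?m = 0"
        using block_sum_eq_0[OF lt] by (simp add: block_pairs_def)
    qed
  qed (use K in auto)
  finally have "real H * f d \<kappa> = (\<Sum>k=1..K. 2 * block_sum k (block_sum k \<tau>) ?m)
      - (\<Sum>k=1..K. block_sum k (block_sum k \<tau>) ?m - block_sum (2 * k) \<tau> ?m)"
    unfolding rec'[OF eq_refl[OF o]] using pp p2 by simp
  \<comment> \<open>With \<open>a\<close> for the term of two blocks and \<open>b\<close> for that
    of one double block, \<open>2a - (a - b) = a + b\<close>.\<close>
  also have "\<dots> = (\<Sum>k=1..K. block_pairs k \<tau> ?m)"
    unfolding sum_subtractf[symmetric] by (intro sum.cong refl) (simp add: block_pairs_def)
  also have "\<dots> = (\<Sum>k=1..H. block_pairs k \<tau> ?m)"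
    using K size by (intro sum.mono_neutral_right) (auto intro!: block_pairs_eq_0)
  finally show "real_of_int (coef (theta n) d \<kappa>) = (\<Sum>k=1..H. block_pairs k \<tau> ?m) / real H"
    using H by (simp add: f_def field_simps)
qed

section \<open>Positivity of the leading coefficients\<close>

lemma block_sum_nonneg:
  assumes "\<And>m'. size m' + k = size m \<Longrightarrow> 0 \<le> \<tau> m'" shows "0 \<le> block_sum k \<tau> m"
proof -
  have "block_sum k \<tau> m = block_sum k (\<lambda>m'. \<bar>\<tau> m'\<bar>) m" using assms by (intro block_sum_cong) simp
  also have "\<dots> \<ge> 0" unfolding block_sum_def by (intro sum_nonneg) simp
  finally show ?thesis .
qed

lemma block_sum_pos:
  assumes "\<And>m'. size m' + k = size m \<Longrightarrow> 0 \<le> \<tau> m'"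
    and "l \<in># m" "k \<le> count m l" "0 < \<tau> (m - replicate_mset k l)"
  shows "0 < block_sum k \<tau> m"
proof -
  have "\<tau> (m - replicate_mset k l) \<le> block_sum k (\<lambda>m'. \<bar>\<tau> m'\<bar>) m"
    unfolding block_sum_def using assms(2,3)
    by (intro order_trans[OF abs_ge_self member_le_sum[of l _ "\<lambda>l. \<bar>\<tau> (m - replicate_mset k l)\<bar>"]]) auto
  also have "\<dots> = block_sum k \<tau> m" using assms(1) by (intro block_sum_cong) simp
  finally show ?thesis using assms(4) by linarith
qed

lemma block_pairs_nonneg:
  assumes "\<And>m'. size m' + 2 * k = size m \<Longrightarrow> 0 \<le> \<tau> m'"
  shows "0 \<le> block_pairs k \<tau> m"
  unfolding block_pairs_def
  by (intro add_nonneg_nonneg block_sum_nonneg) (use assms in auto)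

text \<open>Any two parts, equal or not, can be removed one after the other, so \<open>k = 1\<close>
  gives a positive term for every profile with at least two parts.\<close>

lemma block_pairs_pos:
  assumes nonneg: "\<And>m'. size m' + 2 = size m \<Longrightarrow> 0 < \<tau> m'" and two: "2 \<le> size m"
  shows "0 < block_pairs 1 \<tau> m"
proof -
  have nn: "0 \<le> \<tau> m'" if "size m' + 2 = size m" for m' using nonneg[OF that] by simp
  have s1: "0 \<le> block_sum 1 (block_sum 1 \<tau>) m" by (intro block_sum_nonneg nn) simp
  have s2: "0 \<le> block_sum 2 \<tau> m" by (intro block_sum_nonneg nn) simp
  from two obtain l m1 where m: "m = add_mset l m1" by (metis multiset_nonemptyE not_numeral_le_zero size_empty mset_add)
  with two have "m1 \<noteq> {#}" by auto
  then obtain l' m2 where m1: "m1 = add_mset l' m2" by (metis multiset_nonemptyE mset_add)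
  have "0 < block_sum 1 \<tau> m1"
  proof (rule block_sum_pos[of 1 m1 \<tau> l'])
    show "0 < \<tau> (m1 - replicate_mset 1 l')" using nonneg[of m2] m m1 by simp
  qed (use nn m m1 in auto)
  then have "0 < block_sum 1 (block_sum 1 \<tau>) m"
  proof (intro block_sum_pos[of 1 m "block_sum 1 \<tau>" l])
    show "0 \<le> block_sum 1 \<tau> m'" if "size m' + 1 = size m" for m'
      using that by (intro block_sum_nonneg nn) simp
  qed (use m in auto)
  with s2 show ?thesis by (simp add: block_pairs_def)
qed

text \<open>The bounds on the excess and on the profile size grow together. New values are built
  from sizes of the same parity, and the even sizes start from the value 1 at the empty
  profile.\<close>

lemma leading_theta:
  "\<exists>\<tau>. (\<forall>d. leading n (2 * int d + coord_sum n (half_sum n)) (int (Suc H)) \<tau> (\<lambda>\<kappa>. real_of_int (coef (theta n) d \<kappa>)))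
    \<and> (\<forall>m. size m \<le> H \<longrightarrow> 0 \<le> \<tau> m \<and> (even (size m) \<longrightarrow> 0 < \<tau> m))"
proof (induction H)
  case 0
  show ?case using leading_theta_1 by (intro exI[of _ "\<lambda>_. 1"]) auto
next
  case (Suc H)
  let ?E = "\<lambda>d. 2 * int d + coord_sum n (half_sum n)" and ?H = "Suc H" and ?c = "int n + 1"
  let ?f = "\<lambda>d \<kappa>. real_of_int (coef (theta n) d \<kappa>)"
  from Suc.IH obtain \<tau> where lead: "\<And>d. leading n (?E d) (int ?H) \<tau> (?f d)"
    and pos: "\<And>m. size m \<le> H \<Longrightarrow> 0 \<le> \<tau> m \<and> (even (size m) \<longrightarrow> 0 < \<tau> m)" by blast
  \<comment> \<open>Old values are kept; a profile of size \<open>Suc H\<close> matters only at the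
    new excess, where the recursion dictates its value.\<close>
  define \<sigma> where "\<sigma> m = (if size m \<le> H then \<tau> m else (\<Sum>k=1..?H. block_pairs k \<tau> m) / real ?H)" for m
  have "leading n (?E d) (int (Suc ?H)) \<sigma> (?f d)" for d
    unfolding leading_def
  proof (intro conjI allI impI alternating_theta)
    fix \<kappa> assume *: "strictly_decr n \<kappa> \<and> (\<forall>p. p \<notin> {1..n} \<longrightarrow> \<kappa> p = 0) \<and> ?E d - coord_sum n \<kappa> < int (Suc ?H)"
    then have sd: "strictly_decr n \<kappa>" and out: "\<forall>p. p \<notin> {1..n} \<longrightarrow> \<kappa> p = 0" by blast+
    have ex: "excess n d \<kappa> = int ?H" if "\<not> ?E d - coord_sum n \<kappa> < int ?H"
      using that * by (simp add: excess_def)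
    note step = leading_theta_step[OF _ lead sd out ex]
    show "?f d \<kappa> = 0" if o: "?E d - coord_sum n \<kappa> < int (card (odds n ?c \<kappa>))"
    proof (cases "?E d - coord_sum n \<kappa> < int ?H")
      case True
      show ?thesis by (rule leadingD(2)[OF lead sd out True o])
    next
      case False
      then show ?thesis using step(1)[OF _ False] o * by simp
    qed
    assume o: "?E d - coord_sum n \<kappa> = int (card (odds n ?c \<kappa>)) \<and> (\<forall>p\<in>{1..n}. 1 \<le> \<kappa> p)"
    show "?f d \<kappa> = \<sigma> (prof n ?c \<kappa>)"
    proof (cases "?E d - coord_sum n \<kappa> < int ?H")
      case True
      then have "size (prof n ?c \<kappa>) \<le> H" using o by (simp add: size_prof)
      then show ?thesis using leadingD(3)[OF lead sd out True] o by (simp add: \<sigma>_def)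
    next
      case False
      then have "?H = card (odds n ?c \<kappa>)" using o * by linarith
      then show ?thesis using step(2)[OF _ False] o by (simp add: \<sigma>_def size_prof)
    qed
  qed
  moreover have "0 \<le> \<sigma> m \<and> (even (size m) \<longrightarrow> 0 < \<sigma> m)" if "size m \<le> ?H" for m
  proof (cases "size m \<le> H")
    case True
    then show ?thesis using pos by (simp add: \<sigma>_def)
  next
    case False
    with that have size: "size m = ?H" by simp
    have nonneg: "0 \<le> block_pairs k \<tau> m" if "k \<in> {1..?H}" for k
      using that pos size by (intro block_pairs_nonneg) auto
    have "0 < (\<Sum>k=1..?H. block_pairs k \<tau> m)" if "even (size m)"
    proof (rule sum_pos2[of _ 1])
      have "2 \<le> size m" using that size by (cases H) auto
      then show "0 < block_pairs 1 \<tau> m" using pos size that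
        by (intro block_pairs_pos) (metis add_2_eq_Suc' even_Suc_Suc_iff le_SucI nat_le_linear not_less_eq_eq old.nat.inject)
    qed (use nonneg in auto)
    moreover have "0 \<le> (\<Sum>k=1..?H. block_pairs k \<tau> m)" by (intro sum_nonneg nonneg)
    ultimately show ?thesis using False by (simp add: \<sigma>_def del: sum.cl_ivl_Suc)
  qed
  ultimately show ?case by blast
qed

subsection \<open>The lowest exponent\<close>

lemma partition_antimono:
  assumes "is_partition n p" "1 \<le> i" shows "p (Suc i) \<le> p i"
  using assms by (simp add: is_partition_def)

text \<open>Let \<open>2d = |\<lambda>| + o\<close> with \<open>o\<close> odd parts. In degree
  \<open>d\<close> the excess is exactly \<open>o\<close>, and the coefficient of
  \<open>theta\<close> is a value of \<open>\<tau>\<close> at an even size; in smaller degrees the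
  excess is below \<open>o\<close>. The factor \<open>c\<close> with \<open>c(0) \<noteq> 0\<close>
  does not move the lowest exponent.\<close>

lemma subdegree_gen_exponent:
  assumes p: "is_partition n p" and even: "even (\<Sum>i=1..n. p i)"
  shows "gen_exponent n (partition_weight p) \<noteq> 0"
    and "2 * subdegree (gen_exponent n (partition_weight p)) = (\<Sum>i=1..n. p i + of_bool (odd (p i)))"
proof -
  let ?\<mu> = "partition_weight p" and ?c = "int n + 1"
  let ?\<kappa> = "?\<mu> + half_sum n"
  let ?o = "\<Sum>i=1..n. of_bool (odd (p i)) :: nat"
  have sd: "strictly_decr n ?\<kappa>"
    unfolding strictly_decr_def
  proof (intro allI impI)
    fix i assume i: "1 \<le> i \<and> i < n"
    then show "?\<kappa> (Suc i) < ?\<kappa> i"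
      using partition_antimono[OF p, of i] by (simp add: partition_weight_def half_sum_apply)
  qed
  have out: "\<forall>k. k \<notin> {1..n} \<longrightarrow> ?\<kappa> k = 0"
    using p by (auto simp: is_partition_def partition_weight_def half_sum_apply not_le Suc_le_eq)
  have pos: "\<forall>k\<in>{1..n}. 1 \<le> ?\<kappa> k" by (auto simp: partition_weight_def half_sum_apply)
  have odds: "odds n ?c ?\<kappa> = {k \<in> {1..n}. odd (p k)}"
    unfolding odds_def
    by (intro Collect_cong conj_cong refl) (simp add: lam_half_sum partition_weight_def)
  have card: "card (odds n ?c ?\<kappa>) = ?o"
    unfolding odds by (simp add: of_bool_def sum.If_cases Int_def conj_commute)
  have ex: "excess n d ?\<kappa> = 2 * int d - int (\<Sum>i=1..n. p i)" for d
    unfolding excess_def by (simp add: coord_sum_def partition_weight_def sum.distrib)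
  have "even ((\<Sum>i=1..n. p i) + ?o)"
    unfolding sum.distrib[symmetric] by (rule dvd_sum) auto
  then obtain d where d: "(\<Sum>i=1..n. p i) + ?o = 2 * d" by (rule evenE)
  have o: "even ?o" using d even by (metis dvd_triv_left even_add)
  obtain \<tau> where lead: "\<And>d. leading n (2 * int d + coord_sum n (half_sum n)) (int (Suc ?o)) \<tau> (\<lambda>\<kappa>. real_of_int (coef (theta n) d \<kappa>))"
    and \<tau>: "\<And>m. size m \<le> ?o \<Longrightarrow> 0 \<le> \<tau> m \<and> (even (size m) \<longrightarrow> 0 < \<tau> m)"
    using leading_theta[of n ?o] by blast
  have h: "2 * int d' + coord_sum n (half_sum n) - coord_sum n ?\<kappa> = 2 * int d' - int (\<Sum>i=1..n. p i)" for d'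
    using ex[of d'] by (simp add: excess_def)
  have nz: "coef (theta n) d ?\<kappa> \<noteq> 0"
  proof -
    have "real_of_int (coef (theta n) d ?\<kappa>) = \<tau> (prof n ?c ?\<kappa>)"
      by (rule leadingD(3)[OF lead sd out _ _ pos]) (use h[of d] d card in linarith)+
    moreover have "0 < \<tau> (prof n ?c ?\<kappa>)" using \<tau>[of "prof n ?c ?\<kappa>"] o card by (simp add: size_prof)
    ultimately show ?thesis by auto
  qed
  have z: "coef (theta n) d' ?\<kappa> = 0" if "d' < d" for d'
  proof -
    have "real_of_int (coef (theta n) d' ?\<kappa>) = 0"
      by (rule leadingD(2)[OF lead sd out]) (use h[of d'] d card that in linarith)+
    then show ?thesis by simp
  qed
  let ?C = "coef_series (theta n) ?\<kappa>"
  have C: "?C \<noteq> 0" using nz by (auto simp: coef_series_def fps_eq_iff)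
  have "subdegree ?C = d" using nz z by (intro subdegreeI) (simp_all add: coef_series_def)
  moreover obtain c where c: "fps_nth c 0 \<noteq> 0" "gen_exponent n ?\<mu> = c * ?C"
    by (rule gen_exponent_theta)
  moreover from c(1) have "c \<noteq> 0" "subdegree c = 0" by auto
  ultimately have "gen_exponent n ?\<mu> \<noteq> 0" "subdegree (gen_exponent n ?\<mu>) = d"
    using C by simp_all
  then show "gen_exponent n ?\<mu> \<noteq> 0" "2 * subdegree (gen_exponent n ?\<mu>) = (\<Sum>i=1..n. p i + of_bool (odd (p i)))"
    using d by (simp_all add: sum.distrib)
qed

section \<open>From columns to parts\<close>

lemma fund_weight_apply: "fund_weight j k = (if k \<in> {1..j} then 1 else 0)"
proof -
  have "fund_weight j k = (\<Sum>i=1..j. if i = k then 1 else 0)"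
    unfolding fund_weight_def weight_sum_apply by (rule sum.cong) (auto simp: eps_def)
  then show ?thesis by simp
qed

text \<open>Summation by parts: \<open>b i\<close> occurs in the \<open>n + 1 - i\<close> partial
  sums with \<open>m \<ge> i\<close>.\<close>

lemma sum_partial_sums:
  fixes b :: "nat \<Rightarrow> int"
  shows "(\<Sum>i=1..n. int (n + 1 - i) * b i) = (\<Sum>m=1..n. \<Sum>i=1..m. b i)"
proof (induction n)
  case (Suc n)
  have "(\<Sum>i=1..n. int (Suc n + 1 - i) * b i) = (\<Sum>i=1..n. int (n + 1 - i) * b i) + (\<Sum>i=1..n. b i)"
    unfolding sum.distrib[symmetric] by (intro sum.cong) (auto simp: of_nat_diff algebra_simps)
  then show ?case using Suc by simp
qed simp

text \<open>The adjusted numbers are the increments of the partial sums rounded up to even: an odd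
  \<open>a i\<close> changes the parity, and its correction by 1 up or down is the rounding that
  appears or disappears.\<close>

lemma sum_even_adjust:
  "(\<Sum>i=1..m. even_adjust a i) = int (partial_sum a m) + of_bool (odd (partial_sum a m))"
proof (induction m)
  case (Suc m)
  have "partial_sum a (Suc m) = partial_sum a m + a (Suc m)" by (simp add: partial_sum_def)
  with Suc show ?case by (auto simp: even_adjust_def)
qed (simp add: partial_sum_def)

theorem theorem7p7:
  fixes n :: nat and p a :: "nat \<Rightarrow> nat"
  assumes "n \<ge> 1"
    and "is_partition n p"
    and "even (\<Sum>i = 1..n. p i)"
    and "\<And>k. partition_weight p k = (\<Sum>i = 1..n. int (a i) * fund_weight (n + 1 - i) k)"
  shows "gen_exponent n (partition_weight p) \<noteq> 0
    \<and> real (subdegree (gen_exponent n (partition_weight p)))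
        = 1 / 2 * (\<Sum>i = 1..n. real (n + 1 - i) * real_of_int (even_adjust a i))
    \<and> 1 / 2 * (\<Sum>i = 1..n. real (n + 1 - i) * real_of_int (even_adjust a i))
        = real (\<Sum>i = 1..n. p i) / 2
          + 1 / 2 * (\<Sum>i \<in> {i \<in> {1..n}. odd (a i)}.
                       (-1) ^ (partial_sum a i - 1) * real (n + 1 - i))"
proof (intro conjI)
  show "gen_exponent n (partition_weight p) \<noteq> 0"
    by (rule subdegree_gen_exponent(1)[OF assms(2,3)])
  \<comment> \<open>A part counts the columns of height at least \<open>k\<close>, and
    \<open>n + 1 - i \<ge> k\<close> means \<open>i \<le> n + 1 - k\<close>.\<close>
  have parts: "p k = partial_sum a (n + 1 - k)" if k: "k \<in> {1..n}" for k
  proof -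
    have "int (p k) = (\<Sum>i=1..n. if i \<in> {1..n + 1 - k} then int (a i) else 0)"
      using assms(4)[of k] k unfolding partition_weight_def
      by (auto simp: fund_weight_apply intro!: sum.cong)
    also have "\<dots> = (\<Sum>i\<in>{1..n} \<inter> {1..n + 1 - k}. int (a i))" by (rule sum.inter_restrict[symmetric]) simp
    also have "{1..n} \<inter> {1..n + 1 - k} = {1..n + 1 - k}" using k by auto
    finally have "int (p k) = int (partial_sum a (n + 1 - k))"
      by (simp only: partial_sum_def of_nat_sum)
    then show ?thesis by (simp only: of_nat_eq_iff)
  qed
  have sum_parts: "(\<Sum>m=1..n. F (partial_sum a m)) = (\<Sum>k=1..n. F (p k))" for F :: "nat \<Rightarrow> int"
  proof -
    have "(\<Sum>k=1..n. F (p k)) = (\<Sum>k=1..n. F (partial_sum a (n + 1 - k)))"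
      by (rule sum.cong) (simp_all only: parts)
    also have "\<dots> = (\<Sum>m=1..n. F (partial_sum a m))"
      by (rule sum.reindex_bij_betw[OF bij_betw_mirror, of "\<lambda>m. F (partial_sum a m)"])
    finally show ?thesis ..
  qed
  have "(\<Sum>i=1..n. int (n + 1 - i) * even_adjust a i) = (\<Sum>k=1..n. int (p k) + of_bool (odd (p k)))"
    unfolding sum_partial_sums sum_even_adjust by (rule sum_parts)
  also have "\<dots> = 2 * int (subdegree (gen_exponent n (partition_weight p)))"
    using arg_cong[OF subdegree_gen_exponent(2)[OF assms(2,3)], of int] by simp
  finally have "real_of_int (\<Sum>i=1..n. int (n + 1 - i) * even_adjust a i)
      = real_of_int (2 * int (subdegree (gen_exponent n (partition_weight p))))"
    by (simp only:)
  then have "(\<Sum>i=1..n. real (n + 1 - i) * real_of_int (even_adjust a i))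
      = 2 * real (subdegree (gen_exponent n (partition_weight p)))"
    by simp
  then show "real (subdegree (gen_exponent n (partition_weight p)))
        = 1 / 2 * (\<Sum>i = 1..n. real (n + 1 - i) * real_of_int (even_adjust a i))"
    by simp
  have "(\<Sum>i=1..n. int (n + 1 - i) * int (a i)) = (\<Sum>m=1..n. int (partial_sum a m))"
    unfolding sum_partial_sums by (simp add: partial_sum_def)
  also have "\<dots> = int (\<Sum>k=1..n. p k)"
    using sum_parts[of int] by simp
  finally have "real_of_int (\<Sum>i=1..n. int (n + 1 - i) * int (a i)) = real_of_int (int (\<Sum>k=1..n. p k))"
    by (simp only:)
  then have A: "(\<Sum>i=1..n. real (n + 1 - i) * real (a i)) = real (\<Sum>k=1..n. p k)" by simp
  have adj: "real_of_int (even_adjust a i) = real (a i) + (if odd (a i) then (-1) ^ (partial_sum a i - 1) else 0)"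
    if "i \<in> {1..n}" for i
  proof (cases "odd (a i)")
    case True
    \<comment> \<open>Makes the truncated subtraction in the exponent
      \<open>partial_sum a i - 1\<close> exact, since an odd \<open>a i\<close> is at least
      1.\<close>
    have "a i \<le> partial_sum a i"
      unfolding partial_sum_def using that by (intro member_le_sum) auto
    with True have "1 \<le> partial_sum a i" by (cases "a i") auto
    then show ?thesis using True by (cases "partial_sum a i") (auto simp: even_adjust_def)
  qed (simp add: even_adjust_def)
  have "(\<Sum>i=1..n. real (n + 1 - i) * real_of_int (even_adjust a i))
      = (\<Sum>i=1..n. real (n + 1 - i) * real (a i))
        + (\<Sum>i=1..n. if odd (a i) then (-1) ^ (partial_sum a i - 1) * real (n + 1 - i) else 0)"
    unfolding sum.distrib[symmetric] by (intro sum.cong refl) (simp add: adj distrib_left)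
  also have "(\<Sum>i=1..n. if odd (a i) then (-1) ^ (partial_sum a i - 1) * real (n + 1 - i) else 0)
      = (\<Sum>i \<in> {i \<in> {1..n}. odd (a i)}. (-1) ^ (partial_sum a i - 1) * real (n + 1 - i))"
    by (rule sum.inter_filter[symmetric]) simp
  finally show "1 / 2 * (\<Sum>i = 1..n. real (n + 1 - i) * real_of_int (even_adjust a i))
        = real (\<Sum>i = 1..n. p i) / 2
          + 1 / 2 * (\<Sum>i \<in> {i \<in> {1..n}. odd (a i)}.
                       (-1) ^ (partial_sum a i - 1) * real (n + 1 - i))"
    unfolding A by simp
qed

end
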